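(* Let $(I,H)$ be a finite quiver, possibly with loops. For each $\nu\in\mathbb N[I]$, there is an isomorphism $R(\nu)\xrightarrow{\sim}\mathcal R_\nu$ of graded algebras from the KLR algebra to the Steinberg-type convolution algebra, given by $$1_{\mathbf i}\mapsto1_{\mathbf i},\qquad x_{k,\mathbf i}\mapsto x_{k,\mathbf i},\qquad \tau_{k,\mathbf i}\mapsto\begin{cases}\sigma_{k,\mathbf i}+(x_{k,\mathbf i}-x_{k+1,\mathbf i})^{-a_{i_ki_k}/2}&\text{if }i_k=i_{k+1}\in I^{\le0},\\-\sigma_{k,\mathbf i}&\text{if }i_k=i_{k+1}\in I^+,\\ \sigma_{k,\mathbf i}&\text{if }i_k\ne i_{k+1}.\end{cases}$$
   Context: **Quiver data.** $(I,H)$ is a finite quiver, possibly with loops; $h',h''$ are the source and target of $h\in H$; $\ell_i$ is the number of loops at $i$, $h_{ij}$ ($i\ne j$) the number of arrows from $i$ to $j$. Put $a_{ii}=2-2\ell_i$, $a_{ij}=-h_{ij}-h_{ji}$ for $i\neq j$; $I^+=\{i:a_{ii}=2\}$, $I^{\le 0}=\{i:a_{ii}\le0\}$; $i\cdot j=a_{ij}$. For $\nu\in\mathbb N[I]$ with $\sum\nu_i=n$, $\mathrm{Seq}(\nu)$ is the set of $\mathbf i=i_1\dots i_n\in I^n$ with $\sum i_k=\nu$. $Q_{ij}(u,v)=(-1)^{h_{ij}}(u-v)^{-a_{ij}}$. **KLR algebra.** $R(\nu)$ is the graded $\mathbb C$-algebra generated by $1_{\mathbf i}$ (degree $0$), $x_{k,\mathbf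 i}$ ($1\le k\le n$, degree $2$), $\tau_{k,\mathbf i}$ ($1\le k\le n-1$, degree $-i_k\cdot i_{k+1}$), $\mathbf i\in\mathrm{Seq}(\nu)$. With $x_k=\sum_{\mathbf i}x_{k,\mathbf i}$, $\tau_k=\sum_{\mathbf i}\tau_{k,\mathbf i}$ the relations are: $1_{\mathbf i}1_{\mathbf j}=\delta_{\mathbf i\mathbf j}1_{\mathbf i}$, $\sum1_{\mathbf i}=1$, $x_{k,\mathbf i}=x_k1_{\mathbf i}=1_{\mathbf i}x_k$, $\tau_{k,\mathbf i}=\tau_k1_{\mathbf i}=1_{s_k\mathbf i}\tau_k$, $x_kx_l=x_lx_k$, $\tau_kx_l=x_l\tau_k$ for $l\ne k,k+1$, $\tau_k\tau_l=\tau_l\tau_k$ for $|k-l|>1$; $\tau_k^21_{\mathbf i}=0$ if $i_k=i_{k+1}\in I^+$, $=(-1)^{a_{ii}/2}(x_k-x_{k+1})^{-a_{ii}}1_{\mathbf i}$ if $i_k=i_{k+1}=i\in I^{\le0}$, $=Q_{i_ki_{k+1}}(x_k,x_{k+1})1_{\mathbf i}$ if $i_k\ne i_{k+1}$; $(x_k\tau_k-\tau_kx_{k+1})1_{\mathbf i}=(\tau_kx_k-x_{k+1}\tau_k)1_{\mathbf i}=1_{\mathbf i}$ if $i_k=i_{k+1}\in I^+$, and both are $0$ otherwise; $(\tau_k\tau_{k+1}\tau_k-\tau_{k+1}\tau_k\tau_{k+1})1_{\mathbf i}=\frac{Q_{i_ki_{k+1}}(x_k,x_{k+1})-Q_{i_ki_{k+1}}(x_{k+2},x_{k+1})}{x_k-x_{k+2}}1_{\mathbf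 i}$ if $i_k=i_{k+2}\in I^+$, $i_k\neq i_{k+1}$, $a_{i_ki_{k+1}}<0$, and $=0$ otherwise. **Convolution algebra.** $V_\nu=\bigoplus_i\mathbb C^{\nu_i}$, $\mathbf E_\nu=\bigoplus_{h\in H}\mathrm{Hom}(\mathbb C^{\nu_{h'}},\mathbb C^{\nu_{h''}})$, $G_\nu=\prod_iGL_{\nu_i}(\mathbb C)$. For $\mathbf i\in\mathrm{Seq}(\nu)$, $\widetilde{\mathscr F}_{\mathbf i}$ is the variety of pairs $(x,W)$ with $x\in\mathbf E_\nu$ and $W=(0\subsetneq W_1\subsetneq\dots\subsetneq W_n=V_\nu)$ a flag of $I$-graded subspaces with $\underline\dim(W_k/W_{k-1})=i_k$ and $x(W_k)\subset W_{k-1}$. Put $\mathscr Z_{\mathbf i,\mathbf j}=\widetilde{\mathscr F}_{\mathbf i}\times_{\mathbf E_\nu}\widetilde{\mathscr F}_{\mathbf j}$ and $\mathcal R_\nu=\bigoplus_{\mathbf i,\mathbf j}H_*^{G_\nu}(\mathscr Z_{\mathbf i,\mathbf j})$ (equivariant Borel–Moore homology with the convolution product), graded via $\mathcal R_\nu\cong\mathrm{Ext}^*_{G_\nu}(\mathcal L_\nu,\mathcal L_\nu)$, where $\mathcal L_\nu=\bigoplus_{\mathbf i}(\pi_{\mathbf i})_!\mathbb C[\dim\widetilde{\mathscr F}_{\mathbf i}]$ and $\pi_{\mathbf i}:\widetilde{\mathscr F}_{\mathbf i}\to\mathbf E_\nu$ is the projection. **Known presentation of $\mathcal R_\nu$ (Kang–Kashiwara–Park).**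 $\mathcal R_\nu$ is generated by $1_{\mathbf i}$, $x_{k,\mathbf i}$ (degree $2$), $\sigma_{k,\mathbf i}$ (degree $-i_k\cdot i_{k+1}$), with $1_{\mathbf i}\mathcal R_\nu1_{\mathbf j}=H_*^{G_\nu}(\mathscr Z_{\mathbf i,\mathbf j})$, and defining relations as follows. Put $P_i(u,v)=(u-v)^{\ell_i}$, $P_i(u,v,w)=-\frac{P_i(v,u)P_i(u,w)}{(u-v)(u-w)}-\frac{P_i(u,w)P_i(v,w)}{(u-w)(v-w)}+\frac{P_i(u,v)P_i(v,w)}{(u-v)(v-w)}$, $P_i'(u,v,w)=\frac{P_i(u,v)P_i(u,w)}{(u-v)(u-w)}+\frac{P_i(u,w)P_i(w,v)}{(u-w)(v-w)}-\frac{P_i(u,v)P_i(v,w)}{(u-v)(v-w)}$, $\partial_kf=\frac{f-s_kf}{x_k-x_{k+1}}$, $x_k=\sum_{\mathbf i}x_{k,\mathbf i}$, $\sigma_k=\sum_{\mathbf i}\sigma_{k,\mathbf i}$. Relations: $1_{\mathbf i}1_{\mathbf j}=\delta_{\mathbf i\mathbf j}1_{\mathbf i}$, $1=\sum1_{\mathbf i}$, $x_{k,\mathbf i}=1_{\mathbf i}x_k=x_k1_{\mathbf i}$, $x_kx_l=x_lx_k$, $\sigma_{k,\mathbf i}=1_{s_k\mathbf i}\sigma_k=\sigma_k1_{\mathbf i}$, $\sigma_k\sigma_l=\sigma_l\sigma_k$ if $|k-l|>1$; $\sigma_k^21_{\mathbf i}=-\partial_k(P_{i_k}(x_k,x_{k+1}))\sigma_{k,\mathbf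 i}$ if $i_k=i_{k+1}$, $=Q_{i_ki_{k+1}}(x_k,x_{k+1})1_{\mathbf i}$ if $i_k\ne i_{k+1}$; $(x_{s_k(l)}\sigma_k-\sigma_kx_l)1_{\mathbf i}=P_{i_k}(x_k,x_{k+1})1_{\mathbf i}$ if $l=k$, $i_k=i_{k+1}$; $=-P_{i_k}(x_k,x_{k+1})1_{\mathbf i}$ if $l=k+1$, $i_k=i_{k+1}$; $=0$ otherwise; $(\sigma_k\sigma_{k+1}\sigma_k-\sigma_{k+1}\sigma_k\sigma_{k+1})1_{\mathbf i}=P_{i_k}(x_k,x_{k+1},x_{k+2})\sigma_{k,\mathbf i}+P'_{i_k}(x_k,x_{k+1},x_{k+2})\sigma_{k+1,\mathbf i}$ if $i_k=i_{k+1}=i_{k+2}$; $=-P_{i_k}(x_k,x_{k+2})\frac{Q_{i_ki_{k+1}}(x_k,x_{k+1})-Q_{i_ki_{k+1}}(x_{k+2},x_{k+1})}{x_k-x_{k+2}}1_{\mathbf i}$ if $i_k=i_{k+2}\ne i_{k+1}$; $=0$ otherwise. *)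

theory Defs
  imports
    "HOL-Analysis.Analysis"
    "HOL-Algebra.Module"
    "HOL-Algebra.QuotRing"
    "HOL-Library.Poly_Mapping"
    "HOL-Library.Function_Algebras"
    "HOL-Computational_Algebra.Polynomial"
    "HOL-Computational_Algebra.Fraction_Field"
    "Graph_Theory.Digraph"
begin

section \<open>Graded algebras over the complex numbers\<close>

text \<open>The commutative-base locale \<^locale>\<open>algebra\<close> is not used: only the record is borrowed,
  since the algebras below are not commutative.\<close>

record 'b gr_alg = "(complex, 'b) module" +
  grade :: "int \<Rightarrow> 'b set"

definition quot_alg :: "('b, 'm) gr_alg_scheme \<Rightarrow> 'b set \<Rightarrow> 'b set gr_alg"
  where "quot_alg A J =
    \<lparr>carrier = carrier (A Quot J), mult = mult (A Quot J), one = one (A Quot J),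
     zero = zero (A Quot J), add = add (A Quot J),
     smult = (\<lambda>c U. \<Union>a\<in>U. J +>\<^bsub>A\<^esub> (c \<odot>\<^bsub>A\<^esub> a)),
     grade = (\<lambda>d. (\<lambda>a. J +>\<^bsub>A\<^esub> a) ` grade A d)\<rparr>"

definition gr_alg_iso :: "('a, 'm) gr_alg_scheme \<Rightarrow> ('b, 'n) gr_alg_scheme \<Rightarrow> ('a \<Rightarrow> 'b) set"
  where "gr_alg_iso A B =
    {\<phi> \<in> ring_iso A B. \<phi> \<zero>\<^bsub>A\<^esub> = \<zero>\<^bsub>B\<^esub> \<and>
       (\<forall>c. \<forall>a\<in>carrier A. \<phi> (c \<odot>\<^bsub>A\<^esub> a) = c \<odot>\<^bsub>B\<^esub> \<phi> a) \<and>
       (\<forall>d. \<phi> ` grade A d = grade B d)}"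


section \<open>Free algebras and presentations\<close>

text \<open>Words under concatenation, written additively so that \<open>'g fword \<Rightarrow>\<^sub>0 complex\<close>
  is the free associative algebra on \<^typ>\<open>'g\<close>.\<close>

datatype 'g fword = Word (letters: "'g list")

instantiation fword :: (type) monoid_add
begin

definition zero_fword :: "'a fword"
  where "zero_fword = Word []"

definition plus_fword :: "'a fword \<Rightarrow> 'a fword \<Rightarrow> 'a fword"
  where "plus_fword v w = Word (letters v @ letters w)"

instance
  by standard (simp_all add: zero_fword_def plus_fword_def)

end

type_synonym 'g free = "'g fword \<Rightarrow>\<^sub>0 complex"

definition gen :: "'g \<Rightarrow> 'g free"
  where "gen g = Poly_Mapping.single (Word [g]) 1"

definition cst :: "complex \<Rightarrow> 'g free"
  where "cst c = Poly_Mapping.single 0 c"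

definition free_alg :: "'g set \<Rightarrow> ('g \<Rightarrow> int) \<Rightarrow> 'g free gr_alg"
  where "free_alg S deg =
    \<lparr>carrier = {p. \<forall>w\<in>Poly_Mapping.keys p. set (letters w) \<subseteq> S},
     mult = (*), one = 1, zero = 0, add = (+),
     smult = (\<lambda>c p. cst c * p),
     grade = (\<lambda>d. {p. \<forall>w\<in>Poly_Mapping.keys p.
                     set (letters w) \<subseteq> S \<and> (\<Sum>g\<leftarrow>letters w. deg g) = d})\<rparr>"

definition presented_alg :: "'g set \<Rightarrow> ('g \<Rightarrow> int) \<Rightarrow> 'g free set \<Rightarrow> 'g free set gr_alg"
  where "presented_alg S deg R = quot_alg (free_alg S deg) (Idl\<^bsub>free_alg S deg\<^esub> R)"

definition gen_class :: "'g set \<Rightarrow> ('g \<Rightarrow> int) \<Rightarrow> 'g free set \<Rightarrow> 'g \<Rightarrow> 'g free set"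
  where "gen_class S deg R g = (Idl\<^bsub>free_alg S deg\<^esub> R) +>\<^bsub>free_alg S deg\<^esub> gen g"


section \<open>Quiver data\<close>

text \<open>A finite quiver, possibly with loops and multiple arrows, is a \<^locale>\<open>fin_digraph\<close>;
  \<open>tail\<close> is the source and \<open>head\<close> the target of an arrow.\<close>

definition num_arrows :: "('i, 'h) pre_digraph \<Rightarrow> 'i \<Rightarrow> 'i \<Rightarrow> nat"
  where "num_arrows Q i j = card {h \<in> arcs Q. tail Q h = i \<and> head Q h = j}"

definition num_loops :: "('i, 'h) pre_digraph \<Rightarrow> 'i \<Rightarrow> nat"
  where "num_loops Q i = num_arrows Q i i"

definition cartan :: "('i, 'h) pre_digraph \<Rightarrow> 'i \<Rightarrow> 'i \<Rightarrow> int"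
  where "cartan Q i j =
    (if i = j then 2 - 2 * int (num_loops Q i)
     else - int (num_arrows Q i j) - int (num_arrows Q j i))"

definition I_plus :: "('i, 'h) pre_digraph \<Rightarrow> 'i set"
  where "I_plus Q = {i \<in> verts Q. cartan Q i i = 2}"

definition I_le0 :: "('i, 'h) pre_digraph \<Rightarrow> 'i set"
  where "I_le0 Q = {i \<in> verts Q. cartan Q i i \<le> 0}"

definition Seqs :: "('i, 'h) pre_digraph \<Rightarrow> ('i \<Rightarrow> nat) \<Rightarrow> 'i list set"
  where "Seqs Q \<nu> = {\<ii>. set \<ii> \<subseteq> verts Q \<and> (\<forall>j. count_list \<ii> j = \<nu> j)}"

definition size_of :: "('i, 'h) pre_digraph \<Rightarrow> ('i \<Rightarrow> nat) \<Rightarrow> nat"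
  where "size_of Q \<nu> = (\<Sum>i\<in>verts Q. \<nu> i)"

text \<open>Positions in a sequence are counted from 1.\<close>

definition ent :: "'i list \<Rightarrow> nat \<Rightarrow> 'i"
  where "ent \<ii> k = \<ii> ! (k - 1)"

definition swap_seq :: "nat \<Rightarrow> 'i list \<Rightarrow> 'i list"
  where "swap_seq k \<ii> = \<ii>[k - 1 := ent \<ii> (k + 1), k := ent \<ii> k]"


section \<open>The polynomials in the relations\<close>

text \<open>Polynomials in three variables \<open>u, v, w\<close>; \<open>w\<close> is the outermost variable.\<close>

type_synonym poly3 = "complex poly poly poly"

definition var_u :: poly3 where "var_u = [:[:[:0, 1:]:]:]"
definition var_v :: poly3 where "var_v = [:[:0, 1:]:]"
definition var_w :: poly3 where "var_w = [:0, 1:]"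

definition const3 :: "complex \<Rightarrow> poly3" where "const3 c = [:[:[:c:]:]:]"

definition frac :: "poly3 \<Rightarrow> poly3 fract"
  where "frac p = Fract p 1"

text \<open>Read a rational function back as the polynomial it is; used only where the denominators
  cancel.\<close>

definition as_poly :: "poly3 fract \<Rightarrow> poly3"
  where "as_poly r = (THE p. frac p = r)"

definition Q_pol :: "('i, 'h) pre_digraph \<Rightarrow> 'i \<Rightarrow> 'i \<Rightarrow> poly3 \<Rightarrow> poly3 \<Rightarrow> poly3"
  where "Q_pol Q i j s t = const3 ((-1) ^ num_arrows Q i j) * (s - t) ^ nat (- cartan Q i j)"

definition Q_quot :: "('i, 'h) pre_digraph \<Rightarrow> 'i \<Rightarrow> 'i \<Rightarrow> poly3"
  where "Q_quot Q i j = as_poly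
    (frac (Q_pol Q i j var_u var_v - Q_pol Q i j var_w var_v) / frac (var_u - var_w))"

definition P_pol :: "('i, 'h) pre_digraph \<Rightarrow> 'i \<Rightarrow> poly3 \<Rightarrow> poly3 \<Rightarrow> poly3"
  where "P_pol Q i s t = (s - t) ^ num_loops Q i"

definition P3_pol :: "('i, 'h) pre_digraph \<Rightarrow> 'i \<Rightarrow> poly3"
  where "P3_pol Q i = (let u = var_u; v = var_v; w = var_w; P = P_pol Q i in as_poly
    (- (frac (P v u * P u w) / frac ((u - v) * (u - w)))
     - frac (P u w * P v w) / frac ((u - w) * (v - w))
     + frac (P u v * P v w) / frac ((u - v) * (v - w))))"

definition P3'_pol :: "('i, 'h) pre_digraph \<Rightarrow> 'i \<Rightarrow> poly3"
  where "P3'_pol Q i = (let u = var_u; v = var_v; w = var_w; P = P_pol Q i in as_poly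
    (frac (P u v * P u w) / frac ((u - v) * (u - w))
     + frac (P u w * P w v) / frac ((u - w) * (v - w))
     - frac (P u v * P v w) / frac ((u - v) * (v - w))))"

text \<open>The divided difference of \<open>P\<^sub>i(u,v)\<close> with respect to exchanging \<open>u\<close> and \<open>v\<close>.\<close>

definition dP_pol :: "('i, 'h) pre_digraph \<Rightarrow> 'i \<Rightarrow> poly3"
  where "dP_pol Q i = as_poly
    (frac (P_pol Q i var_u var_v - P_pol Q i var_v var_u) / frac (var_u - var_v))"


section \<open>Generators and relations of the two algebras\<close>

text \<open>Both algebras are presented on generators indexed in the same way: \<open>Idemp \<ii>\<close> is the
  idempotent, \<open>Dot k \<ii>\<close> is \<open>x\<^sub>k\<^sub>,\<^sub>\<ii>\<close>, and \<open>Cross k \<ii>\<close> is \<open>\<tau>\<^sub>k\<^sub>,\<^sub>\<ii>\<close>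
  in the KLR algebra and \<open>\<sigma>\<^sub>k\<^sub>,\<^sub>\<ii>\<close> in the convolution algebra.\<close>

datatype 'i klr_gen = Idemp "'i list" | Dot nat "'i list" | Cross nat "'i list"

definition gens :: "('i, 'h) pre_digraph \<Rightarrow> ('i \<Rightarrow> nat) \<Rightarrow> 'i klr_gen set"
  where "gens Q \<nu> =
    Idemp ` Seqs Q \<nu> \<union>
    {Dot k \<ii> | k \<ii>. \<ii> \<in> Seqs Q \<nu> \<and> 1 \<le> k \<and> k \<le> size_of Q \<nu>} \<union>
    {Cross k \<ii> | k \<ii>. \<ii> \<in> Seqs Q \<nu> \<and> 1 \<le> k \<and> k < size_of Q \<nu>}"

primrec gen_deg :: "('i, 'h) pre_digraph \<Rightarrow> 'i klr_gen \<Rightarrow> int"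
  where
    "gen_deg Q (Idemp \<ii>) = 0"
  | "gen_deg Q (Dot k \<ii>) = 2"
  | "gen_deg Q (Cross k \<ii>) = - cartan Q (ent \<ii> k) (ent \<ii> (k + 1))"

abbreviation idm :: "'i list \<Rightarrow> 'i klr_gen free"
  where "idm \<ii> \<equiv> gen (Idemp \<ii>)"

definition dot :: "('i, 'h) pre_digraph \<Rightarrow> ('i \<Rightarrow> nat) \<Rightarrow> nat \<Rightarrow> 'i klr_gen free"
  where "dot Q \<nu> k = (\<Sum>\<ii>\<in>Seqs Q \<nu>. gen (Dot k \<ii>))"

definition cross :: "('i, 'h) pre_digraph \<Rightarrow> ('i \<Rightarrow> nat) \<Rightarrow> nat \<Rightarrow> 'i klr_gen free"
  where "cross Q \<nu> k = (\<Sum>\<ii>\<in>Seqs Q \<nu>. gen (Cross k \<ii>))"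

text \<open>The value \<open>p(x\<^sub>k, x\<^sub>k\<^sub>+\<^sub>1, x\<^sub>k\<^sub>+\<^sub>2)\<close> with each monomial written in this
  order. If \<open>p\<close> does not involve \<open>w\<close> then \<open>x\<^sub>k\<^sub>+\<^sub>2\<close> does not occur.\<close>

definition eval_at ::
    "('i, 'h) pre_digraph \<Rightarrow> ('i \<Rightarrow> nat) \<Rightarrow> nat \<Rightarrow> poly3 \<Rightarrow> 'i klr_gen free"
  where "eval_at Q \<nu> k p =
    (\<Sum>c\<le>degree p. \<Sum>b\<le>degree (coeff p c). \<Sum>a\<le>degree (coeff (coeff p c) b).
       cst (coeff (coeff (coeff p c) b) a) *
       dot Q \<nu> k ^ a * dot Q \<nu> (k + 1) ^ b * dot Q \<nu> (k + 2) ^ c)"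

text \<open>A relation \<open>l = r\<close> is recorded as \<open>l - r\<close>.\<close>

inductive_set common_rels ::
    "('i, 'h) pre_digraph \<Rightarrow> ('i \<Rightarrow> nat) \<Rightarrow> 'i klr_gen free set"
  for Q :: "('i, 'h) pre_digraph" and \<nu> :: "'i \<Rightarrow> nat"
  where
    idem: "\<lbrakk>\<ii> \<in> Seqs Q \<nu>; \<jj> \<in> Seqs Q \<nu>\<rbrakk> \<Longrightarrow>
      idm \<ii> * idm \<jj> - (if \<ii> = \<jj> then idm \<ii> else 0) \<in> common_rels Q \<nu>"
  | unit: "(\<Sum>\<ii>\<in>Seqs Q \<nu>. idm \<ii>) - 1 \<in> common_rels Q \<nu>"
  | dot_right: "\<lbrakk>\<ii> \<in> Seqs Q \<nu>; 1 \<le> k; k \<le> size_of Q \<nu>\<rbrakk> \<Longrightarrow>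
      gen (Dot k \<ii>) - dot Q \<nu> k * idm \<ii> \<in> common_rels Q \<nu>"
  | dot_left: "\<lbrakk>\<ii> \<in> Seqs Q \<nu>; 1 \<le> k; k \<le> size_of Q \<nu>\<rbrakk> \<Longrightarrow>
      gen (Dot k \<ii>) - idm \<ii> * dot Q \<nu> k \<in> common_rels Q \<nu>"
  | cross_right: "\<lbrakk>\<ii> \<in> Seqs Q \<nu>; 1 \<le> k; k < size_of Q \<nu>\<rbrakk> \<Longrightarrow>
      gen (Cross k \<ii>) - cross Q \<nu> k * idm \<ii> \<in> common_rels Q \<nu>"
  | cross_left: "\<lbrakk>\<ii> \<in> Seqs Q \<nu>; 1 \<le> k; k < size_of Q \<nu>\<rbrakk> \<Longrightarrow>
      gen (Cross k \<ii>) - idm (swap_seq k \<ii>) * cross Q \<nu> k \<in> common_rels Q \<nu>"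
  | dot_dot: "\<lbrakk>1 \<le> k; k \<le> size_of Q \<nu>; 1 \<le> l; l \<le> size_of Q \<nu>\<rbrakk> \<Longrightarrow>
      dot Q \<nu> k * dot Q \<nu> l - dot Q \<nu> l * dot Q \<nu> k \<in> common_rels Q \<nu>"
  | cross_cross: "\<lbrakk>1 \<le> k; k < size_of Q \<nu>; 1 \<le> l; l < size_of Q \<nu>; k + 1 < l \<or> l + 1 < k\<rbrakk> \<Longrightarrow>
      cross Q \<nu> k * cross Q \<nu> l - cross Q \<nu> l * cross Q \<nu> k \<in> common_rels Q \<nu>"


subsection \<open>The KLR algebra\<close>

definition klr_square :: "('i, 'h) pre_digraph \<Rightarrow> 'i \<Rightarrow> 'i \<Rightarrow> poly3"
  where "klr_square Q i j =
    (if i = j then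
       if i \<in> I_plus Q then 0
       else const3 ((-1) powi (cartan Q i i div 2)) * (var_u - var_v) ^ nat (- cartan Q i i)
     else Q_pol Q i j var_u var_v)"

definition klr_braid :: "('i, 'h) pre_digraph \<Rightarrow> 'i \<Rightarrow> 'i \<Rightarrow> 'i \<Rightarrow> poly3"
  where "klr_braid Q i j l =
    (if i = l \<and> i \<in> I_plus Q \<and> i \<noteq> j \<and> cartan Q i j < 0 then Q_quot Q i j else 0)"

inductive_set klr_rels ::
    "('i, 'h) pre_digraph \<Rightarrow> ('i \<Rightarrow> nat) \<Rightarrow> 'i klr_gen free set"
  for Q :: "('i, 'h) pre_digraph" and \<nu> :: "'i \<Rightarrow> nat"
  where
    common: "r \<in> common_rels Q \<nu> \<Longrightarrow> r \<in> klr_rels Q \<nu>"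
  | cross_dot_far: "\<lbrakk>1 \<le> k; k < size_of Q \<nu>; 1 \<le> l; l \<le> size_of Q \<nu>; l \<noteq> k; l \<noteq> k + 1\<rbrakk> \<Longrightarrow>
      cross Q \<nu> k * dot Q \<nu> l - dot Q \<nu> l * cross Q \<nu> k \<in> klr_rels Q \<nu>"
  | square: "\<lbrakk>\<ii> \<in> Seqs Q \<nu>; 1 \<le> k; k < size_of Q \<nu>\<rbrakk> \<Longrightarrow>
      cross Q \<nu> k ^ 2 * idm \<ii>
      - eval_at Q \<nu> k (klr_square Q (ent \<ii> k) (ent \<ii> (k + 1))) * idm \<ii> \<in> klr_rels Q \<nu>"
  | dot_cross: "\<lbrakk>\<ii> \<in> Seqs Q \<nu>; 1 \<le> k; k < size_of Q \<nu>\<rbrakk> \<Longrightarrow>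
      (dot Q \<nu> k * cross Q \<nu> k - cross Q \<nu> k * dot Q \<nu> (k + 1)) * idm \<ii>
      - (if ent \<ii> k = ent \<ii> (k + 1) \<and> ent \<ii> k \<in> I_plus Q then idm \<ii> else 0) \<in> klr_rels Q \<nu>"
  | cross_dot: "\<lbrakk>\<ii> \<in> Seqs Q \<nu>; 1 \<le> k; k < size_of Q \<nu>\<rbrakk> \<Longrightarrow>
      (cross Q \<nu> k * dot Q \<nu> k - dot Q \<nu> (k + 1) * cross Q \<nu> k) * idm \<ii>
      - (if ent \<ii> k = ent \<ii> (k + 1) \<and> ent \<ii> k \<in> I_plus Q then idm \<ii> else 0) \<in> klr_rels Q \<nu>"
  | braid: "\<lbrakk>\<ii> \<in> Seqs Q \<nu>; 1 \<le> k; k + 1 < size_of Q \<nu>\<rbrakk> \<Longrightarrow>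
      (cross Q \<nu> k * cross Q \<nu> (k + 1) * cross Q \<nu> k
       - cross Q \<nu> (k + 1) * cross Q \<nu> k * cross Q \<nu> (k + 1)) * idm \<ii>
      - eval_at Q \<nu> k (klr_braid Q (ent \<ii> k) (ent \<ii> (k + 1)) (ent \<ii> (k + 2))) * idm \<ii>
      \<in> klr_rels Q \<nu>"

definition KLR :: "('i, 'h) pre_digraph \<Rightarrow> ('i \<Rightarrow> nat) \<Rightarrow> 'i klr_gen free set gr_alg"
  where "KLR Q \<nu> = presented_alg (gens Q \<nu>) (gen_deg Q) (klr_rels Q \<nu>)"

definition klr_class ::
    "('i, 'h) pre_digraph \<Rightarrow> ('i \<Rightarrow> nat) \<Rightarrow> 'i klr_gen \<Rightarrow> 'i klr_gen free set"
  where "klr_class Q \<nu> g = gen_class (gens Q \<nu>) (gen_deg Q) (klr_rels Q \<nu>) g"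


subsection \<open>The Kang--Kashiwara--Park relations\<close>

definition kkp_square ::
    "('i, 'h) pre_digraph \<Rightarrow> ('i \<Rightarrow> nat) \<Rightarrow> nat \<Rightarrow> 'i list \<Rightarrow> 'i klr_gen free"
  where "kkp_square Q \<nu> k \<ii> =
    (let i = ent \<ii> k; j = ent \<ii> (k + 1) in
     if i = j then - (eval_at Q \<nu> k (dP_pol Q i) * gen (Cross k \<ii>))
     else eval_at Q \<nu> k (Q_pol Q i j var_u var_v) * idm \<ii>)"

definition kkp_slide ::
    "('i, 'h) pre_digraph \<Rightarrow> ('i \<Rightarrow> nat) \<Rightarrow> nat \<Rightarrow> nat \<Rightarrow> 'i list \<Rightarrow> 'i klr_gen free"
  where "kkp_slide Q \<nu> k l \<ii> =
    (let P = eval_at Q \<nu> k (P_pol Q (ent \<ii> k) var_u var_v) in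
     if l = k \<and> ent \<ii> k = ent \<ii> (k + 1) then P * idm \<ii>
     else if l = k + 1 \<and> ent \<ii> k = ent \<ii> (k + 1) then - (P * idm \<ii>)
     else 0)"

definition kkp_braid ::
    "('i, 'h) pre_digraph \<Rightarrow> ('i \<Rightarrow> nat) \<Rightarrow> nat \<Rightarrow> 'i list \<Rightarrow> 'i klr_gen free"
  where "kkp_braid Q \<nu> k \<ii> =
    (let i = ent \<ii> k; j = ent \<ii> (k + 1); l = ent \<ii> (k + 2) in
     if i = j \<and> j = l then
       eval_at Q \<nu> k (P3_pol Q i) * gen (Cross k \<ii>)
       + eval_at Q \<nu> k (P3'_pol Q i) * gen (Cross (k + 1) \<ii>)
     else if i = l \<and> i \<noteq> j then
       - (eval_at Q \<nu> k (P_pol Q i var_u var_w * Q_quot Q i j) * idm \<ii>)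
     else 0)"

inductive_set kkp_rels ::
    "('i, 'h) pre_digraph \<Rightarrow> ('i \<Rightarrow> nat) \<Rightarrow> 'i klr_gen free set"
  for Q :: "('i, 'h) pre_digraph" and \<nu> :: "'i \<Rightarrow> nat"
  where
    common: "r \<in> common_rels Q \<nu> \<Longrightarrow> r \<in> kkp_rels Q \<nu>"
  | square: "\<lbrakk>\<ii> \<in> Seqs Q \<nu>; 1 \<le> k; k < size_of Q \<nu>\<rbrakk> \<Longrightarrow>
      cross Q \<nu> k ^ 2 * idm \<ii> - kkp_square Q \<nu> k \<ii> \<in> kkp_rels Q \<nu>"
  | slide: "\<lbrakk>\<ii> \<in> Seqs Q \<nu>; 1 \<le> k; k < size_of Q \<nu>; 1 \<le> l; l \<le> size_of Q \<nu>\<rbrakk> \<Longrightarrow>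
      (dot Q \<nu> (Transposition.transpose k (k + 1) l) * cross Q \<nu> k
       - cross Q \<nu> k * dot Q \<nu> l) * idm \<ii>
      - kkp_slide Q \<nu> k l \<ii> \<in> kkp_rels Q \<nu>"
  | braid: "\<lbrakk>\<ii> \<in> Seqs Q \<nu>; 1 \<le> k; k + 1 < size_of Q \<nu>\<rbrakk> \<Longrightarrow>
      (cross Q \<nu> k * cross Q \<nu> (k + 1) * cross Q \<nu> k
       - cross Q \<nu> (k + 1) * cross Q \<nu> k * cross Q \<nu> (k + 1)) * idm \<ii>
      - kkp_braid Q \<nu> k \<ii> \<in> kkp_rels Q \<nu>"


section \<open>The Ext algebra of a complex of sheaves\<close>

text \<open>
  A family of subspaces \<open>N U \<subseteq> ('c \<Rightarrow> complex)\<close>, one for each open \<open>U\<close> of \<open>X\<close> and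
  growing as \<open>U\<close> shrinks, describes the presheaf \<open>U \<mapsto> ('c \<Rightarrow> complex) / N U\<close> whose
  restriction maps are induced by the identity. Accordingly \<open>N p\<close>, \<open>p \<in> \<int>\<close>, together with
  an operator \<open>D\<close>, describes a complex \<open>J\<close> of such presheaves. A family of linear maps
  \<open>\<phi> p U\<close> represents the collection of maps \<open>J\<^sup>p(U) \<rightarrow> J\<^sup>p\<^sup>+\<^sup>m(U)\<close> that it induces;
  every linear map between the quotients has such a lift.
\<close>

type_synonym ('a, 'c) pre_hom = "int \<Rightarrow> 'a set \<Rightarrow> ('c \<Rightarrow> complex) \<Rightarrow> ('c \<Rightarrow> complex)"

definition lin_op :: "(('c \<Rightarrow> complex) \<Rightarrow> ('d \<Rightarrow> complex)) \<Rightarrow> bool"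
  where "lin_op T \<longleftrightarrow>
    (\<forall>f g. T (f + g) = T f + T g) \<and> (\<forall>c f. T (\<lambda>z. c * f z) = (\<lambda>z. c * T f z))"

text \<open>Lifts of the morphisms of sheaves \<open>J\<^sup>p \<rightarrow> J\<^sup>p\<^sup>+\<^sup>m\<close>, \<open>p \<in> \<int>\<close>.\<close>

definition homs ::
    "'a topology \<Rightarrow> (int \<Rightarrow> 'a set \<Rightarrow> ('c \<Rightarrow> complex) set) \<Rightarrow> int \<Rightarrow> ('a, 'c) pre_hom set"
  where "homs X N m =
    {\<phi>. (\<forall>p U. lin_op (\<phi> p U)) \<and>
        (\<forall>p U. openin X U \<longrightarrow> \<phi> p U ` N p U \<subseteq> N (p + m) U) \<and>
        (\<forall>p U U' f. openin X U \<and> openin X U' \<and> U' \<subseteq> U \<longrightarrow>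
           \<phi> p U' f - \<phi> p U f \<in> N (p + m) U')}"

definition null_homs ::
    "'a topology \<Rightarrow> (int \<Rightarrow> 'a set \<Rightarrow> ('c \<Rightarrow> complex) set) \<Rightarrow> int \<Rightarrow> ('a, 'c) pre_hom set"
  where "null_homs X N m = {\<phi>. \<forall>p U f. openin X U \<longrightarrow> \<phi> p U f \<in> N (p + m) U}"

definition hom_diff ::
    "(('c \<Rightarrow> complex) \<Rightarrow> ('c \<Rightarrow> complex)) \<Rightarrow> int \<Rightarrow> ('a, 'c) pre_hom \<Rightarrow> ('a, 'c) pre_hom"
  where "hom_diff D m \<phi> =
    (\<lambda>p U f. D (\<phi> p U f) - (\<lambda>z. (-1) powi m * \<phi> (p + 1) U (D f) z))"

text \<open>The cocycles of the differential graded algebra \<open>Hom\<^sup>\<bullet>(J, J)\<close> with composition as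
  product. An element is a finitely supported family of cocycles of degree \<open>m \<in> \<int>\<close>.\<close>

definition cocycle_alg ::
    "'a topology \<Rightarrow> (int \<Rightarrow> 'a set \<Rightarrow> ('c \<Rightarrow> complex) set) \<Rightarrow>
     (('c \<Rightarrow> complex) \<Rightarrow> ('c \<Rightarrow> complex)) \<Rightarrow> (int \<Rightarrow> ('a, 'c) pre_hom) gr_alg"
  where "cocycle_alg X N D =
    (let Z = {\<phi>. finite {m. \<phi> m \<noteq> 0} \<and>
                 (\<forall>m. \<phi> m \<in> homs X N m \<and> hom_diff D m (\<phi> m) \<in> null_homs X N (m + 1))} in
     \<lparr>carrier = Z,
      mult = (\<lambda>\<phi> \<psi> m p U f. \<Sum>b | \<psi> b \<noteq> 0. \<phi> (m - b) (p + b) U (\<psi> b p U f)),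
      one = (\<lambda>m p U f. if m = 0 then f else 0),
      zero = 0, add = (+),
      smult = (\<lambda>c \<phi> m p U f z. c * \<phi> m p U f z),
      grade = (\<lambda>d. {\<phi> \<in> Z. \<forall>m. m \<noteq> d \<longrightarrow> \<phi> m = 0})\<rparr>)"

definition coboundaries ::
    "'a topology \<Rightarrow> (int \<Rightarrow> 'a set \<Rightarrow> ('c \<Rightarrow> complex) set) \<Rightarrow>
     (('c \<Rightarrow> complex) \<Rightarrow> ('c \<Rightarrow> complex)) \<Rightarrow> (int \<Rightarrow> ('a, 'c) pre_hom) set"
  where "coboundaries X N D =
    {\<phi> \<in> carrier (cocycle_alg X N D).
       \<forall>m. \<exists>\<psi>\<in>homs X N (m - 1). \<phi> m - hom_diff D (m - 1) \<psi> \<in> null_homs X N m}"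

text \<open>If every \<open>J\<^sup>p\<close> is an injective sheaf and \<open>J\<close> is bounded below, this is the graded algebra
  of morphisms \<open>J \<rightarrow> J[m]\<close>, \<open>m \<in> \<int>\<close>, in the derived category of sheaves of complex vector
  spaces on \<open>X\<close>.\<close>

definition ext_alg ::
    "'a topology \<Rightarrow> (int \<Rightarrow> 'a set \<Rightarrow> ('c \<Rightarrow> complex) set) \<Rightarrow>
     (('c \<Rightarrow> complex) \<Rightarrow> ('c \<Rightarrow> complex)) \<Rightarrow> (int \<Rightarrow> ('a, 'c) pre_hom) set gr_alg"
  where "ext_alg X N D = quot_alg (cocycle_alg X N D) (coboundaries X N D)"


subsection \<open>Direct images of constant sheaves\<close>

text \<open>
  The Godement functor \<open>T\<close> sends a sheaf \<open>F\<close> to \<open>U \<mapsto> \<Prod>x\<in>U. F\<^sub>x\<close>. Unfolding the stalks, a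
  section of \<open>T\<^sup>n\<^sup>+\<^sup>1 \<complex>\<close> over \<open>U\<close> is a function of \<open>(x\<^sub>0, \<dots>, x\<^sub>n)\<close>, where for fixed
  \<open>x\<^sub>0 \<in> U\<close> only the germ at \<open>x\<^sub>0\<close> of the dependence on \<open>x\<^sub>1\<close> matters, for fixed \<open>x\<^sub>0\<close> and
  \<open>x\<^sub>1\<close> only the germ at \<open>x\<^sub>1\<close> of the dependence on \<open>x\<^sub>2\<close>, and so on. The predicate below
  says that such a function represents the section \<open>0\<close>.
\<close>

primrec godement_null :: "'y topology \<Rightarrow> nat \<Rightarrow> 'y set \<Rightarrow> ('y list \<Rightarrow> complex) \<Rightarrow> bool"
  where
    "godement_null Y 0 U f \<longleftrightarrow> (\<forall>x\<in>U. f [x] = 0)"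
  | "godement_null Y (Suc n) U f \<longleftrightarrow>
      (\<forall>x\<in>U. \<exists>V. openin Y V \<and> x \<in> V \<and> godement_null Y n V (\<lambda>xs. f (x # xs)))"

text \<open>
  The sheaves \<open>T\<^sup>n\<^sup>+\<^sup>1 \<complex>\<close>, \<open>n \<ge> 0\<close>, with the alternating sum of the maps that omit one
  argument form the (cosimplicial) Godement resolution of the constant sheaf. Its terms are
  products of skyscraper sheaves of complex vector spaces, hence injective. Given spaces \<open>Y s\<close>,
  \<open>s \<in> S\<close>, and a map \<open>\<pi>\<close> from them to \<open>X\<close>, the following complex of injective sheaves on \<open>X\<close>
  therefore represents \<open>\<Oplus>s\<in>S. R\<pi>\<^sub>* \<complex>[d s]\<close>.
\<close>

definition direct_image_null ::
    "'s set \<Rightarrow> ('s \<Rightarrow> 'y topology) \<Rightarrow> ('y \<Rightarrow> 'a) \<Rightarrow> ('s \<Rightarrow> nat) \<Rightarrow>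
     int \<Rightarrow> 'a set \<Rightarrow> ('s \<times> 'y list \<Rightarrow> complex) set"
  where "direct_image_null S Y \<pi> d p U =
    {f. \<forall>s\<in>S. 0 \<le> p + int (d s) \<longrightarrow>
          godement_null (Y s) (nat (p + int (d s))) {y \<in> topspace (Y s). \<pi> y \<in> U}
            (\<lambda>xs. f (s, xs))}"

text \<open>A section of resolution degree \<open>n\<close> depends on lists of length \<open>n + 1\<close>; there is nothing
  in degree \<open>-1\<close>, so the differential vanishes on lists of length 1.\<close>

definition direct_image_diff ::
    "('s \<Rightarrow> nat) \<Rightarrow> ('s \<times> 'y list \<Rightarrow> complex) \<Rightarrow> ('s \<times> 'y list \<Rightarrow> complex)"
  where "direct_image_diff d f = (\<lambda>(s, xs).
    if length xs < 2 then 0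
    else (-1) ^ d s * (\<Sum>k<length xs. (-1) ^ k * f (s, take k xs @ drop (Suc k) xs)))"


section \<open>The varieties\<close>

text \<open>Coordinates: \<open>V\<^sub>\<nu>\<close> consists of the families supported on the indices \<open>a < \<nu> i\<close>;
  \<open>E\<^sub>\<nu>\<close> of the families of matrices, with \<open>x h a b\<close> the entry in row \<open>a\<close> and column \<open>b\<close>.\<close>

type_synonym 'i vect = "'i \<Rightarrow> nat \<Rightarrow> complex"
type_synonym 'h mats = "'h \<Rightarrow> nat \<Rightarrow> nat \<Rightarrow> complex"
type_synonym 'i flag = "nat \<Rightarrow> 'i vect set"

definition vscale :: "complex \<Rightarrow> 'i vect \<Rightarrow> 'i vect"
  where "vscale c v = (\<lambda>i a. c * v i a)"

interpretation vect: vector_space vscale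
  by standard (auto simp: vscale_def fun_eq_iff algebra_simps)

definition V_sp :: "('i \<Rightarrow> nat) \<Rightarrow> 'i vect set"
  where "V_sp \<nu> = {v. \<forall>i a. \<nu> i \<le> a \<longrightarrow> v i a = 0}"

definition V_comp :: "('i \<Rightarrow> nat) \<Rightarrow> 'i \<Rightarrow> 'i vect set"
  where "V_comp \<nu> i = {v \<in> V_sp \<nu>. \<forall>j. j \<noteq> i \<longrightarrow> v j = 0}"

definition graded_subspace :: "('i \<Rightarrow> nat) \<Rightarrow> 'i vect set \<Rightarrow> bool"
  where "graded_subspace \<nu> W \<longleftrightarrow> vect.subspace W \<and> W \<subseteq> V_sp \<nu> \<and>
    (\<forall>v\<in>W. \<forall>i. (\<lambda>j. if j = i then v j else 0) \<in> W)"

definition E_sp :: "('i, 'h) pre_digraph \<Rightarrow> ('i \<Rightarrow> nat) \<Rightarrow> 'h mats set"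
  where "E_sp Q \<nu> = {x. \<forall>h a b.
    \<not> (h \<in> arcs Q \<and> a < \<nu> (head Q h) \<and> b < \<nu> (tail Q h)) \<longrightarrow> x h a b = 0}"

definition arrow_map ::
    "('i, 'h) pre_digraph \<Rightarrow> ('i \<Rightarrow> nat) \<Rightarrow> 'h mats \<Rightarrow> 'h \<Rightarrow> 'i vect \<Rightarrow> 'i vect"
  where "arrow_map Q \<nu> x h v =
    (\<lambda>j a. if j = head Q h then \<Sum>b<\<nu> (tail Q h). x h a b * v (tail Q h) b else 0)"

definition flags :: "('i \<Rightarrow> nat) \<Rightarrow> 'i list \<Rightarrow> 'i flag set"
  where "flags \<nu> \<ii> =
    {W \<in> extensional {0..length \<ii>}.
       W 0 = {0} \<and> W (length \<ii>) = V_sp \<nu> \<and>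
       (\<forall>k\<le>length \<ii>. graded_subspace \<nu> (W k)) \<and>
       (\<forall>k\<in>{1..length \<ii>}. W (k - 1) \<subset> W k \<and>
          (\<forall>j. vect.dim (W k \<inter> V_comp \<nu> j) =
               vect.dim (W (k - 1) \<inter> V_comp \<nu> j) + (if j = ent \<ii> k then 1 else 0)))}"

definition F_tilde ::
    "('i, 'h) pre_digraph \<Rightarrow> ('i \<Rightarrow> nat) \<Rightarrow> 'i list \<Rightarrow> ('h mats \<times> 'i flag) set"
  where "F_tilde Q \<nu> \<ii> =
    {(x, W). x \<in> E_sp Q \<nu> \<and> W \<in> flags \<nu> \<ii> \<and>
       (\<forall>k\<in>{1..length \<ii>}. \<forall>h\<in>arcs Q. arrow_map Q \<nu> x h ` W k \<subseteq> W (k - 1))}"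

text \<open>The analytic topology on \<open>F_tilde\<close>: the quotient topology from the space of pairs of a
  representation and a homogeneous basis adapted to the flag.\<close>

definition flag_of :: "nat \<Rightarrow> (nat \<Rightarrow> 'i vect) \<Rightarrow> 'i flag"
  where "flag_of n b = (\<lambda>k\<in>{0..n}. vect.span (b ` {1..k}))"

definition framed ::
    "('i, 'h) pre_digraph \<Rightarrow> ('i \<Rightarrow> nat) \<Rightarrow> 'i list \<Rightarrow> ('h mats \<times> (nat \<Rightarrow> 'i vect)) set"
  where "framed Q \<nu> \<ii> =
    {(x, b). (\<forall>k. if k \<in> {1..length \<ii>} then b k \<in> V_comp \<nu> (ent \<ii> k) else b k = 0) \<and>
             (x, flag_of (length \<ii>) b) \<in> F_tilde Q \<nu> \<ii>}"

definition quotient_top :: "'b topology \<Rightarrow> ('b \<Rightarrow> 'c) \<Rightarrow> 'c topology"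
  where "quotient_top T q =
    topology (\<lambda>U. U \<subseteq> q ` topspace T \<and> openin T {z \<in> topspace T. q z \<in> U})"

lemma openin_quotient_top:
  "openin (quotient_top T q) U \<longleftrightarrow>
     U \<subseteq> q ` topspace T \<and> openin T {z \<in> topspace T. q z \<in> U}"
proof -
  have "istopology (\<lambda>U. U \<subseteq> q ` topspace T \<and> openin T {z \<in> topspace T. q z \<in> U})"
    unfolding istopology_def
  proof (intro conjI allI impI)
    fix A B assume A: "A \<subseteq> q ` topspace T \<and> openin T {z \<in> topspace T. q z \<in> A}"
      and B: "B \<subseteq> q ` topspace T \<and> openin T {z \<in> topspace T. q z \<in> B}"
    have "{z \<in> topspace T. q z \<in> A \<inter> B} =
        {z \<in> topspace T. q z \<in> A} \<inter> {z \<in> topspace T. q z \<in> B}" by auto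
    then show "openin T {z \<in> topspace T. q z \<in> A \<inter> B}" using A B by auto
    show "A \<inter> B \<subseteq> q ` topspace T" using A by auto
  next
    fix K assume K: "\<forall>A\<in>K. A \<subseteq> q ` topspace T \<and> openin T {z \<in> topspace T. q z \<in> A}"
    have "{z \<in> topspace T. q z \<in> \<Union> K} = (\<Union>A\<in>K. {z \<in> topspace T. q z \<in> A})" by auto
    then show "openin T {z \<in> topspace T. q z \<in> \<Union> K}" using K by auto
    show "\<Union> K \<subseteq> q ` topspace T" using K by auto
  qed
  then show ?thesis by (simp add: quotient_top_def topology_inverse')
qed

definition F_tilde_top ::
    "('i, 'h) pre_digraph \<Rightarrow> ('i \<Rightarrow> nat) \<Rightarrow> 'i list \<Rightarrow> ('h mats \<times> 'i flag) topology"
  where "F_tilde_top Q \<nu> \<ii> =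
    quotient_top (top_of_set (framed Q \<nu> \<ii>)) (\<lambda>(x, b). (x, flag_of (length \<ii>) b))"

text \<open>The complex dimension: the graded flag variety has dimension \<open>\<Sum>j. \<nu> j (\<nu> j - 1) / 2\<close>,
  the number of pairs \<open>k < l\<close> with equal entries, and over it \<open>F_tilde\<close> is the vector bundle of
  those \<open>x\<close> that map the \<open>l\<close>-th line of the flag into the earlier ones.\<close>

definition dim_F_tilde :: "('i, 'h) pre_digraph \<Rightarrow> 'i list \<Rightarrow> nat"
  where "dim_F_tilde Q \<ii> =
    (\<Sum>l\<in>{1..length \<ii>}. \<Sum>k\<in>{1..<l}.
       (if ent \<ii> k = ent \<ii> l then 1 else 0) + num_arrows Q (ent \<ii> l) (ent \<ii> k))"


section \<open>The group and the Borel construction\<close>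

text \<open>Elements of \<open>G\<^sub>\<nu>\<close>, listed as pairs \<open>(g, g\<inverse>)\<close>.\<close>

definition G_pairs :: "('i \<Rightarrow> nat) \<Rightarrow> ('i mats \<times> 'i mats) set"
  where "G_pairs \<nu> =
    {(g, g'). (\<forall>i a b. \<not> (a < \<nu> i \<and> b < \<nu> i) \<longrightarrow> g i a b = 0 \<and> g' i a b = 0) \<and>
       (\<forall>i. \<forall>a<\<nu> i. \<forall>b<\<nu> i.
          (\<Sum>c<\<nu> i. g i a c * g' i c b) = (if a = b then 1 else 0))}"

definition act_V :: "('i \<Rightarrow> nat) \<Rightarrow> 'i mats \<times> 'i mats \<Rightarrow> 'i vect \<Rightarrow> 'i vect"
  where "act_V \<nu> = (\<lambda>(g, g') v i a. \<Sum>b<\<nu> i. g i a b * v i b)"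

definition act_E ::
    "('i, 'h) pre_digraph \<Rightarrow> ('i \<Rightarrow> nat) \<Rightarrow> 'i mats \<times> 'i mats \<Rightarrow> 'h mats \<Rightarrow> 'h mats"
  where "act_E Q \<nu> = (\<lambda>(g, g') x h a b.
    \<Sum>c<\<nu> (head Q h). \<Sum>e<\<nu> (tail Q h). g (head Q h) a c * x h c e * g' (tail Q h) e b)"

definition act_flag :: "('i \<Rightarrow> nat) \<Rightarrow> nat \<Rightarrow> 'i mats \<times> 'i mats \<Rightarrow> 'i flag \<Rightarrow> 'i flag"
  where "act_flag \<nu> n g W = (\<lambda>k\<in>{0..n}. act_V \<nu> g ` W k)"

text \<open>A contractible space with free action of \<open>G\<^sub>\<nu>\<close>: families of injective linear maps
  \<open>\<complex>\<^bsup>\<nu> i\<^esup> \<rightarrow> \<complex>\<^bsup>\<nat>\<^esup>\<close> (\<open>u i a\<close> is the image of the \<open>a\<close>-th basis vector) in the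
  topology of pointwise convergence, with \<open>g\<close> acting by \<open>u \<mapsto> u \<circ> g\<inverse>\<close>.\<close>

definition EG :: "('i \<Rightarrow> nat) \<Rightarrow> 'i mats set"
  where "EG \<nu> = {u. (\<forall>i a s. \<nu> i \<le> a \<longrightarrow> u i a s = 0) \<and>
    (\<forall>i c. (\<forall>s. (\<Sum>a<\<nu> i. c a * u i a s) = 0) \<longrightarrow> (\<forall>a<\<nu> i. c a = 0))}"

definition act_EG :: "('i \<Rightarrow> nat) \<Rightarrow> 'i mats \<times> 'i mats \<Rightarrow> 'i mats \<Rightarrow> 'i mats"
  where "act_EG \<nu> = (\<lambda>(g, g') u i b s. \<Sum>a<\<nu> i. g' i a b * u i a s)"

text \<open>
  Instead of an orbit space one can keep the points and only retain the invariant open sets: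
  these correspond to the open sets of the orbit space, so that the sheaves are the same.
\<close>

definition invariant_top :: "'g set \<Rightarrow> ('g \<Rightarrow> 'b \<Rightarrow> 'b) \<Rightarrow> 'b topology \<Rightarrow> 'b topology"
  where "invariant_top G act T =
    topology (\<lambda>U. openin T U \<and> (\<forall>g\<in>G. act g ` U \<subseteq> U))"

lemma openin_invariant_top:
  "openin (invariant_top G act T) U \<longleftrightarrow> openin T U \<and> (\<forall>g\<in>G. act g ` U \<subseteq> U)"
proof -
  have "istopology (\<lambda>U. openin T U \<and> (\<forall>g\<in>G. act g ` U \<subseteq> U))"
    unfolding istopology_def by (auto simp: image_subset_iff)
  then show ?thesis by (simp add: invariant_top_def topology_inverse')
qed

definition E_G ::
    "('i, 'h) pre_digraph \<Rightarrow> ('i \<Rightarrow> nat) \<Rightarrow> ('i mats \<times> 'h mats) topology"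
  where "E_G Q \<nu> =
    invariant_top (G_pairs \<nu>) (\<lambda>g (u, x). (act_EG \<nu> g u, act_E Q \<nu> g x))
      (prod_topology (top_of_set (EG \<nu>)) (top_of_set (E_sp Q \<nu>)))"

definition F_tilde_G ::
    "('i, 'h) pre_digraph \<Rightarrow> ('i \<Rightarrow> nat) \<Rightarrow> 'i list \<Rightarrow>
     ('i mats \<times> 'h mats \<times> 'i flag) topology"
  where "F_tilde_G Q \<nu> \<ii> =
    invariant_top (G_pairs \<nu>)
      (\<lambda>g (u, x, W). (act_EG \<nu> g u, act_E Q \<nu> g x, act_flag \<nu> (length \<ii>) g W))
      (prod_topology (top_of_set (EG \<nu>)) (F_tilde_top Q \<nu> \<ii>))"

definition proj_G :: "'i mats \<times> 'h mats \<times> 'i flag \<Rightarrow> 'i mats \<times> 'h mats"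
  where "proj_G = (\<lambda>(u, x, W). (u, x))"


section \<open>The convolution algebra\<close>

text \<open>
  The algebra \<open>Ext\<^sup>*\<close> of \<open>L\<^sub>\<nu> = \<Oplus>\<ii>. (\<pi>\<^sub>\<ii>)\<^sub>! \<complex>[dim F_tilde \<ii>]\<close> in the equivariant derived
  category of \<open>E\<^sub>\<nu>\<close>, that is, in the derived category of sheaves on the Borel construction; the
  maps \<open>\<pi>\<^sub>\<ii>\<close> are proper, so \<open>\<pi>\<^sub>!\<close> is the derived direct image. It is the direct sum of the
  equivariant Borel--Moore homology groups of the fibre products of \<open>F_tilde \<ii>\<close> and
  \<open>F_tilde \<jj>\<close> over \<open>E\<^sub>\<nu>\<close>, which are the morphisms from the \<open>\<jj>\<close>-th to the \<open>\<ii>\<close>-th summand,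
  and the convolution product is composition.
\<close>

type_synonym ('i, 'h) conv =
  "(int \<Rightarrow> ('i mats \<times> 'h mats, 'i list \<times> ('i mats \<times> 'h mats \<times> 'i flag) list) pre_hom) set"

definition L_null ::
    "('i, 'h) pre_digraph \<Rightarrow> ('i \<Rightarrow> nat) \<Rightarrow> int \<Rightarrow> ('i mats \<times> 'h mats) set \<Rightarrow>
     ('i list \<times> ('i mats \<times> 'h mats \<times> 'i flag) list \<Rightarrow> complex) set"
  where "L_null Q \<nu> =
    direct_image_null (Seqs Q \<nu>) (F_tilde_G Q \<nu>) proj_G (dim_F_tilde Q)"

definition L_diff ::
    "('i, 'h) pre_digraph \<Rightarrow>
     ('i list \<times> ('i mats \<times> 'h mats \<times> 'i flag) list \<Rightarrow> complex) \<Rightarrow>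
     ('i list \<times> ('i mats \<times> 'h mats \<times> 'i flag) list \<Rightarrow> complex)"
  where "L_diff Q = direct_image_diff (dim_F_tilde Q)"

definition conv_alg :: "('i, 'h) pre_digraph \<Rightarrow> ('i \<Rightarrow> nat) \<Rightarrow> ('i, 'h) conv gr_alg"
  where "conv_alg Q \<nu> = ext_alg (E_G Q \<nu>) (L_null Q \<nu>) (L_diff Q)"

text \<open>The idempotent of \<open>\<ii>\<close> is the class of the projection onto the \<open>\<ii>\<close>-th summand.\<close>

definition conv_idem ::
    "('i, 'h) pre_digraph \<Rightarrow> ('i \<Rightarrow> nat) \<Rightarrow> 'i list \<Rightarrow> ('i, 'h) conv"
  where "conv_idem Q \<nu> \<ii> =
    coboundaries (E_G Q \<nu>) (L_null Q \<nu>) (L_diff Q)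
      +>\<^bsub>cocycle_alg (E_G Q \<nu>) (L_null Q \<nu>) (L_diff Q)\<^esub>
    (\<lambda>m p U f. if m = 0 then (\<lambda>(\<jj>, xs). if \<jj> = \<ii> then f (\<jj>, xs) else 0) else 0)"

text \<open>The elements \<open>x k \<ii>\<close> and \<open>\<sigma> k \<ii>\<close>, together with the idempotents, are generators of the
  convolution algebra, of the prescribed degrees, with the Kang--Kashiwara--Park relations as
  defining relations.\<close>

definition kkp_generators ::
    "('i, 'h) pre_digraph \<Rightarrow> ('i \<Rightarrow> nat) \<Rightarrow>
     (nat \<Rightarrow> 'i list \<Rightarrow> ('i, 'h) conv) \<Rightarrow> (nat \<Rightarrow> 'i list \<Rightarrow> ('i, 'h) conv) \<Rightarrow> bool"
  where "kkp_generators Q \<nu> x \<sigma> \<longleftrightarrow>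
    (let S = gens Q \<nu>; deg = gen_deg Q; R = kkp_rels Q \<nu>; n = size_of Q \<nu> in
     \<exists>\<Psi> \<in> gr_alg_iso (presented_alg S deg R) (conv_alg Q \<nu>).
       (\<forall>\<ii>\<in>Seqs Q \<nu>. \<Psi> (gen_class S deg R (Idemp \<ii>)) = conv_idem Q \<nu> \<ii>) \<and>
       (\<forall>\<ii>\<in>Seqs Q \<nu>. \<forall>k\<in>{1..n}. \<Psi> (gen_class S deg R (Dot k \<ii>)) = x k \<ii>) \<and>
       (\<forall>\<ii>\<in>Seqs Q \<nu>. \<forall>k\<in>{1..<n}. \<Psi> (gen_class S deg R (Cross k \<ii>)) = \<sigma> k \<ii>))"

text \<open>The images of the \<open>\<tau>\<^sub>k\<^sub>,\<^sub>\<ii>\<close>. The power of \<open>x\<^sub>k\<^sub>,\<^sub>\<ii> - x\<^sub>k\<^sub>+\<^sub>1\<^sub>,\<^sub>\<ii>\<close> is taken in the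
  algebra cut off by the idempotent of \<open>\<ii>\<close>; in particular its zeroth power is that idempotent.\<close>

definition tau_image ::
    "('i, 'h) pre_digraph \<Rightarrow> ('i \<Rightarrow> nat) \<Rightarrow>
     (nat \<Rightarrow> 'i list \<Rightarrow> ('i, 'h) conv) \<Rightarrow> (nat \<Rightarrow> 'i list \<Rightarrow> ('i, 'h) conv) \<Rightarrow>
     nat \<Rightarrow> 'i list \<Rightarrow> ('i, 'h) conv"
  where "tau_image Q \<nu> x \<sigma> k \<ii> =
    (let i = ent \<ii> k; j = ent \<ii> (k + 1); A = conv_alg Q \<nu> in
     if i = j \<and> i \<in> I_le0 Q then
       \<sigma> k \<ii> \<oplus>\<^bsub>A\<^esub>
         ((x k \<ii> \<ominus>\<^bsub>A\<^esub> x (k + 1) \<ii>) [^]\<^bsub>A\<^esub> nat (- cartan Q i i div 2)) \<otimes>\<^bsub>A\<^esub> conv_idem Q \<nu> \<ii>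
     else if i = j \<and> i \<in> I_plus Q then \<ominus>\<^bsub>A\<^esub> \<sigma> k \<ii>
     else \<sigma> k \<ii>)"

end

theory Submission
  imports Defs
begin

text \<open>
  By the Kang--Kashiwara--Park presentation the convolution algebra is a quotient of the free
  algebra on the generators that also present the KLR algebra. The prescribed images of the
  \<open>\<tau>\<^sub>k\<^sub>,\<^sub>\<ii>\<close> define a graded automorphism of this free algebra, whose inverse subtracts
  the powers of \<open>x\<^sub>k - x\<^sub>k\<^sub>+\<^sub>1\<close> instead of adding them, so it suffices that it carries one ideal of
  relations onto the other. At a vertex with \<open>m + 1\<close> loops, \<open>\<tau>\<^sub>k = \<sigma>\<^sub>k + (x\<^sub>k - x\<^sub>k\<^sub>+\<^sub>1)\<^sup>m\<close>
  exchanges \<open>x\<^sub>k\<close> and \<open>x\<^sub>k\<^sub>+\<^sub>1\<close> without correction term because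
  \<open>(x\<^sub>k - x\<^sub>k\<^sub>+\<^sub>1) (x\<^sub>k - x\<^sub>k\<^sub>+\<^sub>1)\<^sup>m\<close> is the polynomial in the slide relation of \<open>\<sigma>\<^sub>k\<close>; moving all
  powers to the left turns the quadratic and the braid relation of \<open>\<sigma>\<close> into those of \<open>\<tau>\<close>,
  the polynomials \<open>P\<^sub>i(u,v,w)\<close> and \<open>P'\<^sub>i(u,v,w)\<close> being the coefficients that appear.
\<close>


section \<open>Non-unital ring homomorphisms\<close>

text \<open>Everything is computed after a map \<open>h\<close> out of the free algebra that
  satisfies the relations shared by both presentations. The heart is the equivalence
  \<open>kkp_iff_klr\<close>: \<open>h\<close> kills the relations of \<sigma> iff \<open>h\<close>
  after the twist kills those of \<tau>. Taken for the reduction modulo the first ideal, and for the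
  reduction modulo the second preceded by the inverse twist, it yields both inclusions of ideals.
  The relations cannot be compared independently. Moving powers across crossings presupposes the
  slide relations, and the braid relations presuppose the quadratic ones as well, since squares of
  crossings arise on the way. This also happens for neighbours i, j, i with i distinct from j: if i
  has \<open>m + 1\<close> loops, the shift of the middle crossing moves left as the
  \<open>m\<close>-th power of \<open>X k - X (k + 2)\<close> and leaves a difference of two
  squares, that is, of two values of \<open>Q_pol\<close>. This is where P(u,w) times the divided
  difference of Q comes from. At a vertex without loops P is 1, and only signs change.\<close>

definition rng_hom :: "('a::ring \<Rightarrow> 'b::ring) \<Rightarrow> bool"
  where "rng_hom h \<longleftrightarrow> (\<forall>a b. h (a + b) = h a + h b) \<and> (\<forall>a b. h (a * b) = h a * h b)"

lemma rng_homI: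
  "(\<And>a b. h (a + b) = h a + h b) \<Longrightarrow> (\<And>a b. h (a * b) = h a * h b) \<Longrightarrow> rng_hom h"
  by (simp add: rng_hom_def)

lemma rng_hom_add: "rng_hom h \<Longrightarrow> h (a + b) = h a + h b"
  and rng_hom_mult: "rng_hom h \<Longrightarrow> h (a * b) = h a * h b"
  by (simp_all add: rng_hom_def)

lemma rng_hom_zero [simp]: "rng_hom h \<Longrightarrow> h 0 = 0"
  using rng_hom_add[of h 0 0] by simp

lemma rng_hom_uminus: "rng_hom h \<Longrightarrow> h (- a) = - h a"
  by (metis eq_neg_iff_add_eq_0 neg_eq_iff_add_eq_0 rng_hom_add rng_hom_zero)

lemma rng_hom_diff: "rng_hom h \<Longrightarrow> h (a - b) = h a - h b"
  by (metis diff_conv_add_uminus rng_hom_add rng_hom_uminus)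

lemma rng_hom_sum: "rng_hom h \<Longrightarrow> h (sum f A) = (\<Sum>a\<in>A. h (f a))"
  by (induction A rule: infinite_finite_induct) (simp_all add: rng_hom_add)

text \<open>Without \<open>h 1 = 1\<close> the rule \<open>h (b ^ n) = h b ^ n\<close> can fail at
  \<open>n = 0\<close>; a further factor absorbs the unit.\<close>

lemma rng_hom_mult_power_right:
  fixes h :: "'a::ring_1 \<Rightarrow> 'b::ring_1"
  shows "rng_hom h \<Longrightarrow> h (a * b ^ n) = h a * h b ^ n"
  by (induction n) (simp_all only: power_Suc2 rng_hom_mult power_0 mult_1_right flip: mult.assoc)

lemma rng_hom_mult_power_left:
  fixes h :: "'a::ring_1 \<Rightarrow> 'b::ring_1"
  shows "rng_hom h \<Longrightarrow> h (b ^ n * a) = h b ^ n * h a"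
  by (induction n) (simp_all only: power_Suc rng_hom_mult power_0 mult_1_left mult.assoc)

lemma rng_hom_comp: "rng_hom g \<Longrightarrow> rng_hom h \<Longrightarrow> rng_hom (\<lambda>a. g (h a))"
  by (simp add: rng_hom_def)

text \<open>The library's \<^const>\<open>poly\<close> only takes values in commutative rings.\<close>

definition eval_pol :: "('a::comm_ring_1 \<Rightarrow> 'b::ring_1) \<Rightarrow> 'b \<Rightarrow> 'a poly \<Rightarrow> 'b"
  where "eval_pol f x p = (\<Sum>i\<le>degree p. f (coeff p i) * x ^ i)"

lemma eval_pol_upto:
  assumes "rng_hom f" "degree p \<le> n"
  shows "eval_pol f x p = (\<Sum>i\<le>n. f (coeff p i) * x ^ i)"
  unfolding eval_pol_def
  by (rule sum.mono_neutral_left) (use assms in \<open>auto simp: coeff_eq_0\<close>)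

lemma eval_pol_add: "rng_hom f \<Longrightarrow> eval_pol f x (p + q) = eval_pol f x p + eval_pol f x q"
  by (simp add: eval_pol_upto[where n = "max (degree p) (degree q)"] degree_add_le
      rng_hom_add sum.distrib distrib_right)

lemma eval_pol_const: "eval_pol f x [:a:] = f a"
  by (simp add: eval_pol_def)

lemma eval_pol_pCons:
  assumes "rng_hom f"
  shows "eval_pol f x (pCons a p) = f a + eval_pol f x p * x"
  by (subst eval_pol_upto[where n = "Suc (degree p)"])
    (use assms in \<open>simp_all add: degree_pCons_le eval_pol_def sum.atMost_Suc_shift
      sum_distrib_right mult.assoc power_commutes del: sum.atMost_Suc\<close>)

lemma eval_pol_smult:
  assumes "rng_hom f"
  shows "eval_pol f x (Polynomial.smult a p) = f a * eval_pol f x p"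
  by (subst eval_pol_upto[where n = "degree p"])
    (use assms in \<open>simp_all add: degree_smult_le eval_pol_def sum_distrib_left rng_hom_mult mult.assoc\<close>)

lemma eval_pol_commute:
  assumes "\<And>a. f a * y = y * f a" "x * y = y * x"
  shows "eval_pol f x p * y = y * eval_pol f x p"
proof -
  have "x ^ i * y = y * x ^ i" for i
    using assms(2) power_commuting_commutes by blast
  then have "f a * x ^ i * y = y * (f a * x ^ i)" for a i
    by (metis assms(1) mult.assoc)
  then show ?thesis
    unfolding eval_pol_def sum_distrib_left sum_distrib_right by presburger
qed

text \<open>Substitution respects products because the value \<open>x\<close> commutes with the
  images of the coefficients and can be moved past \<open>eval_pol f x q\<close>. Applied three
  times, this evaluates polynomials at three commuting dots.\<close>

lemma rng_hom_eval_pol: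
  assumes "rng_hom f" "\<And>a. f a * x = x * f a"
  shows "rng_hom (eval_pol f x)"
proof (rule rng_homI)
  show "eval_pol f x (p + q) = eval_pol f x p + eval_pol f x q" for p q
    using assms by (simp add: eval_pol_add)
  show "eval_pol f x (p * q) = eval_pol f x p * eval_pol f x q" for p q
  proof (induction p)
    case 0
    then show ?case using assms by (simp add: eval_pol_def)
  next
    case (pCons a p)
    have "eval_pol f x q * x = x * eval_pol f x q"
      using assms(2) by (intro eval_pol_commute) auto
    then show ?case
      using assms(1) pCons.IH
      by (simp add: eval_pol_add eval_pol_smult eval_pol_pCons distrib_right mult.assoc)
  qed
qed


section \<open>The product of all quotients of a ring\<close>

definition two_sided_ideal :: "'a::ring_1 set \<Rightarrow> bool"
  where "two_sided_ideal J \<longleftrightarrow>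
    0 \<in> J \<and> (\<forall>a\<in>J. \<forall>b\<in>J. a + b \<in> J) \<and> (\<forall>a\<in>J. \<forall>r. r * a \<in> J \<and> a * r \<in> J)"

lemma two_sided_idealD:
  assumes "two_sided_ideal J"
  shows "0 \<in> J" "a \<in> J \<Longrightarrow> b \<in> J \<Longrightarrow> a + b \<in> J" "a \<in> J \<Longrightarrow> r * a \<in> J" "a \<in> J \<Longrightarrow> a * r \<in> J"
    "a \<in> J \<Longrightarrow> - a \<in> J"
  using assms unfolding two_sided_ideal_def by (simp_all, metis mult_minus1)

definition quots_rel :: "('a::ring_1 set \<Rightarrow> 'a) \<Rightarrow> ('a set \<Rightarrow> 'a) \<Rightarrow> bool"
  where "quots_rel f g \<longleftrightarrow> (\<forall>J. two_sided_ideal J \<longrightarrow> f J - g J \<in> J)"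

lemma equivp_quots_rel: "equivp quots_rel"
proof (rule equivpI)
  show "reflp quots_rel"
    by (simp add: reflp_def quots_rel_def two_sided_idealD)
  show "symp quots_rel"
    unfolding symp_def quots_rel_def by (metis minus_diff_eq two_sided_idealD(5))
  show "transp quots_rel"
    unfolding transp_def quots_rel_def
    by (metis add_diff_eq diff_add_cancel two_sided_idealD(2))
qed

text \<open>A type of quotients of \<^typ>\<open>'a\<close> by a two-sided ideal cannot depend on the ideal. Taking
  all ideals together allows one to compute modulo an ideal in a type of class \<^class>\<open>ring_1\<close>.\<close>

quotient_type (overloaded) 'a quots = "'a::ring_1 set \<Rightarrow> 'a" / quots_rel
  by (rule equivp_quots_rel)

instantiation quots :: (ring_1) ring_1
begin

lift_definition zero_quots :: "'a quots" is "\<lambda>J. 0" .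

lift_definition one_quots :: "'a quots" is "\<lambda>J. 1" .

lift_definition plus_quots :: "'a quots \<Rightarrow> 'a quots \<Rightarrow> 'a quots" is "\<lambda>f g J. f J + g J"
  unfolding quots_rel_def by (metis add_diff_add two_sided_idealD(2))

lift_definition uminus_quots :: "'a quots \<Rightarrow> 'a quots" is "\<lambda>f J. - f J"
  unfolding quots_rel_def by (metis minus_diff_minus two_sided_idealD(5))

lift_definition minus_quots :: "'a quots \<Rightarrow> 'a quots \<Rightarrow> 'a quots" is "\<lambda>f g J. f J - g J"
  unfolding quots_rel_def
  by (metis (no_types, lifting) diff_conv_add_uminus add_diff_add minus_diff_minus
      two_sided_idealD(2,5))

lift_definition times_quots :: "'a quots \<Rightarrow> 'a quots \<Rightarrow> 'a quots" is "\<lambda>f g J. f J * g J"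
  unfolding quots_rel_def
proof (intro allI impI)
  fix f f' g g' :: "'a set \<Rightarrow> 'a" and J :: "'a set"
  assume *: "\<forall>J. two_sided_ideal J \<longrightarrow> f J - f' J \<in> J" "\<forall>J. two_sided_ideal J \<longrightarrow> g J - g' J \<in> J"
    and J: "two_sided_ideal J"
  have "f J * g J - f' J * g' J = (f J - f' J) * g J + f' J * (g J - g' J)"
    by (simp add: algebra_simps)
  also have "\<dots> \<in> J"
    using * J two_sided_idealD[OF J] by blast
  finally show "f J * g J - f' J * g' J \<in> J" .
qed

instance
proof
  show "(0::'a quots) \<noteq> 1"
  proof transfer
    \<comment> \<open>The component at the zero ideal is the ring itself, where \<open>0\<close> and
      \<open>1\<close> differ.\<close>
    have "two_sided_ideal {0::'a}"
      by (simp add: two_sided_ideal_def)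
    then show "\<not> quots_rel (\<lambda>J. 0::'a) (\<lambda>J. 1)"
      by (auto simp: quots_rel_def intro!: exI[of _ "{0}"])
  qed
qed (transfer, simp add: quots_rel_def two_sided_idealD algebra_simps)+

end

text \<open>Supported at a single ideal, hence additive and multiplicative but not unital: this is why
  homomorphisms are not required to preserve \<open>1\<close>.\<close>

lift_definition at_ideal :: "'a::ring_1 set \<Rightarrow> 'a \<Rightarrow> 'a quots"
  is "\<lambda>J a J'. if J' = J then a else 0" .

lemma rng_hom_at_ideal: "rng_hom (at_ideal J)"
proof (rule rng_homI)
  show "at_ideal J (a + b) = at_ideal J a + at_ideal J b" for a b
    by transfer (simp add: quots_rel_def two_sided_idealD)
  show "at_ideal J (a * b) = at_ideal J a * at_ideal J b" for a b
    by transfer (simp add: quots_rel_def two_sided_idealD)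
qed

lemma at_ideal_eq_0_iff: "two_sided_ideal J \<Longrightarrow> at_ideal J a = 0 \<longleftrightarrow> a \<in> J"
  by transfer (auto simp: quots_rel_def two_sided_idealD)


section \<open>Substitution in free algebras\<close>

lemma free_sum_single:
  fixes p :: "'k \<Rightarrow>\<^sub>0 'v::comm_monoid_add"
  shows "p = (\<Sum>w\<in>Poly_Mapping.keys p. Poly_Mapping.single w (Poly_Mapping.lookup p w))"
  by (rule poly_mapping_eqI) (auto simp: lookup_sum lookup_single when_def not_in_keys_iff_lookup_eq_zero)

lemma cst_simps:
  "cst 0 = 0" "cst 1 = 1" "cst (c + d) = cst c + cst d" "cst (c * d) = cst c * cst d"
  by (simp_all add: cst_def single_add mult_single)

lemma cst_mult_single: "cst c * Poly_Mapping.single w d = Poly_Mapping.single w (c * d)"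
  by (simp add: cst_def mult_single)

lemma single_mult_cst: "Poly_Mapping.single w d * cst c = Poly_Mapping.single w (c * d)"
  by (simp add: cst_def mult_single mult.commute)

lemma cst_commute: "cst c * p = p * cst c"
  by (subst (1 2) free_sum_single)
    (simp add: sum_distrib_left sum_distrib_right cst_mult_single single_mult_cst)

lemma single_Word: "Poly_Mapping.single (Word l) c = cst c * prod_list (map gen l)"
proof (induction l arbitrary: c)
  case Nil
  then show ?case by (simp add: cst_def zero_fword_def)
next
  case (Cons g l)
  have "Poly_Mapping.single (Word (g # l)) c = gen g * Poly_Mapping.single (Word l) c"
    by (simp add: gen_def mult_single plus_fword_def)
  also have "\<dots> = cst c * (gen g * prod_list (map gen l))"
    unfolding Cons.IH mult.assoc[symmetric] cst_commute[of c "gen g"] ..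
  finally show ?case by simp
qed

text \<open>The universal property of the free algebra, written out on words: the algebra
  homomorphism that sends \<open>gen g\<close> to \<open>f g\<close>.\<close>

definition subst :: "('g \<Rightarrow> 'k free) \<Rightarrow> 'g free \<Rightarrow> 'k free"
  where "subst f p = (\<Sum>w\<in>Poly_Mapping.keys p.
    cst (Poly_Mapping.lookup p w) * prod_list (map f (letters w)))"

lemma subst_upto:
  assumes "finite W" "Poly_Mapping.keys p \<subseteq> W"
  shows "subst f p = (\<Sum>w\<in>W. cst (Poly_Mapping.lookup p w) * prod_list (map f (letters w)))"
  unfolding subst_def
  by (rule sum.mono_neutral_left)
    (use assms in \<open>auto simp: not_in_keys_iff_lookup_eq_zero cst_simps\<close>)

lemma subst_add: "subst f (p + q) = subst f p + subst f q"
proof -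
  define W where "W = Poly_Mapping.keys p \<union> Poly_Mapping.keys q"
  have "finite W" "Poly_Mapping.keys p \<subseteq> W" "Poly_Mapping.keys q \<subseteq> W" "Poly_Mapping.keys (p + q) \<subseteq> W"
    using keys_add[of p q] by (auto simp: W_def)
  then show ?thesis
    by (simp add: subst_upto[of W] lookup_add cst_simps distrib_right sum.distrib)
qed

lemma subst_zero: "subst f 0 = 0"
  by (simp add: subst_def)

lemma subst_sum: "subst f (sum g A) = (\<Sum>a\<in>A. subst f (g a))"
  by (induction A rule: infinite_finite_induct) (simp_all add: subst_zero subst_add)

lemma subst_single: "subst f (Poly_Mapping.single w c) = cst c * prod_list (map f (letters w))"
  by (simp add: subst_def cst_simps)

lemma subst_mult: "subst f (p * q) = subst f p * subst f q"
proof -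
  have *: "subst f (Poly_Mapping.single v c * Poly_Mapping.single w d) =
      subst f (Poly_Mapping.single v c) * subst f (Poly_Mapping.single w d)" for v w c d
  proof -
    let ?v = "prod_list (map f (letters v))" and ?w = "prod_list (map f (letters w))"
    have "subst f (Poly_Mapping.single v c * Poly_Mapping.single w d) = cst c * (cst d * ?v) * ?w"
      by (simp add: mult_single subst_single plus_fword_def cst_simps mult.assoc)
    also have "\<dots> = (cst c * ?v) * (cst d * ?w)"
      by (simp only: cst_commute[of d ?v] mult.assoc)
    finally show ?thesis
      by (simp only: subst_single)
  qed
  have "p * q = (\<Sum>v\<in>Poly_Mapping.keys p. \<Sum>w\<in>Poly_Mapping.keys q.
      Poly_Mapping.single v (Poly_Mapping.lookup p v) * Poly_Mapping.single w (Poly_Mapping.lookup q w))"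
    unfolding sum_product[symmetric] by (rule arg_cong2[of _ _ _ _ "(*)"]; rule free_sum_single)
  then have "subst f (p * q) =
      (\<Sum>v\<in>Poly_Mapping.keys p. \<Sum>w\<in>Poly_Mapping.keys q.
        subst f (Poly_Mapping.single v (Poly_Mapping.lookup p v) *
          Poly_Mapping.single w (Poly_Mapping.lookup q w)))"
    by (simp only: subst_sum)
  also have "\<dots> = subst f p * subst f q"
    unfolding * subst_single subst_def[of f p] subst_def[of f q] sum_product ..
  finally show ?thesis .
qed

lemma rng_hom_subst: "rng_hom (subst f)"
  by (simp add: rng_hom_def subst_add subst_mult)

lemma subst_cst [simp]: "subst f (cst c) = cst c"
  by (simp add: cst_def subst_single zero_fword_def)

lemma subst_one [simp]: "subst f 1 = 1"
  by (metis subst_cst cst_simps(2))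

lemma subst_gen [simp]: "subst f (gen g) = f g"
  by (simp add: gen_def subst_single cst_simps)

lemma subst_prod_list: "subst f (prod_list ps) = prod_list (map (subst f) ps)"
  by (induction ps) (simp_all add: subst_mult)

lemma subst_power: "subst f (p ^ n) = subst f p ^ n"
  by (induction n) (simp_all add: subst_mult)

lemmas subst_simps = subst_add subst_zero subst_sum subst_mult subst_power
  rng_hom_diff[OF rng_hom_subst] rng_hom_uminus[OF rng_hom_subst]

lemma subst_subst: "subst f (subst g p) = subst (\<lambda>x. subst f (g x)) p"
  by (simp add: subst_def[of g] subst_def[of "\<lambda>x. subst f (g x)"] subst_sum subst_mult
      subst_prod_list comp_def)

text \<open>Only letters that occur in \<open>p\<close> matter, so a substitution that fixes just
  the generators in \<open>S\<close> is the identity on the free algebra on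
  \<open>S\<close>.\<close>

lemma subst_gen_id:
  assumes "\<And>w g. w \<in> Poly_Mapping.keys p \<Longrightarrow> g \<in> set (letters w) \<Longrightarrow> f g = gen g"
  shows "subst f p = p"
proof -
  have "cst (Poly_Mapping.lookup p w) * prod_list (map f (letters w)) =
      Poly_Mapping.single w (Poly_Mapping.lookup p w)" if "w \<in> Poly_Mapping.keys p" for w
    using assms[OF that] single_Word[of "letters w"] by (metis fword.collapse map_eq_conv)
  then show ?thesis
    by (simp add: subst_def flip: free_sum_single)
qed


section \<open>Graded subalgebras of the free algebra\<close>

lemma free_alg_simps [simp]:
  "mult (free_alg S deg) = (*)" "one (free_alg S deg) = 1" "zero (free_alg S deg) = 0"
  "add (free_alg S deg) = (+)" "smult (free_alg S deg) = (\<lambda>c p. cst c * p)"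
  by (simp_all add: free_alg_def)

lemma carrier_free_alg:
  "carrier (free_alg S deg) = {p. \<forall>w\<in>Poly_Mapping.keys p. set (letters w) \<subseteq> S}"
  by (simp add: free_alg_def)

lemma grade_free_alg:
  "grade (free_alg S deg) d = {p \<in> carrier (free_alg S deg).
    \<forall>w\<in>Poly_Mapping.keys p. (\<Sum>g\<leftarrow>letters w. deg g) = d}"
  by (auto simp: free_alg_def)

lemma free_alg_carrierI:
  shows "0 \<in> carrier (free_alg S deg)" "1 \<in> carrier (free_alg S deg)"
    "cst c \<in> carrier (free_alg S deg)" "g \<in> S \<Longrightarrow> gen g \<in> carrier (free_alg S deg)"
  by (auto simp: carrier_free_alg cst_def gen_def zero_fword_def split: if_splits)

lemma free_alg_carrier_add:
  "p \<in> carrier (free_alg S deg) \<Longrightarrow> q \<in> carrier (free_alg S deg) \<Longrightarrow> p + q \<in> carrier (free_alg S deg)"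
  using keys_add[of p q] by (auto simp: carrier_free_alg)

lemma free_alg_carrier_mult:
  "p \<in> carrier (free_alg S deg) \<Longrightarrow> q \<in> carrier (free_alg S deg) \<Longrightarrow> p * q \<in> carrier (free_alg S deg)"
  using keys_mult[of p q] by (fastforce simp: carrier_free_alg plus_fword_def)

lemma free_alg_carrier_uminus:
  "p \<in> carrier (free_alg S deg) \<Longrightarrow> - p \<in> carrier (free_alg S deg)"
  by (simp add: carrier_free_alg)

lemma free_alg_carrier_diff:
  "p \<in> carrier (free_alg S deg) \<Longrightarrow> q \<in> carrier (free_alg S deg) \<Longrightarrow> p - q \<in> carrier (free_alg S deg)"
  by (metis diff_conv_add_uminus free_alg_carrier_add free_alg_carrier_uminus)

lemma free_alg_carrier_power:
  "p \<in> carrier (free_alg S deg) \<Longrightarrow> p ^ n \<in> carrier (free_alg S deg)"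
  by (induction n) (simp_all add: free_alg_carrierI free_alg_carrier_mult)

lemma free_alg_carrier_sum:
  "(\<And>a. a \<in> A \<Longrightarrow> f a \<in> carrier (free_alg S deg)) \<Longrightarrow> sum f A \<in> carrier (free_alg S deg)"
  by (induction A rule: infinite_finite_induct)
    (simp_all add: free_alg_carrierI free_alg_carrier_add)

lemmas free_alg_closed = free_alg_carrierI free_alg_carrier_add free_alg_carrier_mult
  free_alg_carrier_uminus free_alg_carrier_diff free_alg_carrier_power free_alg_carrier_sum

lemma ring_free_alg: "ring (free_alg S deg)"
proof (rule ringI)
  show "abelian_group (free_alg S deg)"
  proof (rule abelian_groupI)
    fix p assume "p \<in> carrier (free_alg S deg)"
    then show "\<exists>q\<in>carrier (free_alg S deg). q \<oplus>\<^bsub>free_alg S deg\<^esub> p = \<zero>\<^bsub>free_alg S deg\<^esub>"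
      by (intro bexI[of _ "- p"]) (simp_all add: free_alg_closed)
  qed (simp_all add: free_alg_closed algebra_simps)
  show "Group.monoid (free_alg S deg)"
    by (rule monoidI) (simp_all add: free_alg_closed mult.assoc)
qed (simp_all add: algebra_simps)

lemma free_alg_a_inv:
  "p \<in> carrier (free_alg S deg) \<Longrightarrow> \<ominus>\<^bsub>free_alg S deg\<^esub> p = - p"
  by (rule abelian_group.minus_equality)
    (simp_all add: ring.is_abelian_group[OF ring_free_alg] free_alg_closed)

lemma free_alg_nat_pow: "p [^]\<^bsub>free_alg S deg\<^esub> (n::nat) = p ^ n"
  by (induction n) (simp_all add: Group.nat_pow_def power_commutes)

lemma grade_carrier: "grade (free_alg S deg) d \<subseteq> carrier (free_alg S deg)"
  by (auto simp: grade_free_alg)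

lemma grade_zero: "0 \<in> grade (free_alg S deg) d"
  and grade_cst: "cst c \<in> grade (free_alg S deg) 0"
  and grade_gen: "g \<in> S \<Longrightarrow> gen g \<in> grade (free_alg S deg) (deg g)"
  by (auto simp: grade_free_alg free_alg_closed cst_def gen_def zero_fword_def
      carrier_free_alg split: if_splits)

lemma grade_add:
  "p \<in> grade (free_alg S deg) d \<Longrightarrow> q \<in> grade (free_alg S deg) d \<Longrightarrow> p + q \<in> grade (free_alg S deg) d"
  using keys_add[of p q] by (auto simp: grade_free_alg free_alg_closed)

lemma grade_uminus: "p \<in> grade (free_alg S deg) d \<Longrightarrow> - p \<in> grade (free_alg S deg) d"
  by (auto simp: grade_free_alg free_alg_closed)

lemma grade_diff:
  "p \<in> grade (free_alg S deg) d \<Longrightarrow> q \<in> grade (free_alg S deg) d \<Longrightarrow> p - q \<in> grade (free_alg S deg) d"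
  by (metis diff_conv_add_uminus grade_add grade_uminus)

lemma grade_mult:
  assumes "p \<in> grade (free_alg S deg) d" "q \<in> grade (free_alg S deg) e"
  shows "p * q \<in> grade (free_alg S deg) (d + e)"
  using assms keys_mult[of p q]
  by (fastforce simp: grade_free_alg free_alg_closed plus_fword_def)

lemma grade_power:
  "p \<in> grade (free_alg S deg) d \<Longrightarrow> p ^ n \<in> grade (free_alg S deg) (int n * d)"
proof (induction n)
  case 0
  then show ?case using grade_cst[of 1] by (simp add: cst_simps)
next
  case (Suc n)
  then show ?case using grade_mult[of p S deg d "p ^ n" "int n * d"] by (simp add: algebra_simps)
qed

lemma grade_sum:
  "(\<And>a. a \<in> A \<Longrightarrow> f a \<in> grade (free_alg S deg) d) \<Longrightarrow> sum f A \<in> grade (free_alg S deg) d"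
  by (induction A rule: infinite_finite_induct) (simp_all add: grade_zero grade_add)

lemma subst_closed:
  assumes "\<And>g. g \<in> S \<Longrightarrow> f g \<in> carrier (free_alg S' deg')" "p \<in> carrier (free_alg S deg)"
  shows "subst f p \<in> carrier (free_alg S' deg')"
proof -
  have "prod_list (map f l) \<in> carrier (free_alg S' deg')" if "set l \<subseteq> S" for l
    using that by (induction l) (simp_all add: assms(1) free_alg_closed)
  then show ?thesis
    unfolding subst_def using assms(2)
    by (intro free_alg_closed) (auto simp: carrier_free_alg)
qed

lemma subst_grade:
  assumes "\<And>g. g \<in> S \<Longrightarrow> f g \<in> grade (free_alg S' deg') (deg g)"
    "p \<in> grade (free_alg S deg) d"
  shows "subst f p \<in> grade (free_alg S' deg') d"
proof -
  have *: "prod_list (map f l) \<in> grade (free_alg S' deg') (\<Sum>g\<leftarrow>l. deg g)" if "set l \<subseteq> S" for l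
    using that
  proof (induction l)
    case Nil
    then show ?case using grade_cst[of 1] by (simp add: cst_simps)
  qed (simp add: assms(1) grade_mult)
  have "cst c * prod_list (map f (letters w)) \<in> grade (free_alg S' deg') d"
    if "w \<in> Poly_Mapping.keys p" for w c
    using grade_mult[OF grade_cst *] assms(2) that
    by (auto simp: grade_free_alg carrier_free_alg)
  then show ?thesis
    unfolding subst_def by (intro grade_sum)
qed

text \<open>Substitutions that are mutually inverse on generators are mutually inverse on the
  algebras. Both respect degrees, which gives equality of the homogeneous parts and not only an
  inclusion.\<close>

lemma subst_gr_alg_iso:
  assumes f: "\<And>g. g \<in> S \<Longrightarrow> f g \<in> grade (free_alg S' deg') (deg g)"
    and f': "\<And>g. g \<in> S' \<Longrightarrow> f' g \<in> grade (free_alg S deg) (deg' g)"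
    and inv: "\<And>g. g \<in> S \<Longrightarrow> subst f' (f g) = gen g" "\<And>g. g \<in> S' \<Longrightarrow> subst f (f' g) = gen g"
  shows "subst f \<in> gr_alg_iso (free_alg S deg) (free_alg S' deg')"
proof -
  let ?A = "free_alg S deg" and ?B = "free_alg S' deg'"
  have closed: "subst f p \<in> carrier ?B" if "p \<in> carrier ?A" for p
    using subst_closed[OF _ that] f grade_carrier by blast
  have closed': "subst f' p \<in> carrier ?A" if "p \<in> carrier ?B" for p
    using subst_closed[OF _ that] f' grade_carrier by blast
  have left: "subst f' (subst f p) = p" if "p \<in> carrier ?A" for p
    unfolding subst_subst using that inv(1) by (intro subst_gen_id) (auto simp: carrier_free_alg)
  have right: "subst f (subst f' p) = p" if "p \<in> carrier ?B" for p
    unfolding subst_subst using that inv(2) by (intro subst_gen_id) (auto simp: carrier_free_alg)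
  have bij: "bij_betw (subst f) (carrier ?A) (carrier ?B)"
    by (rule bij_betw_byWitness[where f' = "subst f'"]) (auto simp: left right closed closed')
  have iso: "subst f \<in> ring_iso ?A ?B"
    using bij closed by (auto intro!: ring_iso_memI simp: subst_add subst_mult)
  have "subst f ` grade ?A d = grade ?B d" for d
  proof
    show "subst f ` grade ?A d \<subseteq> grade ?B d"
      using subst_grade[of S f S' deg' deg] f by auto
    show "grade ?B d \<subseteq> subst f ` grade ?A d"
    proof
      fix p assume p: "p \<in> grade ?B d"
      then have "subst f' p \<in> grade ?A d"
        using subst_grade[of S' f' S deg deg'] f' by auto
      moreover have "p = subst f (subst f' p)"
        using right[of p] p grade_carrier[of S' deg' d] by (simp add: subset_iff)
      ultimately show "p \<in> subst f ` grade ?A d" by blast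
    qed
  qed
  then show ?thesis
    using iso by (simp add: gr_alg_iso_def subst_zero subst_mult)
qed


section \<open>Ideals of subalgebras of the free algebra\<close>

text \<open>An ideal of the free algebra on \<open>S\<close> is extended to the free algebra on all generators by
  the generators outside \<open>S\<close>.\<close>

definition extended_ideal :: "'g set \<Rightarrow> 'g free set \<Rightarrow> 'g free set"
  where "extended_ideal S J = {p. subst (\<lambda>g. if g \<in> S then gen g else 0) p \<in> J}"

text \<open>The set is the preimage of \<open>J\<close> under a homomorphism, the one that kills the
  generators outside \<open>S\<close> and therefore takes values in the free algebra on
  \<open>S\<close>.\<close>

lemma two_sided_ideal_extended:
  assumes "ideal J (free_alg S deg)"
  shows "two_sided_ideal (extended_ideal S J)"
proof -
  interpret ideal J "free_alg S deg" by fact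
  have "subst (\<lambda>g. if g \<in> S then gen g else 0) p \<in> carrier (free_alg S deg)" for p :: "'a free"
    by (rule subst_closed[where S = UNIV and deg = deg])
      (auto simp: free_alg_closed carrier_free_alg[of UNIV])
  note closed = this
  show ?thesis
    unfolding two_sided_ideal_def extended_ideal_def
  proof (intro conjI ballI allI; unfold mem_Collect_eq)
    let ?f = "subst (\<lambda>g. if g \<in> S then gen g else 0)"
    show "?f 0 \<in> J"
      using additive_subgroup.zero_closed[OF is_additive_subgroup] by (simp add: subst_zero)
    show "?f (p + q) \<in> J" if "?f p \<in> J" "?f q \<in> J" for p q
      using additive_subgroup.a_closed[OF is_additive_subgroup that] by (simp add: subst_add)
    show "?f (q * p) \<in> J" "?f (p * q) \<in> J" if "?f p \<in> J" for p q
      using I_l_closed[OF that closed] I_r_closed[OF that closed] by (simp_all add: subst_mult)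
  qed
qed

lemma mem_extended_ideal_iff:
  assumes "p \<in> carrier (free_alg S deg)"
  shows "p \<in> extended_ideal S J \<longleftrightarrow> p \<in> J"
proof -
  have "subst (\<lambda>g. if g \<in> S then gen g else 0) p = p"
    using assms by (intro subst_gen_id) (auto simp: carrier_free_alg)
  then show ?thesis
    by (simp add: extended_ideal_def)
qed

text \<open>Makes dots beyond the last position vanish, such as the third argument of
  \<open>eval_at\<close> at the last crossing.\<close>

lemma gen_mem_extended_ideal:
  assumes "ideal J (free_alg S deg)" "g \<notin> S"
  shows "gen g \<in> extended_ideal S J"
proof -
  have "0 \<in> J"
    using additive_subgroup.zero_closed[OF ideal.axioms(1)[OF assms(1)]] by simp
  then show ?thesis
    using assms(2) by (simp add: extended_ideal_def)
qed


section \<open>Isomorphisms of quotient algebras\<close>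

lemma a_r_coset_image:
  assumes "ring_hom_ring A B F" "J \<subseteq> carrier A" "a \<in> carrier A"
  shows "F ` (J +>\<^bsub>A\<^esub> a) = F ` J +>\<^bsub>B\<^esub> F a"
proof -
  interpret ring_hom_ring A B F by fact
  show ?thesis
    using assms(2,3) by (auto simp: a_r_coset_def' image_iff subset_iff)
qed

text \<open>Elements of the quotient are cosets, hence sets, and \<open>F\<close> carries the coset
  of \<open>a\<close> onto that of \<open>F a\<close>. The induced map is therefore the formation of
  images.\<close>

lemma gr_alg_iso_quot:
  assumes A: "ring A" and B: "ring B" and F: "F \<in> gr_alg_iso A B" and J: "ideal J A"
    and smult: "\<And>c a. a \<in> carrier A \<Longrightarrow> c \<odot>\<^bsub>A\<^esub> a \<in> carrier A"
    and grade: "\<And>d. grade A d \<subseteq> carrier A"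
  shows "(`) F \<in> gr_alg_iso (quot_alg A J) (quot_alg B (F ` J))"
proof -
  interpret J: ideal J A by fact
  have hom: "ring_hom_ring A B F" and bij: "bij_betw F (carrier A) (carrier B)"
    using A B F by (auto simp: gr_alg_iso_def ring_iso_def ring_hom_ringI2)
  interpret ring_hom_ring A B F by fact
  have J_sub: "J \<subseteq> carrier A" by (rule J.a_subset)
  have coset: "F ` (J +>\<^bsub>A\<^esub> a) = F ` J +>\<^bsub>B\<^esub> F a" if "a \<in> carrier A" for a
    using a_r_coset_image[OF hom J_sub that] .
  have sub: "U \<subseteq> carrier A" if "U \<in> carrier (A Quot J)" for U
    using that J.a_rcosets_carrier by (simp add: FactRing_def)
  have "inj_on ((`) F) (carrier (A Quot J))"
    using inj_on_image[of F "carrier (A Quot J)"] sub bij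
    by (meson Sup_least bij_betw_def inj_on_subset)
  moreover have "((`) F) ` carrier (A Quot J) = carrier (B Quot (F ` J))"
  proof -
    have "((`) F) ` carrier (A Quot J) = (\<lambda>a. F ` J +>\<^bsub>B\<^esub> F a) ` carrier A"
      by (simp add: FactRing_def A_RCOSETS_def' UNION_singleton_eq_range image_image coset
          cong: image_cong_simp)
    also have "\<dots> = (\<lambda>b. F ` J +>\<^bsub>B\<^esub> b) ` (F ` carrier A)"
      by (simp add: image_image)
    also have "\<dots> = carrier (B Quot (F ` J))"
      using bij by (auto simp: FactRing_def A_RCOSETS_def' bij_betw_def)
    finally show ?thesis .
  qed
  ultimately have bij': "bij_betw ((`) F) (carrier (A Quot J)) (carrier (B Quot (F ` J)))"
    by (simp add: bij_betw_def)
  have mult: "F ` rcoset_mult A J U V = rcoset_mult B (F ` J) (F ` U) (F ` V)"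
    if "U \<in> carrier (A Quot J)" "V \<in> carrier (A Quot J)" for U V
    using sub[OF that(1)] sub[OF that(2)]
    by (simp add: rcoset_mult_def image_UN coset subset_iff)
  have add: "F ` set_add A U V = set_add B (F ` U) (F ` V)"
    if "U \<in> carrier (A Quot J)" "V \<in> carrier (A Quot J)" for U V
    using sub[OF that(1)] sub[OF that(2)]
    by (simp add: set_add_def set_mult_def image_UN subset_iff)
  have iso: "(`) F \<in> ring_iso (quot_alg A J) (quot_alg B (F ` J))"
    using bij' bij_betwE[OF bij'] mult add
    by (intro ring_iso_memI) (simp_all add: quot_alg_def FactRing_def coset)
  have "F ` (\<Union>a\<in>U. J +>\<^bsub>A\<^esub> (c \<odot>\<^bsub>A\<^esub> a)) = (\<Union>b\<in>F ` U. F ` J +>\<^bsub>B\<^esub> (c \<odot>\<^bsub>B\<^esub> b))"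
    if "U \<in> carrier (A Quot J)" for U c
    using sub[OF that] F smult by (simp add: image_UN coset subset_iff gr_alg_iso_def)
  moreover have "((`) F) ` grade (quot_alg A J) d = grade (quot_alg B (F ` J)) d" for d
  proof -
    have "((`) F) ` grade (quot_alg A J) d = (\<lambda>b. F ` J +>\<^bsub>B\<^esub> b) ` F ` grade A d"
      using grade[of d] by (force simp: quot_alg_def coset subset_iff image_iff)
    then show ?thesis
      using F by (simp add: quot_alg_def gr_alg_iso_def)
  qed
  ultimately show ?thesis
    using iso by (simp add: gr_alg_iso_def) (simp add: quot_alg_def FactRing_def)
qed

lemma gr_alg_iso_comp:
  assumes F: "F \<in> gr_alg_iso A B" and G: "G \<in> gr_alg_iso B C"
  shows "G \<circ> F \<in> gr_alg_iso A C"
proof -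
  have "F a \<in> carrier B" if "a \<in> carrier A" for a
    using F that by (auto simp: gr_alg_iso_def ring_iso_def ring_hom_def)
  moreover have "G \<circ> F \<in> ring_iso A C"
    using F G ring_iso_set_trans by (auto simp: gr_alg_iso_def)
  moreover have "(\<lambda>x. G (F x)) ` grade A d = grade C d" for d
    using F G image_image[of G F "grade A d"] by (simp add: gr_alg_iso_def)
  ultimately show ?thesis
    using F G by (simp add: gr_alg_iso_def)
qed

text \<open>\<open>quot_alg A J\<close> has the ring operations of \<open>A Quot J\<close> but is a
  different record; the identity map transports the axioms.\<close>

lemma ring_quot_alg:
  assumes "ideal J A"
  shows "ring (quot_alg A J)"
proof -
  interpret ring "A Quot J"
    using assms by (rule ideal.quotient_is_ring)
  have "id \<in> ring_iso (A Quot J) (quot_alg A J)"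
    by (auto intro!: ring_iso_memI simp: quot_alg_def)
  from ring_iso_imp_img_ring[OF this] show ?thesis
    by (simp add: quot_alg_def)
qed

text \<open>Serves to recognise the convolution algebra as a ring by means of its
  presentation.\<close>

lemma gr_alg_iso_ring:
  assumes "ring A" "F \<in> gr_alg_iso A B"
  shows "ring B"
proof -
  interpret ring A by fact
  have "F \<in> ring_iso A B" "F \<zero>\<^bsub>A\<^esub> = \<zero>\<^bsub>B\<^esub>"
    using assms(2) by (auto simp: gr_alg_iso_def)
  then show ?thesis
    using ring_iso_imp_img_ring[of F B] by simp
qed

text \<open>Preimages of ideals under \<open>F\<close> and under its inverse are ideals, so each
  inclusion need only be checked on generating relations.\<close>

lemma Idl_image_eq:
  assumes A: "ring A" and B: "ring B" and F: "F \<in> ring_iso A B"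
    and R: "R \<subseteq> carrier A" and S: "S \<subseteq> carrier B"
    and RS: "F ` R \<subseteq> Idl\<^bsub>B\<^esub> S" and SR: "S \<subseteq> F ` (Idl\<^bsub>A\<^esub> R)"
  shows "F ` (Idl\<^bsub>A\<^esub> R) = Idl\<^bsub>B\<^esub> S"
proof
  interpret A: ring A by fact
  interpret B: ring B by fact
  define G where "G = inv_into (carrier A) F"
  have G: "G \<in> ring_iso B A"
    unfolding G_def by (rule ring_iso_set_sym[OF A F])
  have bij: "bij_betw F (carrier A) (carrier B)"
    using F by (simp add: ring_iso_def)
  interpret F: ring_hom_ring A B F
    using F A B by (simp add: ring_iso_def ring_hom_ringI2)
  interpret G: ring_hom_ring B A G
    using G A B by (simp add: ring_iso_def ring_hom_ringI2)
  have "Idl\<^bsub>A\<^esub> R \<subseteq> {a \<in> carrier A. F a \<in> Idl\<^bsub>B\<^esub> S}"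
    using R RS by (intro A.genideal_minimal F.ideal_vimage B.genideal_ideal S) auto
  then show "F ` (Idl\<^bsub>A\<^esub> R) \<subseteq> Idl\<^bsub>B\<^esub> S" by auto
  have sub: "Idl\<^bsub>A\<^esub> R \<subseteq> carrier A"
    using ideal.Icarr[OF A.genideal_ideal[OF R]] by blast
  have GF: "G (F a) = a" if "a \<in> carrier A" for a
    using bij that by (simp add: G_def bij_betw_def)
  have FG: "F (G b) = b" if "b \<in> carrier B" for b
    using bij that by (simp add: G_def bij_betw_def f_inv_into_f)
  have "S \<subseteq> {b \<in> carrier B. G b \<in> Idl\<^bsub>A\<^esub> R}"
    using S SR sub GF by (fastforce simp: image_iff subset_iff)
  then have "Idl\<^bsub>B\<^esub> S \<subseteq> {b \<in> carrier B. G b \<in> Idl\<^bsub>A\<^esub> R}"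
    by (intro B.genideal_minimal G.ideal_vimage A.genideal_ideal R)
  then show "Idl\<^bsub>B\<^esub> S \<subseteq> F ` (Idl\<^bsub>A\<^esub> R)"
    using FG by (force simp: image_iff)
qed


section \<open>The polynomials in the relations\<close>

lemma frac_simps:
  "frac (p + q) = frac p + frac q" "frac (p - q) = frac p - frac q" "frac (- p) = - frac p"
  "frac (p * q) = frac p * frac q" "frac 0 = 0" "frac 1 = 1"
  by (simp_all add: frac_def Zero_fract_def One_fract_def)

lemma frac_power: "frac (p ^ n) = frac p ^ n"
  by (induction n) (simp_all add: frac_simps)

lemma frac_eq_iff: "frac p = frac q \<longleftrightarrow> p = q"
  by (simp add: frac_def eq_fract)

lemma frac_eq_0_iff: "frac p = 0 \<longleftrightarrow> p = 0"
  by (metis frac_eq_iff frac_simps(5))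

lemma as_poly_eqI: "r = frac p \<Longrightarrow> as_poly r = p"
  by (simp add: as_poly_def frac_eq_iff)

lemma frac_mult_divide: "q \<noteq> 0 \<Longrightarrow> frac (q * r) / frac q = frac r"
  by (simp add: frac_simps frac_eq_0_iff)

lemma var_diff_nonzero: "var_u - var_v \<noteq> 0" "var_u - var_w \<noteq> 0" "var_v - var_w \<noteq> 0"
  by (simp_all add: var_u_def var_v_def var_w_def)

text \<open>The denominator cancels because a difference of equal powers is divisible by the
  difference of the bases, here (u - v) - (w - v) = u - w.\<close>

lemma Q_quot_mult:
  "Q_quot Q i j * (var_u - var_w) = Q_pol Q i j var_u var_v - Q_pol Q i j var_w var_v"
proof -
  let ?n = "nat (- cartan Q i j)"
  obtain s where s: "(var_u - var_v) ^ ?n - (var_w - var_v) ^ ?n = (var_u - var_w) * s"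
    using power_diff_sumr2[of "var_u - var_v" ?n "var_w - var_v"] by auto
  have *: "Q_pol Q i j var_u var_v - Q_pol Q i j var_w var_v =
      (var_u - var_w) * (const3 ((-1) ^ num_arrows Q i j) * s)"
    by (simp add: Q_pol_def right_diff_distrib[symmetric] s mult.left_commute)
  have "Q_quot Q i j = const3 ((-1) ^ num_arrows Q i j) * s"
    unfolding Q_quot_def * by (intro as_poly_eqI frac_mult_divide var_diff_nonzero)
  then show ?thesis
    by (simp add: * mult.commute)
qed

text \<open>Here \<open>Q_pol\<close> does not depend on its arguments. This reconciles the clause
  \<open>cartan Q i j < 0\<close> of \<open>klr_braid\<close> with the relation of \<sigma>, which
  has no such clause.\<close>

lemma Q_quot_eq_0:
  assumes "cartan Q i j = 0"
  shows "Q_quot Q i j = 0"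
proof -
  have "Q_quot Q i j * (var_u - var_w) = 0"
    by (simp add: Q_quot_mult Q_pol_def assms)
  then show ?thesis
    using var_diff_nonzero(2) by simp
qed

section \<open>Values of \<open>dP_pol\<close>, \<open>P3_pol\<close> and \<open>P3'_pol\<close> for
  a given number of loops\<close>

lemma minus_diff_power: "(y - x) ^ n = (-1) ^ n * (x - y :: 'a::comm_ring_1) ^ n"
  by (metis minus_diff_eq power_minus)

lemma dP_pol_0: "num_loops Q i = 0 \<Longrightarrow> dP_pol Q i = 0"
  by (simp add: dP_pol_def P_pol_def as_poly_eqI frac_simps)

text \<open>Exchanging u and v multiplies the power \<open>m + 1\<close> of u - v by minus
  \<open>(-1) ^ m\<close>; one factor u - v then cancels.\<close>

lemma dP_pol_Suc:
  assumes "num_loops Q i = Suc m"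
  shows "dP_pol Q i = (1 + (-1) ^ m) * (var_u - var_v) ^ m"
proof -
  have "P_pol Q i var_u var_v - P_pol Q i var_v var_u =
      (var_u - var_v) * ((1 + (-1) ^ m) * (var_u - var_v) ^ m)"
    by (simp add: P_pol_def assms minus_diff_power[of var_v var_u] algebra_simps del: power_Suc)
      (simp add: algebra_simps)
  then show ?thesis
    unfolding dP_pol_def by (simp only: as_poly_eqI frac_mult_divide var_diff_nonzero not_False_eq_True)
qed

text \<open>With P = 1, the three fractions cancel over their common denominator because u - w = (u
  - v) + (v - w).\<close>

lemma P3_pol_0: "num_loops Q i = 0 \<Longrightarrow> P3_pol Q i = 0" "num_loops Q i = 0 \<Longrightarrow> P3'_pol Q i = 0"
proof -
  have c: "var_u - var_w = (var_u - var_v) + (var_v - var_w)" by simp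
  have nz: "frac (var_u - var_v) \<noteq> 0" "frac (var_v - var_w) \<noteq> 0"
    "frac (var_u - var_v) + frac (var_v - var_w) \<noteq> 0"
    using var_diff_nonzero unfolding frac_simps(1)[symmetric] frac_eq_0_iff by simp_all
  show "num_loops Q i = 0 \<Longrightarrow> P3_pol Q i = 0" "num_loops Q i = 0 \<Longrightarrow> P3'_pol Q i = 0"
    unfolding P3_pol_def P3'_pol_def Let_def c frac_simps(4) frac_simps(1)[of "var_u - var_v"]
    using nz by (intro as_poly_eqI; simp add: P_pol_def frac_simps(5,6) divide_simps; algebra)+
qed

text \<open>In the presence of a loop every P contains its own linear factor, so each of the three
  fractions is a polynomial by itself. The signs come from P with reversed arguments.\<close>

lemma P3_pol_Suc:
  fixes Q :: "('i, 'h) pre_digraph"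
  defines "a \<equiv> var_u - var_v" and "b \<equiv> var_v - var_w" and "c \<equiv> var_u - var_w"
  assumes "num_loops Q i = Suc m"
  shows "P3_pol Q i = (-1) ^ m * (a ^ m * c ^ m) - c ^ m * b ^ m + a ^ m * b ^ m"
    and "P3'_pol Q i = a ^ m * c ^ m - (-1) ^ m * (c ^ m * b ^ m) - a ^ m * b ^ m"
proof -
  have nz: "a \<noteq> 0" "b \<noteq> 0" "c \<noteq> 0"
    using var_diff_nonzero by (simp_all add: a_def b_def c_def)
  have P: "P_pol Q i var_v var_u = - ((-1) ^ m) * (a * a ^ m)" "P_pol Q i var_u var_w = c * c ^ m"
    "P_pol Q i var_v var_w = b * b ^ m" "P_pol Q i var_u var_v = a * a ^ m"
    "P_pol Q i var_w var_v = - ((-1) ^ m) * (b * b ^ m)"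
    by (simp_all add: P_pol_def assms(4) a_def b_def c_def minus_diff_power[of var_v var_u]
        minus_diff_power[of var_w var_v] del: power_Suc) simp_all
  have F: "P_pol Q i var_v var_u * P_pol Q i var_u var_w = a * c * (- ((-1) ^ m) * (a ^ m * c ^ m))"
    "P_pol Q i var_u var_w * P_pol Q i var_v var_w = c * b * (c ^ m * b ^ m)"
    "P_pol Q i var_u var_v * P_pol Q i var_v var_w = a * b * (a ^ m * b ^ m)"
    "P_pol Q i var_u var_v * P_pol Q i var_u var_w = a * c * (a ^ m * c ^ m)"
    "P_pol Q i var_u var_w * P_pol Q i var_w var_v = c * b * (- ((-1) ^ m) * (c ^ m * b ^ m))"
    unfolding P by (simp_all add: mult_ac)
  have nz': "a * c \<noteq> 0" "c * b \<noteq> 0" "a * b \<noteq> 0"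
    using nz by simp_all
  show "P3_pol Q i = (-1) ^ m * (a ^ m * c ^ m) - c ^ m * b ^ m + a ^ m * b ^ m"
    unfolding P3_pol_def Let_def F a_def[symmetric] b_def[symmetric] c_def[symmetric]
      frac_mult_divide[OF nz'(1)] frac_mult_divide[OF nz'(2)] frac_mult_divide[OF nz'(3)]
    by (intro as_poly_eqI) (simp add: frac_simps frac_power)
  show "P3'_pol Q i = a ^ m * c ^ m - (-1) ^ m * (c ^ m * b ^ m) - a ^ m * b ^ m"
    unfolding P3'_pol_def Let_def F a_def[symmetric] b_def[symmetric] c_def[symmetric]
      frac_mult_divide[OF nz'(1)] frac_mult_divide[OF nz'(2)] frac_mult_divide[OF nz'(3)]
    by (intro as_poly_eqI) (simp add: frac_simps frac_power)
qed

section \<open>Polynomials that do not involve the outermost variable\<close>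

lemma degree_0_mult: "degree p = 0 \<Longrightarrow> degree q = 0 \<Longrightarrow> degree (p * q) = 0"
  using degree_mult_le[of p q] by simp

lemma degree_0_diff:
  fixes p q :: "'a::comm_ring_1 poly"
  shows "degree p = 0 \<Longrightarrow> degree q = 0 \<Longrightarrow> degree (p - q) = 0"
  using degree_diff_le[of p 0 q] by simp

lemma degree_0_power: "degree p = 0 \<Longrightarrow> degree (p ^ n) = 0"
  by (induction n) (simp_all add: degree_0_mult)

text \<open>The degree is that in \<open>var_w\<close>. Degree zero keeps the relations at the last
  crossing, where \<open>k + 2\<close> exceeds the number of positions, inside the free algebra on
  the generators.\<close>

lemma degree_w_free: "degree var_u = 0" "degree var_v = 0" "degree (const3 c) = 0"
  by (simp_all add: var_u_def var_v_def const3_def)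

lemma degree_Q_pol: "degree (Q_pol Q i j var_u var_v) = 0"
  unfolding Q_pol_def by (intro degree_0_mult degree_0_diff degree_0_power degree_w_free)

lemma degree_P_pol: "degree (P_pol Q i var_u var_v) = 0"
  unfolding P_pol_def by (intro degree_0_mult degree_0_diff degree_0_power degree_w_free)

lemma degree_dP_pol: "degree (dP_pol Q i) = 0"
proof (cases "num_loops Q i")
  case 0
  then show ?thesis by (simp add: dP_pol_0)
next
  case (Suc m)
  have "degree (1 + (-1) ^ m :: poly3) = 0"
    by (cases "even m") (simp_all add: degree_numeral)
  then show ?thesis
    unfolding dP_pol_Suc[OF Suc] by (intro degree_0_mult degree_0_diff degree_0_power degree_w_free)
qed

lemma degree_klr_square: "degree (klr_square Q i j) = 0"
  unfolding klr_square_def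
  by (auto simp: degree_Q_pol intro!: degree_0_mult degree_0_diff degree_0_power degree_w_free)


section \<open>Exchanging neighbours in a sequence\<close>

lemma length_Seqs:
  assumes "fin_digraph Q" "\<ii> \<in> Seqs Q \<nu>"
  shows "length \<ii> = size_of Q \<nu>"
proof -
  interpret fin_digraph Q by fact
  have "length \<ii> = (\<Sum>i\<in>verts Q. count_list \<ii> i)"
    using assms(2) by (intro sum_count_set[symmetric]) (auto simp: Seqs_def)
  then show ?thesis
    using assms(2) by (simp add: Seqs_def size_of_def)
qed

lemma finite_Seqs:
  assumes "fin_digraph Q"
  shows "finite (Seqs Q \<nu>)"
proof -
  interpret fin_digraph Q by fact
  have "Seqs Q \<nu> \<subseteq> {\<ii>. set \<ii> \<subseteq> verts Q \<and> length \<ii> = size_of Q \<nu>}"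
    using length_Seqs[OF assms] by (auto simp: Seqs_def)
  then show ?thesis
    using finite_lists_length_eq[OF finite_verts] finite_subset by blast
qed

lemma ent_swap_seq:
  assumes "1 \<le> k" "k < length \<ii>" "1 \<le> l"
  shows "ent (swap_seq k \<ii>) l = ent \<ii> (Transposition.transpose k (k + 1) l)"
  using assms by (auto simp: ent_def swap_seq_def Transposition.transpose_def nth_list_update)

lemma swap_seq_eq_self:
  assumes "1 \<le> k" "k < length \<ii>" "ent \<ii> k = ent \<ii> (k + 1)"
  shows "swap_seq k \<ii> = \<ii>"
  using assms by (simp add: swap_seq_def ent_def) (metis list_update_id)

lemma swap_seq_swap_seq:
  assumes "1 \<le> k" "k < length \<ii>"
  shows "swap_seq k (swap_seq k \<ii>) = \<ii>"
proof (rule nth_equalityI)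
  show "length (swap_seq k (swap_seq k \<ii>)) = length \<ii>"
    by (simp add: swap_seq_def)
  show "swap_seq k (swap_seq k \<ii>) ! l = \<ii> ! l" if "l < length (swap_seq k (swap_seq k \<ii>))" for l
    using assms that by (auto simp: swap_seq_def ent_def nth_list_update)
qed

lemma swap_seq_Seqs:
  assumes "1 \<le> k" "k < length \<ii>" "\<ii> \<in> Seqs Q \<nu>"
  shows "swap_seq k \<ii> \<in> Seqs Q \<nu>"
proof -
  have "mset (swap_seq k \<ii>) = mset \<ii>"
    using assms mset_swap[of k \<ii> "k - 1"] by (simp add: swap_seq_def ent_def)
  then show ?thesis
    using assms(3) by (auto simp: Seqs_def simp flip: count_mset set_mset_mset)
qed


section \<open>The change of crossings\<close>

text \<open>For \<open>x = y\<close> this is commutation; otherwise it moves a power of dots across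
  a crossing.\<close>

lemma intertwine_power:
  fixes t :: "'a::monoid_mult"
  assumes "t * x = y * t"
  shows "t * x ^ n = y ^ n * t"
proof (induction n)
  case (Suc n)
  have "t * x ^ Suc n = (t * x) * x ^ n" by (simp add: mult.assoc)
  also have "\<dots> = y * (t * x ^ n)" by (simp add: assms mult.assoc)
  finally show ?case by (simp add: Suc mult.assoc)
qed simp

lemma mult_eq_left: "x * y = z \<Longrightarrow> x * (y * w) = z * (w :: 'a::semigroup_mult)"
  by (simp flip: mult.assoc)

lemma mult_eq_left': "x * y = y * x \<Longrightarrow> x * (y * w) = y * (x * (w :: 'a::semigroup_mult))"
  by (metis mult.assoc)

lemma slide_two:
  fixes t u :: "'a::semigroup_mult"
  assumes "u * x = y * u" "t * y = z * t"
  shows "t * (u * (x * w)) = z * t * (u * w)"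
proof -
  have "t * (u * (x * w)) = t * (y * (u * w))"
    by (simp only: assms(1) mult.assoc[symmetric])
  also have "\<dots> = z * t * (u * w)"
    by (simp only: assms(2) mult.assoc[symmetric])
  finally show ?thesis .
qed

text \<open>In the next two identities \<open>t\<close> and \<open>u\<close> are the crossings \<open>\<tau>\<^sub>k\<close> and \<open>\<tau>\<^sub>k\<^sub>+\<^sub>1\<close>, \<open>A\<close>, \<open>B\<close>, \<open>C\<close>
  are the \<open>m\<close>-th powers of \<open>x\<^sub>k - x\<^sub>k\<^sub>+\<^sub>1\<close>, \<open>x\<^sub>k\<^sub>+\<^sub>1 - x\<^sub>k\<^sub>+\<^sub>2\<close>, \<open>x\<^sub>k - x\<^sub>k\<^sub>+\<^sub>2\<close>, and \<open>e = (-1)\<^sup>m\<close>.\<close>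

lemma square_identity:
  fixes t A e :: "'a::ring_1"
  assumes e: "e = 1 \<or> e = - 1" and tA: "t * A = e * (A * t)"
  shows "(t - A) * (t - A) + (1 + e) * (A * (t - A)) = t * t - e * (A * A)"
  using e
proof
  assume "e = 1"
  then show ?thesis using tA by (simp add: algebra_simps mult_2)
next
  assume "e = - 1"
  then show ?thesis using tA by (simp add: algebra_simps)
qed

lemma braid_identity:
  fixes t u A B C e :: "'a::ring_1"
  assumes e: "e = 1 \<or> e = - 1"
    and comm: "B * A = A * B" "C * A = A * C" "C * B = B * C"
    and t: "t * A = e * (A * t)" "t * B = C * t" "t * C = B * t"
    and u: "u * A = C * u" "u * B = e * (B * u)" "u * C = A * u"
    and sq: "t * t = e * (A * A)" "u * u = e * (B * B)"
  shows "(t - A) * ((u - B) * (t - A)) - (u - B) * ((t - A) * (u - B)) =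
    t * (u * t) - u * (t * u) + (e * (A * C) - C * B + A * B) * (t - A)
      + (A * C - e * (C * B) - A * B) * (u - B)"
proof -
  \<comment> \<open>The rules move \<open>A\<close>, \<open>B\<close>, \<open>C\<close> to the left
    of the crossings, in this order, and remove squares of crossings; \<open>left\<close> supplies
    the same rules with one more factor on the right, as right-nested products require. The two
    values of \<open>e\<close> are treated separately, so that \<open>e\<close> never has to be
    moved.\<close>
  note rules = comm t u sq
  note left = rules[THEN mult_eq_left]
  show ?thesis
    using e
  proof
    assume "e = 1"
    then show ?thesis
      using rules left by (simp add: algebra_simps)
  next
    assume "e = - 1"
    then show ?thesis
      using rules left by (simp add: algebra_simps)
  qed
qed

text \<open>\<open>S\<close> and \<open>T\<close> play the roles of \<sigma> and \<tau>. The
  assumptions are common to both sides, so that each relation for \<open>S\<close> can be shown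
  equivalent to one for \<open>T\<close>. \<open>S_sum\<close> and \<open>T_sum\<close> express that
  the idempotents add up to a right unit for the crossings; their sum is the image of
  \<open>1\<close> under a non-unital homomorphism and may differ from \<open>1\<close>.\<close>

locale twisted_crossings =
  fixes Q :: "('i, 'h) pre_digraph" and \<nu> :: "'i \<Rightarrow> nat"
    and E :: "'i list \<Rightarrow> 'a::ring_1" and X S T :: "nat \<Rightarrow> 'a"
  assumes fin: "fin_digraph Q"
    and E_mult: "\<And>\<ii> \<jj>. \<ii> \<in> Seqs Q \<nu> \<Longrightarrow> \<jj> \<in> Seqs Q \<nu> \<Longrightarrow> E \<ii> * E \<jj> = (if \<ii> = \<jj> then E \<ii> else 0)"
    and X_E: "\<And>\<ii> k. \<ii> \<in> Seqs Q \<nu> \<Longrightarrow> E \<ii> * X k = X k * E \<ii>"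
    and X_X: "\<And>k l. X k * X l = X l * X k"
    and S_E: "\<And>\<ii> k. \<ii> \<in> Seqs Q \<nu> \<Longrightarrow> 1 \<le> k \<Longrightarrow> k < size_of Q \<nu> \<Longrightarrow>
      S k * E \<ii> = E (swap_seq k \<ii>) * S k"
    and T_E: "\<And>\<ii> k. \<ii> \<in> Seqs Q \<nu> \<Longrightarrow> 1 \<le> k \<Longrightarrow> k < size_of Q \<nu> \<Longrightarrow>
      T k * E \<ii> = E (swap_seq k \<ii>) * T k"
    and S_sum: "\<And>k. 1 \<le> k \<Longrightarrow> k < size_of Q \<nu> \<Longrightarrow> S k = (\<Sum>\<ii>\<in>Seqs Q \<nu>. S k * E \<ii>)"
    and T_sum: "\<And>k. 1 \<le> k \<Longrightarrow> k < size_of Q \<nu> \<Longrightarrow> T k = (\<Sum>\<ii>\<in>Seqs Q \<nu>. T k * E \<ii>)"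
    and twist: "\<And>\<ii> k. \<ii> \<in> Seqs Q \<nu> \<Longrightarrow> 1 \<le> k \<Longrightarrow> k < size_of Q \<nu> \<Longrightarrow>
      T k * E \<ii> =
        (if ent \<ii> k = ent \<ii> (k + 1)
         then if num_loops Q (ent \<ii> k) = 0 then - (S k * E \<ii>)
              else S k * E \<ii> + (X k - X (k + 1)) ^ (num_loops Q (ent \<ii> k) - 1) * E \<ii>
         else S k * E \<ii>)"
begin

abbreviation n where "n \<equiv> size_of Q \<nu>"

definition d :: "nat \<Rightarrow> 'a" where "d k = X k - X (k + 1)"

text \<open>With \<open>shift_tw\<close> this puts the three cases of the twist into one affine
  form: a sign times the old crossing, plus a polynomial in the dots.\<close>

definition sgn_tw :: "nat \<Rightarrow> 'i list \<Rightarrow> 'a"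
  where "sgn_tw k \<ii> = (if ent \<ii> k = ent \<ii> (k + 1) \<and> num_loops Q (ent \<ii> k) = 0 then - 1 else 1)"

definition shift_tw :: "nat \<Rightarrow> 'i list \<Rightarrow> 'a"
  where "shift_tw k \<ii> = (if ent \<ii> k = ent \<ii> (k + 1) \<and> num_loops Q (ent \<ii> k) \<noteq> 0
    then d k ^ (num_loops Q (ent \<ii> k) - 1) else 0)"

lemma twist': "\<ii> \<in> Seqs Q \<nu> \<Longrightarrow> 1 \<le> k \<Longrightarrow> k < n \<Longrightarrow>
    T k * E \<ii> = sgn_tw k \<ii> * S k * E \<ii> + shift_tw k \<ii> * E \<ii>"
  by (subst twist) (auto simp: sgn_tw_def shift_tw_def d_def)

lemma d_commute: "X l * d k = d k * X l" "\<ii> \<in> Seqs Q \<nu> \<Longrightarrow> E \<ii> * d k = d k * E \<ii>"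
  "d k * d l = d l * d k"
  by (simp_all add: d_def algebra_simps X_X X_E)

lemma d_power_commute: "X l * d k ^ m = d k ^ m * X l" "\<ii> \<in> Seqs Q \<nu> \<Longrightarrow> E \<ii> * d k ^ m = d k ^ m * E \<ii>"
  using d_commute intertwine_power by metis+

lemma d_power_d_power: "d k ^ m * d l ^ m' = d l ^ m' * d k ^ m"
  using d_commute(3) intertwine_power by metis

lemma shift_tw_commute: "X l * shift_tw k \<ii> = shift_tw k \<ii> * X l"
  "\<jj> \<in> Seqs Q \<nu> \<Longrightarrow> E \<jj> * shift_tw k \<ii> = shift_tw k \<ii> * E \<jj>"
  "shift_tw l \<jj> * shift_tw k \<ii> = shift_tw k \<ii> * shift_tw l \<jj>"
  by (simp_all add: shift_tw_def d_power_commute d_power_d_power)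

lemma len: "\<ii> \<in> Seqs Q \<nu> \<Longrightarrow> length \<ii> = n"
  using length_Seqs[OF fin] .

lemma swap_Seqs: "\<ii> \<in> Seqs Q \<nu> \<Longrightarrow> 1 \<le> k \<Longrightarrow> k < n \<Longrightarrow> swap_seq k \<ii> \<in> Seqs Q \<nu>"
  using swap_seq_Seqs[of k \<ii>] len[of \<ii>] by simp

lemma ent_swap:
  "\<ii> \<in> Seqs Q \<nu> \<Longrightarrow> 1 \<le> k \<Longrightarrow> k < n \<Longrightarrow> 1 \<le> l \<Longrightarrow>
    ent (swap_seq k \<ii>) l = ent \<ii> (Transposition.transpose k (k + 1) l)"
  using ent_swap_seq len by metis

lemma swap_self:
  "\<ii> \<in> Seqs Q \<nu> \<Longrightarrow> 1 \<le> k \<Longrightarrow> k < n \<Longrightarrow> ent \<ii> k = ent \<ii> (k + 1) \<Longrightarrow> swap_seq k \<ii> = \<ii>"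
  using swap_seq_eq_self len by metis

lemma E_idem: "\<ii> \<in> Seqs Q \<nu> \<Longrightarrow> E \<ii> * E \<ii> = E \<ii>"
  by (simp add: E_mult)

text \<open>The twist is known only on single sequences. Inserting the idempotent of the sequence
  reached after the rightmost crossing makes it applicable to every factor of a product.\<close>

lemma S_stage:
  assumes "\<ii> \<in> Seqs Q \<nu>" "1 \<le> k" "k < n"
  shows "y * S k * E \<ii> = (y * E (swap_seq k \<ii>)) * (S k * E \<ii>)"
proof -
  have "E (swap_seq k \<ii>) * (S k * E \<ii>) = S k * E \<ii>"
    by (metis S_E[OF assms] E_idem[OF assms(1)] mult.assoc)
  then show ?thesis by (simp add: mult.assoc)
qed

lemma T_stage:
  assumes "\<ii> \<in> Seqs Q \<nu>" "1 \<le> k" "k < n"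
  shows "y * T k * E \<ii> = (y * E (swap_seq k \<ii>)) * (T k * E \<ii>)"
proof -
  have "E (swap_seq k \<ii>) * (T k * E \<ii>) = T k * E \<ii>"
    by (metis T_E[OF assms] E_idem[OF assms(1)] mult.assoc)
  then show ?thesis by (simp add: mult.assoc)
qed


subsection \<open>Crossings and dots\<close>

text \<open>The shift is a polynomial in the dots and commutes with them, so it contributes only its
  product with the difference of the two dots.\<close>

lemma slide_shift:
  assumes "\<ii> \<in> Seqs Q \<nu>" "1 \<le> k" "k < n"
  shows "(X l' * T k - T k * X l) * E \<ii> =
    sgn_tw k \<ii> * ((X l' * S k - S k * X l) * E \<ii>) + (X l' - X l) * shift_tw k \<ii> * E \<ii>"
proof -
  have "(X l' * T k - T k * X l) * E \<ii> = X l' * (T k * E \<ii>) - (T k * E \<ii>) * X l"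
    by (simp add: algebra_simps X_E[OF assms(1)])
  also have "\<dots> = sgn_tw k \<ii> * ((X l' * S k - S k * X l) * E \<ii>) + (X l' - X l) * shift_tw k \<ii> * E \<ii>"
    unfolding twist'[OF assms]
    by (simp add: algebra_simps X_E[OF assms(1)] shift_tw_commute mult_eq_left'[OF shift_tw_commute(1)]
        sgn_tw_def)
  finally show ?thesis .
qed

definition kkp_slide_val :: "nat \<Rightarrow> nat \<Rightarrow> 'i list \<Rightarrow> 'a"
  where "kkp_slide_val k l \<ii> =
    (if l = k \<and> ent \<ii> k = ent \<ii> (k + 1) then d k ^ num_loops Q (ent \<ii> k) * E \<ii>
     else if l = k + 1 \<and> ent \<ii> k = ent \<ii> (k + 1) then - (d k ^ num_loops Q (ent \<ii> k) * E \<ii>)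
     else 0)"

definition klr_slide_val :: "nat \<Rightarrow> 'i list \<Rightarrow> 'a"
  where "klr_slide_val k \<ii> =
    (if ent \<ii> k = ent \<ii> (k + 1) \<and> num_loops Q (ent \<ii> k) = 0 then E \<ii> else 0)"

definition kkp_slides :: "nat \<Rightarrow> 'i list \<Rightarrow> bool"
  where "kkp_slides k \<ii> \<longleftrightarrow> (\<forall>l\<in>{1..n}.
    (X (Transposition.transpose k (k + 1) l) * S k - S k * X l) * E \<ii> = kkp_slide_val k l \<ii>)"

definition klr_slides :: "nat \<Rightarrow> 'i list \<Rightarrow> bool"
  where "klr_slides k \<ii> \<longleftrightarrow>
    (\<forall>l\<in>{1..n}. l \<noteq> k \<longrightarrow> l \<noteq> k + 1 \<longrightarrow> (T k * X l - X l * T k) * E \<ii> = 0) \<and>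
    (X k * T k - T k * X (k + 1)) * E \<ii> = klr_slide_val k \<ii> \<and>
    (T k * X k - X (k + 1) * T k) * E \<ii> = klr_slide_val k \<ii>"

lemma kkp_slides_iff:
  assumes "\<ii> \<in> Seqs Q \<nu>" "1 \<le> k" "k < n"
  shows "kkp_slides k \<ii> \<longleftrightarrow> klr_slides k \<ii>"
proof -
  have far: "(T k * X l - X l * T k) * E \<ii> = 0 \<longleftrightarrow>
      (X (Transposition.transpose k (k + 1) l) * S k - S k * X l) * E \<ii> = kkp_slide_val k l \<ii>"
    if "l \<noteq> k" "l \<noteq> k + 1" for l
  proof -
    have "(T k * X l - X l * T k) * E \<ii> = - ((X l * T k - T k * X l) * E \<ii>)"
      by (simp add: algebra_simps)
    then show ?thesis
      using that by (simp add: slide_shift[OF assms] kkp_slide_val_def sgn_tw_def)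
  qed
  \<comment> \<open>The choice of exponent: with loops, one more factor \<open>d k\<close> turns the
    shift into the P of the slide relation and cancels the correction term. Without loops P is 1,
    and the sign of the twist turns one relation into the other.\<close>
  have shift: "d k * shift_tw k \<ii> * E \<ii> + (if ent \<ii> k = ent \<ii> (k + 1) \<and> num_loops Q (ent \<ii> k) = 0 then E \<ii> else 0) =
      (if ent \<ii> k = ent \<ii> (k + 1) then d k ^ num_loops Q (ent \<ii> k) * E \<ii> else 0)"
    by (cases "num_loops Q (ent \<ii> k)") (auto simp: shift_tw_def)
  have right: "(X k * T k - T k * X (k + 1)) * E \<ii> = klr_slide_val k \<ii> \<longleftrightarrow>
      (X k * S k - S k * X (k + 1)) * E \<ii> = kkp_slide_val k (k + 1) \<ii>"
    using shift unfolding slide_shift[OF assms] d_def[symmetric] kkp_slide_val_def klr_slide_val_def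
    by (auto simp: sgn_tw_def shift_tw_def algebra_simps eq_neg_iff_add_eq_0 minus_equation_iff)
  have "(T k * X k - X (k + 1) * T k) * E \<ii> = - ((X (k + 1) * T k - T k * X k) * E \<ii>)"
    by (simp add: algebra_simps)
  also have "\<dots> = - (sgn_tw k \<ii> * ((X (k + 1) * S k - S k * X k) * E \<ii>)) + d k * shift_tw k \<ii> * E \<ii>"
    unfolding slide_shift[OF assms] by (simp add: d_def algebra_simps)
  finally have "(T k * X k - X (k + 1) * T k) * E \<ii> = klr_slide_val k \<ii> \<longleftrightarrow>
      (X (k + 1) * S k - S k * X k) * E \<ii> = kkp_slide_val k k \<ii>"
    using shift unfolding kkp_slide_val_def klr_slide_val_def
    by (auto simp: sgn_tw_def shift_tw_def algebra_simps)
  with far right assms show ?thesis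
    unfolding kkp_slides_def klr_slides_def
    by (auto 4 3 simp: Transposition.transpose_def)
qed

text \<open>The excluded case, a dot on a crossing of two equal vertices without loops, is the only
  one in which a correction term survives.\<close>

lemma T_slide:
  assumes "\<ii> \<in> Seqs Q \<nu>" "1 \<le> k" "k < n" "klr_slides k \<ii>" "l \<in> {1..n}"
    "ent \<ii> k \<noteq> ent \<ii> (k + 1) \<or> num_loops Q (ent \<ii> k) \<noteq> 0 \<or> l \<noteq> k \<and> l \<noteq> k + 1"
  shows "T k * E \<ii> * X l = X (Transposition.transpose k (k + 1) l) * (T k * E \<ii>)"
proof -
  have "(T k * X l - X (Transposition.transpose k (k + 1) l) * T k) * E \<ii> = 0"
    using assms(4-6) by (auto simp: klr_slides_def klr_slide_val_def Transposition.transpose_def algebra_simps)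
  then show ?thesis
    by (simp add: algebra_simps X_E[OF assms(1)])
qed

lemma T_slide_power:
  assumes "\<ii> \<in> Seqs Q \<nu>" "1 \<le> k" "k < n" "klr_slides k \<ii>" "p \<in> {1..n}" "q \<in> {1..n}"
    "ent \<ii> k \<noteq> ent \<ii> (k + 1) \<or> num_loops Q (ent \<ii> k) \<noteq> 0"
  shows "T k * E \<ii> * (X p - X q) ^ m =
    (X (Transposition.transpose k (k + 1) p) - X (Transposition.transpose k (k + 1) q)) ^ m * (T k * E \<ii>)"
proof -
  have "T k * E \<ii> * X l = X (Transposition.transpose k (k + 1) l) * (T k * E \<ii>)"
    if "l \<in> {1..n}" for l
    using T_slide[OF assms(1-4) that] assms(7) by blast
  then show ?thesis
    using assms(5,6) by (intro intertwine_power) (simp only: right_diff_distrib left_diff_distrib)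
qed

lemma S_eq_T:
  assumes "\<ii> \<in> Seqs Q \<nu>" "1 \<le> k" "k < n" "ent \<ii> k \<noteq> ent \<ii> (k + 1)"
  shows "S k * E \<ii> = T k * E \<ii>"
  using assms by (simp add: twist)

lemma S_eq_T_diff:
  assumes "\<ii> \<in> Seqs Q \<nu>" "1 \<le> k" "k < n" "ent \<ii> k = ent \<ii> (k + 1)"
    "num_loops Q (ent \<ii> k) = Suc m"
  shows "S k * E \<ii> = T k * E \<ii> - d k ^ m * E \<ii>"
proof -
  have "T k * E \<ii> = S k * E \<ii> + d k ^ m * E \<ii>"
    using twist[OF assms(1-3)] assms(4,5) by (simp add: d_def)
  then show ?thesis by simp
qed

lemma S_eq_minus_T:
  assumes "\<ii> \<in> Seqs Q \<nu>" "1 \<le> k" "k < n" "ent \<ii> k = ent \<ii> (k + 1)"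
    "num_loops Q (ent \<ii> k) = 0"
  shows "S k * E \<ii> = - (T k * E \<ii>)"
  using assms by (simp add: twist)


subsection \<open>Squares of crossings\<close>

lemma E_T_self:
  assumes "\<ii> \<in> Seqs Q \<nu>" "1 \<le> k" "k < n" "ent \<ii> k = ent \<ii> (k + 1)"
  shows "E \<ii> * T k = T k * E \<ii>"
  using T_E[OF assms(1-3)] swap_self[OF assms] by simp

lemma square_unequal:
  assumes "\<ii> \<in> Seqs Q \<nu>" "1 \<le> k" "k < n" "ent \<ii> k \<noteq> ent \<ii> (k + 1)"
  shows "S k * S k * E \<ii> = T k * T k * E \<ii>"
proof -
  have "ent (swap_seq k \<ii>) k \<noteq> ent (swap_seq k \<ii>) (k + 1)"
    using assms by (simp add: ent_swap)
  then have "S k * E (swap_seq k \<ii>) = T k * E (swap_seq k \<ii>)"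
    using assms by (intro S_eq_T swap_Seqs)
  then show ?thesis
    using S_eq_T[OF assms] by (simp add: S_stage[OF assms(1-3)] T_stage[OF assms(1-3)])
qed

lemma square_no_loops:
  assumes "\<ii> \<in> Seqs Q \<nu>" "1 \<le> k" "k < n" "ent \<ii> k = ent \<ii> (k + 1)"
    "num_loops Q (ent \<ii> k) = 0"
  shows "S k * S k * E \<ii> = T k * T k * E \<ii>"
  using S_eq_minus_T[OF assms] swap_self[OF assms(1-4)]
  by (simp add: S_stage[OF assms(1-3)] T_stage[OF assms(1-3)])

lemma T_d_power:
  assumes "\<ii> \<in> Seqs Q \<nu>" "1 \<le> k" "k < n" "ent \<ii> k = ent \<ii> (k + 1)"
    "num_loops Q (ent \<ii> k) \<noteq> 0" "klr_slides k \<ii>"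
  shows "T k * E \<ii> * d k ^ m = (-1) ^ m * (d k ^ m * (T k * E \<ii>))"
proof -
  have "T k * E \<ii> * d k ^ m = (- d k) ^ m * (T k * E \<ii>)"
    using T_slide_power[OF assms(1-3,6), of k "k + 1" m] assms by (simp add: d_def)
  then show ?thesis
    by (simp add: power_minus[of "d k"] mult.assoc)
qed

text \<open>The crossing takes \<open>\<ii>\<close> to itself, so \<open>square_identity\<close>
  applies to \<open>T k\<close> and its shift, both cut off by the idempotent.\<close>

lemma square_loops:
  assumes "\<ii> \<in> Seqs Q \<nu>" "1 \<le> k" "k < n" "ent \<ii> k = ent \<ii> (k + 1)"
    "num_loops Q (ent \<ii> k) = Suc m" "klr_slides k \<ii>"
  shows "S k * S k * E \<ii> + (1 + (-1) ^ m) * (d k ^ m * (S k * E \<ii>)) =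
    T k * T k * E \<ii> - (-1) ^ m * (d k ^ m * d k ^ m) * E \<ii>"
proof -
  let ?t = "T k * E \<ii>" and ?A = "d k ^ m * E \<ii>"
  note EX = d_power_commute(2)[OF assms(1)]
  have t: "E \<ii> * ?t = ?t" "?t * E \<ii> = ?t"
    using E_T_self[OF assms(1-4)] E_idem[OF assms(1)] by (simp_all add: mult.assoc flip: mult.assoc[of "E \<ii>"])
  have "?t * ?A = ?t * d k ^ m"
    by (simp only: EX[symmetric] mult.assoc[symmetric] t(2))
  also have "\<dots> = (-1) ^ m * (?A * ?t)"
    using T_d_power[OF assms(1-4) _ assms(6)] assms(5) by (simp add: mult.assoc t(1)[unfolded mult.assoc])
  finally have tA: "?t * ?A = (-1) ^ m * (?A * ?t)" .
  have AA: "?A * ?A = d k ^ m * d k ^ m * E \<ii>"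
    by (metis EX E_idem[OF assms(1)] mult.assoc)
  have AS: "d k ^ m * (?t - ?A) = ?A * (?t - ?A)"
    unfolding right_diff_distrib AA unfolding mult.assoc t(1) ..
  have S: "S k * E \<ii> = ?t - ?A"
    by (rule S_eq_T_diff[OF assms(1-5)])
  have e: "(-1) ^ m = (1::'a) \<or> (-1) ^ m = (-1::'a)"
    by (simp add: minus_one_power_iff)
  show ?thesis
    unfolding S_stage[OF assms(1-3)] T_stage[OF assms(1-3)] swap_self[OF assms(1-4)] S AS
    using square_identity[OF e tA, unfolded AA] by (simp only: mult.assoc)
qed


subsection \<open>Commuting crossings\<close>

text \<open>Distant crossings do not move each other's entries, and the shift of one involves only
  dots that commute with the other. Besides the product of the two \<open>S\<close>, the expansion
  of a product of two \<open>T\<close> has terms that are symmetric in the two positions and cancel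
  in the commutator.\<close>

lemma far_crossings:
  assumes "\<ii> \<in> Seqs Q \<nu>" "1 \<le> k" "k < n" "1 \<le> l" "l < n" "k + 1 < l \<or> l + 1 < k"
    and slides: "\<And>\<jj> k. \<jj> \<in> Seqs Q \<nu> \<Longrightarrow> 1 \<le> k \<Longrightarrow> k < n \<Longrightarrow> kkp_slides k \<jj>"
  shows "(T k * T l - T l * T k) * E \<ii> =
    sgn_tw k \<ii> * sgn_tw l \<ii> * ((S k * S l - S l * S k) * E \<ii>)"
proof -
  have one_side: "T p * T q * E \<ii> = sgn_tw p \<ii> * (sgn_tw q \<ii> * (S p * S q * E \<ii>))
      + sgn_tw q \<ii> * (shift_tw p \<ii> * (S q * E \<ii>)) + sgn_tw p \<ii> * (shift_tw q \<ii> * (S p * E \<ii>))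
      + shift_tw p \<ii> * shift_tw q \<ii> * E \<ii>"
    if p: "1 \<le> p" "p < n" and q: "1 \<le> q" "q < n" and pq: "p + 1 < q \<or> q + 1 < p" for p q
  proof -
    let ?j = "swap_seq q \<ii>"
    note i = assms(1)
    have j: "?j \<in> Seqs Q \<nu>" using swap_Seqs i q by blast
    have ents: "ent ?j p = ent \<ii> p" "ent ?j (p + 1) = ent \<ii> (p + 1)"
      using pq p q by (auto simp: ent_swap[OF i q] Transposition.transpose_def)
    have same: "sgn_tw p ?j = sgn_tw p \<ii>" "shift_tw p ?j = shift_tw p \<ii>"
      unfolding sgn_tw_def shift_tw_def ents by (rule refl)+
    have S_X: "S p * E \<ii> * X r = X r * (S p * E \<ii>)" if "r \<in> {1..n}" "r \<noteq> p" "r \<noteq> p + 1" for r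
    proof -
      have "(X (Transposition.transpose p (p + 1) r) * S p - S p * X r) * E \<ii> = kkp_slide_val p r \<ii>"
        using slides[OF i p] that(1) by (simp add: kkp_slides_def)
      then show ?thesis
        using that(2,3) by (simp add: kkp_slide_val_def Transposition.transpose_def algebra_simps X_E[OF i])
    qed
    have "S p * E \<ii> * d q = d q * (S p * E \<ii>)"
      using S_X[of q] S_X[of "q + 1"] q pq
      by (auto simp: d_def right_diff_distrib left_diff_distrib)
    then have S_shift: "S p * E \<ii> * shift_tw q \<ii> = shift_tw q \<ii> * (S p * E \<ii>)"
      by (simp add: shift_tw_def intertwine_power)
    have ES: "E ?j * (S q * E \<ii>) = S q * E \<ii>"
      using S_stage[OF i q, of 1] by simp
    have "T p * T q * E \<ii> = sgn_tw q \<ii> * (T p * (S q * E \<ii>)) + (T p * E \<ii>) * shift_tw q \<ii>"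
      unfolding mult.assoc[of "T p" "T q"] twist'[OF i q]
      by (simp add: sgn_tw_def distrib_left shift_tw_commute(2)[OF i] mult.assoc)
    also have "T p * (S q * E \<ii>) = (T p * E ?j) * (S q * E \<ii>)"
      by (simp add: mult.assoc ES[unfolded mult.assoc])
    also have "\<dots> = sgn_tw p \<ii> * (S p * S q * E \<ii>) + shift_tw p \<ii> * (S q * E \<ii>)"
      unfolding twist'[OF j p] same by (simp add: distrib_right mult.assoc ES[unfolded mult.assoc])
    also have "(T p * E \<ii>) * shift_tw q \<ii> =
        sgn_tw p \<ii> * (shift_tw q \<ii> * (S p * E \<ii>)) + shift_tw p \<ii> * shift_tw q \<ii> * E \<ii>"
      unfolding twist'[OF i p] using S_shift
      by (simp add: distrib_right mult.assoc shift_tw_commute(2)[OF i])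
    finally show ?thesis
      by (simp add: sgn_tw_def distrib_left)
  qed
  have "sgn_tw k \<ii> * (sgn_tw l \<ii> * x) = sgn_tw l \<ii> * (sgn_tw k \<ii> * x)" for x
    by (simp add: sgn_tw_def)
  moreover have "l + 1 < k \<or> k + 1 < l"
    using assms(6) by blast
  ultimately show ?thesis
    using one_side[OF assms(2-6)] one_side[OF assms(4,5,2,3)]
    by (simp add: algebra_simps shift_tw_commute(3) mult_eq_left'[OF shift_tw_commute(3)])
qed


text \<open>Some relations are imposed without an idempotent. They are glued from their restrictions
  to the single sequences.\<close>

lemma T_X_global:
  assumes "1 \<le> k" "k < n" "\<And>\<ii>. \<ii> \<in> Seqs Q \<nu> \<Longrightarrow> (T k * X l - X l * T k) * E \<ii> = 0"
  shows "T k * X l = X l * T k"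
proof -
  have "T k * X l - X l * T k = (\<Sum>\<ii>\<in>Seqs Q \<nu>. (T k * X l - X l * T k) * E \<ii>)"
    by (subst (1 2) T_sum[OF assms(1,2)])
      (simp add: sum_distrib_left sum_distrib_right sum_subtractf left_diff_distrib mult.assoc X_E)
  then show ?thesis
    using assms(3) by simp
qed

lemma S_S_global:
  assumes "1 \<le> k" "k < n" "1 \<le> l" "l < n"
    and "\<And>\<ii>. \<ii> \<in> Seqs Q \<nu> \<Longrightarrow> (S k * S l - S l * S k) * E \<ii> = 0"
  shows "S k * S l = S l * S k"
proof -
  have "S p * S q = (\<Sum>\<ii>\<in>Seqs Q \<nu>. S p * S q * E \<ii>)" if "1 \<le> q" "q < n" for p q
    by (subst S_sum[OF that]) (simp add: sum_distrib_left mult.assoc)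
  from this[OF assms(3,4), of k] this[OF assms(1,2), of l] show ?thesis
    using assms(5) by (simp add: left_diff_distrib)
qed

lemma T_T_global:
  assumes "1 \<le> k" "k < n" "1 \<le> l" "l < n"
    and "\<And>\<ii>. \<ii> \<in> Seqs Q \<nu> \<Longrightarrow> (T k * T l - T l * T k) * E \<ii> = 0"
  shows "T k * T l = T l * T k"
proof -
  have "T p * T q = (\<Sum>\<ii>\<in>Seqs Q \<nu>. T p * T q * E \<ii>)" if "1 \<le> q" "q < n" for p q
    by (subst T_sum[OF that]) (simp add: sum_distrib_left mult.assoc)
  from this[OF assms(3,4), of k] this[OF assms(1,2), of l] show ?thesis
    using assms(5) by (simp add: left_diff_distrib)
qed


subsection \<open>Braids\<close>

definition S_braid :: "nat \<Rightarrow> 'i list \<Rightarrow> 'a"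
  where "S_braid k \<ii> = (S k * S (k + 1) * S k - S (k + 1) * S k * S (k + 1)) * E \<ii>"

definition T_braid :: "nat \<Rightarrow> 'i list \<Rightarrow> 'a"
  where "T_braid k \<ii> = (T k * T (k + 1) * T k - T (k + 1) * T k * T (k + 1)) * E \<ii>"

lemma S_stage3:
  assumes "\<ii> \<in> Seqs Q \<nu>" "1 \<le> k" "k < n" "1 \<le> l" "l < n"
  shows "S k * S l * S k * E \<ii> =
    (S k * E (swap_seq l (swap_seq k \<ii>))) * ((S l * E (swap_seq k \<ii>)) * (S k * E \<ii>))"
  unfolding S_stage[OF assms(1-3)] S_stage[OF swap_Seqs[OF assms(1-3)] assms(4,5)]
  by (simp only: mult.assoc)

lemma T_stage3:
  assumes "\<ii> \<in> Seqs Q \<nu>" "1 \<le> k" "k < n" "1 \<le> l" "l < n"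
  shows "T k * T l * T k * E \<ii> =
    (T k * E (swap_seq l (swap_seq k \<ii>))) * ((T l * E (swap_seq k \<ii>)) * (T k * E \<ii>))"
  unfolding T_stage[OF assms(1-3)] T_stage[OF swap_Seqs[OF assms(1-3)] assms(4,5)]
  by (simp only: mult.assoc)

context
  fixes \<ii> k
  assumes i: "\<ii> \<in> Seqs Q \<nu>" and k: "1 \<le> k" "k + 1 < n"
begin

lemma k': "k < n" "1 \<le> k + 1" using k by simp_all

lemma S_braid_stage: "S_braid k \<ii> =
    (S k * E (swap_seq (k + 1) (swap_seq k \<ii>))) * ((S (k + 1) * E (swap_seq k \<ii>)) * (S k * E \<ii>))
    - (S (k + 1) * E (swap_seq k (swap_seq (k + 1) \<ii>))) * ((S k * E (swap_seq (k + 1) \<ii>)) * (S (k + 1) * E \<ii>))"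
  unfolding S_braid_def left_diff_distrib S_stage3[OF i k(1) k'(1) k'(2) k(2)]
    S_stage3[OF i k'(2) k(2) k(1) k'(1)] ..

lemma T_braid_stage: "T_braid k \<ii> =
    (T k * E (swap_seq (k + 1) (swap_seq k \<ii>))) * ((T (k + 1) * E (swap_seq k \<ii>)) * (T k * E \<ii>))
    - (T (k + 1) * E (swap_seq k (swap_seq (k + 1) \<ii>))) * ((T k * E (swap_seq (k + 1) \<ii>)) * (T (k + 1) * E \<ii>))"
  unfolding T_braid_def left_diff_distrib T_stage3[OF i k(1) k'(1) k'(2) k(2)]
    T_stage3[OF i k'(2) k(2) k(1) k'(1)] ..

lemma swapped_Seqs: "swap_seq k \<ii> \<in> Seqs Q \<nu>" "swap_seq (k + 1) \<ii> \<in> Seqs Q \<nu>"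
  "swap_seq (k + 1) (swap_seq k \<ii>) \<in> Seqs Q \<nu>" "swap_seq k (swap_seq (k + 1) \<ii>) \<in> Seqs Q \<nu>"
  using swap_Seqs i k k' by simp_all

lemmas membership = i swapped_Seqs k k' swapped_Seqs[simplified] k[simplified]

lemma ent_swapped:
  "ent (swap_seq k \<ii>) k = ent \<ii> (k + 1)" "ent (swap_seq k \<ii>) (k + 1) = ent \<ii> k"
  "ent (swap_seq k \<ii>) (k + 2) = ent \<ii> (k + 2)"
  "ent (swap_seq (k + 1) \<ii>) k = ent \<ii> k" "ent (swap_seq (k + 1) \<ii>) (k + 1) = ent \<ii> (k + 2)"
  "ent (swap_seq (k + 1) \<ii>) (k + 2) = ent \<ii> (k + 1)"
  "ent (swap_seq (k + 1) (swap_seq k \<ii>)) k = ent \<ii> (k + 1)"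
  "ent (swap_seq (k + 1) (swap_seq k \<ii>)) (k + 1) = ent \<ii> (k + 2)"
  "ent (swap_seq (k + 1) (swap_seq k \<ii>)) (k + 2) = ent \<ii> k"
  "ent (swap_seq k (swap_seq (k + 1) \<ii>)) k = ent \<ii> (k + 2)"
  "ent (swap_seq k (swap_seq (k + 1) \<ii>)) (k + 1) = ent \<ii> k"
  "ent (swap_seq k (swap_seq (k + 1) \<ii>)) (k + 2) = ent \<ii> (k + 1)"
  using k by (simp_all add: ent_swap[OF i] ent_swap[OF swapped_Seqs(1)]
      ent_swap[OF swapped_Seqs(2)[simplified]]
      Transposition.transpose_def)

lemma k2: "k + 1 + 1 = k + 2" by simp

text \<open>Both products cross the same three pairs of entries. The middle crossing exchanges the
  two distinct ends and is left alone by the twist, and at most one other pair is equal. That pair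
  contributes the same sign to both products, or a shift that slides through and gives the same
  extra term in both.\<close>

lemma braid_distinct_ends:
  assumes "ent \<ii> k \<noteq> ent \<ii> (k + 2)"
    and slides: "\<And>\<jj> k. \<jj> \<in> Seqs Q \<nu> \<Longrightarrow> 1 \<le> k \<Longrightarrow> k < n \<Longrightarrow> klr_slides k \<jj>"
  shows "T_braid k \<ii> = 0 \<longleftrightarrow> S_braid k \<ii> = 0"
proof -
  let ?i1 = "swap_seq k \<ii>" and ?j1 = "swap_seq (k + 1) \<ii>"
  let ?i2 = "swap_seq (k + 1) ?i1" and ?j2 = "swap_seq k ?j1"
  have mid: "S (k + 1) * E ?i1 = T (k + 1) * E ?i1" "S k * E ?j1 = T k * E ?j1"
    using assms(1) k k' swapped_Seqs by (simp_all only: S_eq_T ent_swapped k2 not_False_eq_True)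
  consider (distinct) "ent \<ii> k \<noteq> ent \<ii> (k + 1)" "ent \<ii> (k + 1) \<noteq> ent \<ii> (k + 2)"
    | (left) "ent \<ii> k = ent \<ii> (k + 1)" | (right) "ent \<ii> (k + 1) = ent \<ii> (k + 2)" by blast
  then show ?thesis
  proof cases
    case distinct
    have "S k * E ?i2 = T k * E ?i2" "S k * E \<ii> = T k * E \<ii>"
      "S (k + 1) * E ?j2 = T (k + 1) * E ?j2" "S (k + 1) * E \<ii> = T (k + 1) * E \<ii>"
      using distinct k k' swapped_Seqs i by (simp_all only: S_eq_T ent_swapped k2 not_False_eq_True)
    then show ?thesis
      using mid by (simp only: T_braid_stage S_braid_stage)
  next
    case left
    have i1: "?i1 = \<ii>"
      using swap_self[OF i k(1) k'(1) left] .
    have eqs: "S k * E ?i2 = T k * E ?i2" "S (k + 1) * E \<ii> = T (k + 1) * E \<ii>"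
      using left assms(1) k k' swapped_Seqs i by (simp_all only: S_eq_T ent_swapped k2 not_False_eq_True)
    have j2: "ent ?j2 (k + 1) = ent ?j2 (k + 1 + 1)" "num_loops Q (ent ?j2 (k + 1)) = num_loops Q (ent \<ii> k)"
      using left by (simp_all only: ent_swapped k2)
    show ?thesis
    proof (cases "num_loops Q (ent \<ii> k)")
      case 0
      have "S k * E \<ii> = - (T k * E \<ii>)" "S (k + 1) * E ?j2 = - (T (k + 1) * E ?j2)"
        using left 0 j2 by (auto intro!: S_eq_minus_T membership)
      then show ?thesis
        unfolding T_braid_stage S_braid_stage mid eqs by (auto simp: algebra_simps)
    next
      case (Suc m)
      have S: "S k * E \<ii> = T k * E \<ii> - d k ^ m * E \<ii>"
        "S (k + 1) * E ?j2 = T (k + 1) * E ?j2 - d (k + 1) ^ m * E ?j2"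
        using left Suc j2 by (auto intro!: S_eq_T_diff membership)
      \<comment> \<open>The shift starts at the right end of the first product.
        \<open>T (k + 1)\<close> turns \<open>X k - X (k + 1)\<close> into
        \<open>X k - X (k + 2)\<close>, and \<open>T k\<close> turns this into
        \<open>X (k + 1) - X (k + 2)\<close>, whose power is the shift at the left end of the second
        product.\<close>
      have "T (k + 1) * E ?i1 * d k ^ m = (X k - X (k + 2)) ^ m * (T (k + 1) * E ?i1)"
        unfolding i1 d_def using k k' left assms(1)
        by (subst T_slide_power) (auto intro!: slides membership simp: Transposition.transpose_def)
      moreover have "T k * E ?i2 * (X k - X (k + 2)) ^ m = d (k + 1) ^ m * (T k * E ?i2)"
        unfolding d_def using k k' left assms(1)
        by (subst T_slide_power)
          (auto intro!: slides membership simp: Transposition.transpose_def ent_swapped[simplified])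
      ultimately have slide: "(T k * E ?i2) * ((T (k + 1) * E ?i1) * (d k ^ m * E \<ii>)) =
          d (k + 1) ^ m * (T k * E ?i2) * ((T (k + 1) * E ?i1) * E \<ii>)"
        by (rule slide_two)
      have "E ?j2 * (T k * E ?j1) = T k * E ?j1"
        using T_stage[OF swapped_Seqs(2) k(1) k'(1), of 1] by simp
      then have "E ?j2 * ((T k * E ?j1) * (T (k + 1) * E \<ii>)) = (T k * E ?j1) * (T (k + 1) * E \<ii>)"
        by (rule mult_eq_left)
      then have "(d (k + 1) ^ m * E ?j2) * ((T k * E ?j1) * (T (k + 1) * E \<ii>)) =
          d (k + 1) ^ m * (T k * E ?i2) * ((T (k + 1) * E ?i1) * E \<ii>)"
        unfolding i1 by (simp add: mult.assoc E_idem[OF i])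
      then show ?thesis
        unfolding T_braid_stage S_braid_stage mid eqs S right_diff_distrib left_diff_distrib slide
        by simp
    qed
  next
    case right
    have j1: "?j1 = \<ii>"
      using swap_self[OF i k'(2) k(2)] right by (simp add: k2)
    have eqs: "S (k + 1) * E ?j2 = T (k + 1) * E ?j2" "S k * E \<ii> = T k * E \<ii>"
      using right assms(1) k k' swapped_Seqs i by (simp_all only: S_eq_T ent_swapped k2 not_False_eq_True)
    have i2: "ent ?i2 k = ent ?i2 (k + 1)" "num_loops Q (ent ?i2 k) = num_loops Q (ent \<ii> (k + 1))"
      using right by (simp_all only: ent_swapped k2)
    show ?thesis
    proof (cases "num_loops Q (ent \<ii> (k + 1))")
      case 0
      have "S (k + 1) * E \<ii> = - (T (k + 1) * E \<ii>)" "S k * E ?i2 = - (T k * E ?i2)"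
        using right 0 i2 by (auto intro!: S_eq_minus_T membership simp: k2)
      then show ?thesis
        unfolding T_braid_stage S_braid_stage mid eqs by (auto simp: algebra_simps)
    next
      case (Suc m)
      have S: "S (k + 1) * E \<ii> = T (k + 1) * E \<ii> - d (k + 1) ^ m * E \<ii>"
        "S k * E ?i2 = T k * E ?i2 - d k ^ m * E ?i2"
        using right Suc i2 by (auto intro!: S_eq_T_diff membership simp: k2)
      \<comment> \<open>The mirror image: the shift at the right end of the second product travels
        to the left and meets the one at the left end of the first.\<close>
      have "T k * E ?j1 * d (k + 1) ^ m = (X k - X (k + 2)) ^ m * (T k * E ?j1)"
        unfolding j1 d_def using k k' right assms(1)
        by (subst T_slide_power) (auto intro!: slides membership simp: Transposition.transpose_def)
      moreover have "T (k + 1) * E ?j2 * (X k - X (k + 2)) ^ m = d k ^ m * (T (k + 1) * E ?j2)"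
        unfolding d_def using k k' right assms(1)
        by (subst T_slide_power)
          (auto intro!: slides membership simp: Transposition.transpose_def ent_swapped[simplified])
      ultimately have slide: "(T (k + 1) * E ?j2) * ((T k * E ?j1) * (d (k + 1) ^ m * E \<ii>)) =
          d k ^ m * (T (k + 1) * E ?j2) * ((T k * E ?j1) * E \<ii>)"
        by (rule slide_two)
      have "E ?i2 * (T (k + 1) * E ?i1) = T (k + 1) * E ?i1"
        using T_stage[OF swapped_Seqs(1) k'(2) k(2), of 1] by simp
      then have "E ?i2 * ((T (k + 1) * E ?i1) * (T k * E \<ii>)) = (T (k + 1) * E ?i1) * (T k * E \<ii>)"
        by (rule mult_eq_left)
      then have "(d k ^ m * E ?i2) * ((T (k + 1) * E ?i1) * (T k * E \<ii>)) =
          d k ^ m * (T (k + 1) * E ?j2) * ((T k * E ?j1) * E \<ii>)"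
        unfolding j1 by (simp add: mult.assoc E_idem[OF i])
      then show ?thesis
        unfolding T_braid_stage S_braid_stage mid eqs S right_diff_distrib left_diff_distrib slide
        by simp
    qed
  qed
qed

text \<open>In each product either all three crossings change sign, or only the middle one, which
  exchanges the equal ends.\<close>

lemma braid_no_loops:
  assumes "ent \<ii> k = ent \<ii> (k + 2)" "num_loops Q (ent \<ii> k) = 0"
  shows "T_braid k \<ii> = - S_braid k \<ii>"
proof (cases "ent \<ii> k = ent \<ii> (k + 1)")
  case True
  have self: "swap_seq k \<ii> = \<ii>" "swap_seq (k + 1) \<ii> = \<ii>"
    using swap_self[OF i k(1) k'(1) True] swap_self[OF i k'(2) k(2)] True assms(1) by (simp_all add: k2)
  have "S k * E \<ii> = - (T k * E \<ii>)" "S (k + 1) * E \<ii> = - (T (k + 1) * E \<ii>)"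
    using True assms by (auto intro!: S_eq_minus_T membership simp: k2)
  then show ?thesis
    unfolding T_braid_stage S_braid_stage self by simp
next
  case False
  have ne: "ent \<ii> k \<noteq> ent \<ii> (k + 1)" "ent \<ii> (k + 1) \<noteq> ent \<ii> (k + 2)"
    "ent \<ii> (k + 1) \<noteq> ent \<ii> k"
    using False assms(1) by metis+
  have "S k * E (swap_seq (k + 1) (swap_seq k \<ii>)) = T k * E (swap_seq (k + 1) (swap_seq k \<ii>))"
    "S (k + 1) * E (swap_seq k (swap_seq (k + 1) \<ii>)) = T (k + 1) * E (swap_seq k (swap_seq (k + 1) \<ii>))"
    "S k * E \<ii> = T k * E \<ii>" "S (k + 1) * E \<ii> = T (k + 1) * E \<ii>"
    by (intro S_eq_T membership; use ne assms(1) in \<open>simp only: ent_swapped k2 not_False_eq_True\<close>)+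
  moreover have "S (k + 1) * E (swap_seq k \<ii>) = - (T (k + 1) * E (swap_seq k \<ii>))"
    using assms(2) by (intro S_eq_minus_T membership) (simp_all only: ent_swapped k2 assms(1))
  moreover have "S k * E (swap_seq (k + 1) \<ii>) = - (T k * E (swap_seq (k + 1) \<ii>))"
    using assms(2) by (intro S_eq_minus_T membership) (simp_all only: ent_swapped k2 assms(1))
  ultimately show ?thesis
    unfolding T_braid_stage S_braid_stage by simp
qed

text \<open>Only the middle crossings are shifted, by powers of \<open>d (k + 1)\<close> and
  \<open>d k\<close>. Across the outer crossing on the left both turn into the same power of
  \<open>X k - X (k + 2)\<close>, and the outer crossings, now adjacent, form a square.\<close>

lemma braid_middle_loops:
  assumes "ent \<ii> k = ent \<ii> (k + 2)" "ent \<ii> k \<noteq> ent \<ii> (k + 1)"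
    and m: "num_loops Q (ent \<ii> k) = Suc m"
    and slides: "\<And>\<jj> k. \<jj> \<in> Seqs Q \<nu> \<Longrightarrow> 1 \<le> k \<Longrightarrow> k < n \<Longrightarrow> klr_slides k \<jj>"
  shows "T_braid k \<ii> = S_braid k \<ii> +
    (X k - X (k + 2)) ^ m * (S k * S k * E \<ii> - S (k + 1) * S (k + 1) * E \<ii>)"
proof -
  let ?i1 = "swap_seq k \<ii>" and ?j1 = "swap_seq (k + 1) \<ii>"
  have ne: "ent \<ii> k \<noteq> ent \<ii> (k + 1)" "ent \<ii> (k + 1) \<noteq> ent \<ii> (k + 2)"
    "ent \<ii> (k + 1) \<noteq> ent \<ii> k"
    using assms(1,2) by metis+
  have self: "swap_seq (k + 1) ?i1 = ?i1" "swap_seq k ?j1 = ?j1"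
    using assms(1) by (auto intro!: swap_self membership simp del: One_nat_def add_2_eq_Suc')
      (simp_all only: ent_swapped k2)
  have eqs: "T k * E ?i1 = S k * E ?i1" "T (k + 1) * E ?j1 = S (k + 1) * E ?j1"
    "T k * E \<ii> = S k * E \<ii>" "T (k + 1) * E \<ii> = S (k + 1) * E \<ii>"
    by (intro S_eq_T[symmetric] membership; use ne assms(1) in \<open>simp only: ent_swapped k2 not_False_eq_True\<close>)+
  have "S (k + 1) * E ?i1 = T (k + 1) * E ?i1 - d (k + 1) ^ m * E ?i1"
    "S k * E ?j1 = T k * E ?j1 - d k ^ m * E ?j1"
    using m by (intro S_eq_T_diff membership; simp only: ent_swapped k2 assms(1))+
  then have mid: "T (k + 1) * E ?i1 = S (k + 1) * E ?i1 + d (k + 1) ^ m * E ?i1"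
    "T k * E ?j1 = S k * E ?j1 + d k ^ m * E ?j1"
    by simp_all
  have reorder: "t * (b * e * s) = y * (t * s)" if "t * b = y * t" "t * e = t" for t b e s y :: 'a
  proof -
    have "t * (b * e * s) = y * (t * e * s)"
      by (simp only: that(1) mult.assoc[symmetric])
    then show ?thesis by (simp only: that(2))
  qed
  have "(T k * E ?i1) * d (k + 1) ^ m = (X k - X (k + 2)) ^ m * (T k * E ?i1)"
    unfolding d_def using k k' assms(1,2)
    by (subst T_slide_power)
      (auto intro!: slides membership simp: Transposition.transpose_def ent_swapped[simplified])
  then have slide1: "(S k * E ?i1) * (d (k + 1) ^ m * E ?i1 * (S k * E \<ii>)) =
      (X k - X (k + 2)) ^ m * (S k * S k * E \<ii>)"
    unfolding eqs S_stage[OF i k(1) k'(1), of "S k"]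
    by (rule reorder) (simp only: E_idem[OF swapped_Seqs(1)] mult.assoc)
  have "(T (k + 1) * E ?j1) * d k ^ m = (X k - X (k + 2)) ^ m * (T (k + 1) * E ?j1)"
    unfolding d_def using k k' assms(1,2)
    by (subst T_slide_power)
      (auto intro!: slides membership simp: Transposition.transpose_def ent_swapped[simplified])
  then have slide2: "(S (k + 1) * E ?j1) * (d k ^ m * E ?j1 * (S (k + 1) * E \<ii>)) =
      (X k - X (k + 2)) ^ m * (S (k + 1) * S (k + 1) * E \<ii>)"
    unfolding eqs S_stage[OF i k'(2) k(2), of "S (k + 1)"]
    by (rule reorder) (simp only: E_idem[OF swapped_Seqs(2)] mult.assoc)
  show ?thesis
    unfolding T_braid_stage S_braid_stage self eqs mid distrib_left distrib_right slide1 slide2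
    by (simp add: right_diff_distrib)
qed

text \<open>All crossings preserve \<open>\<ii>\<close>, so \<open>braid_identity\<close> applies to
  crossings and shifts cut off by \<open>E \<ii>\<close>. It expands \<open>S\<close> as
  \<open>T\<close> minus its shift; hence the squares that have to be known are those of
  \<open>T\<close>.\<close>

lemma braid_equal_loops:
  assumes "ent \<ii> k = ent \<ii> (k + 1)" "ent \<ii> k = ent \<ii> (k + 2)"
    and m: "num_loops Q (ent \<ii> k) = Suc m"
    and slides: "\<And>\<jj> k. \<jj> \<in> Seqs Q \<nu> \<Longrightarrow> 1 \<le> k \<Longrightarrow> k < n \<Longrightarrow> klr_slides k \<jj>"
    and squares: "T k * T k * E \<ii> = (-1) ^ m * (d k ^ m * d k ^ m) * E \<ii>"
      "T (k + 1) * T (k + 1) * E \<ii> = (-1) ^ m * (d (k + 1) ^ m * d (k + 1) ^ m) * E \<ii>"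
  defines "c \<equiv> X k - X (k + 2)"
  shows "S_braid k \<ii> = T_braid k \<ii>
    + ((-1) ^ m * (d k ^ m * c ^ m) - c ^ m * d (k + 1) ^ m + d k ^ m * d (k + 1) ^ m) * (S k * E \<ii>)
    + (d k ^ m * c ^ m - (-1) ^ m * (c ^ m * d (k + 1) ^ m) - d k ^ m * d (k + 1) ^ m) * (S (k + 1) * E \<ii>)"
proof -
  let ?t = "T k * E \<ii>" and ?u = "T (k + 1) * E \<ii>" and ?e = "(-1) ^ m :: 'a"
  define a b where "a = d k ^ m" and "b = d (k + 1) ^ m"
  let ?A = "a * E \<ii>" and ?B = "b * E \<ii>" and ?C = "c ^ m * E \<ii>"
  have loops: "num_loops Q (ent \<ii> (k + 1)) = Suc m" and eq1: "ent \<ii> (k + 1) = ent \<ii> (k + 1 + 1)"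
    using assms(1,2) m by (simp_all add: k2)
  have self: "swap_seq k \<ii> = \<ii>" "swap_seq (k + 1) \<ii> = \<ii>"
    using swap_self[OF i k(1) k'(1) assms(1)] swap_self[OF i k'(2) k(2) eq1] .
  have S: "S k * E \<ii> = ?t - ?A" "S (k + 1) * E \<ii> = ?u - ?B"
    unfolding a_def b_def
    using S_eq_T_diff[OF i k(1) k'(1) assms(1) m] S_eq_T_diff[OF i k'(2) k(2) eq1 loops] by auto
  have c: "c = d k + d (k + 1)"
    by (simp add: c_def d_def)
  have comm_c: "E \<ii> * c = c * E \<ii>" "d k * c = c * d k" "d (k + 1) * c = c * d (k + 1)"
    unfolding c using d_commute(2)[OF i] d_commute(3) by (simp_all add: distrib_left distrib_right)
  have comm: "E \<ii> * a = a * E \<ii>" "E \<ii> * b = b * E \<ii>" "E \<ii> * c ^ m = c ^ m * E \<ii>"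
    "b * a = a * b" "c ^ m * a = a * c ^ m" "c ^ m * b = b * c ^ m"
    unfolding a_def b_def
    using d_power_commute(2)[OF i] d_power_d_power intertwine_power[OF comm_c(1)]
      intertwine_power[OF intertwine_power[OF comm_c(2), symmetric]]
      intertwine_power[OF intertwine_power[OF comm_c(3), symmetric]] by simp_all
  have t: "E \<ii> * ?t = ?t" "?t * E \<ii> = ?t" "E \<ii> * ?u = ?u" "?u * E \<ii> = ?u"
    using E_T_self[OF i k(1) k'(1) assms(1)] E_T_self[OF i k'(2) k(2) eq1] E_idem[OF i]
    by (simp_all add: mult.assoc flip: mult.assoc[of "E \<ii>"])
  have ta: "?t * a = ?e * (a * ?t)" and ub: "?u * b = ?e * (b * ?u)"
    unfolding a_def b_def using T_d_power[OF i k(1) k'(1) assms(1)] T_d_power[OF i k'(2) k(2) eq1]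
      m loops slides i k k' by auto
  have tb: "?t * b = c ^ m * ?t" and tc: "?t * c ^ m = b * ?t"
    and ua: "?u * a = c ^ m * ?u" and uc: "?u * c ^ m = a * ?u"
    unfolding a_def b_def c_def d_def using k k' m loops
    by (subst T_slide_power; (auto intro!: slides membership simp: Transposition.transpose_def))+
  have rule_E: "t * (x * E \<ii>) = y * E \<ii> * t"
    if "t * x = y * t" "E \<ii> * t = t" "t * E \<ii> = t" for t x y
    by (metis that mult.assoc)
  have e_rule: "?e * (x * y) = ?e * x * y" for x y
    by (simp add: mult.assoc)
  have tA: "?t * ?A = ?e * (?A * ?t)" and uB: "?u * ?B = ?e * (?B * ?u)"
    using rule_E[of ?t a "?e * a"] rule_E[of ?u b "?e * b"] ta ub t by (simp_all add: mult.assoc)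
  have rest: "?t * ?B = ?C * ?t" "?t * ?C = ?B * ?t" "?u * ?A = ?C * ?u" "?u * ?C = ?A * ?u"
    using rule_E tb tc ua uc t by blast+
  have prod: "x * E \<ii> * (y * E \<ii>) = x * y * E \<ii>" if "E \<ii> * y = y * E \<ii>" for x y
    by (metis E_idem[OF i] mult.assoc that)
  have ABC: "?B * ?A = ?A * ?B" "?C * ?A = ?A * ?C" "?C * ?B = ?B * ?C"
    using comm by (simp_all only: prod)
  have sq: "?t * ?t = ?e * (?A * ?A)" "?u * ?u = ?e * (?B * ?B)"
    using squares comm unfolding T_stage[OF i k(1) k'(1)] T_stage[OF i k'(2) k(2)] self
    by (simp_all only: prod) (simp_all add: a_def b_def mult.assoc)
  have e: "?e = 1 \<or> ?e = - 1"
    by (simp add: minus_one_power_iff)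
  have EAB: "E \<ii> * ?A = ?A" "E \<ii> * ?B = ?B"
    using comm(1,2) E_idem[OF i] by (metis mult.assoc)+
  \<comment> \<open>The coefficients in the identity carry an idempotent, which is absorbed by the
    crossing to their right.\<close>
  have drop: "x * E \<ii> * (?t - ?A) = x * (?t - ?A)" "x * E \<ii> * (?u - ?B) = x * (?u - ?B)" for x
    unfolding mult.assoc[of x] right_diff_distrib t EAB by (rule refl)+
  have "S_braid k \<ii> = (?t - ?A) * ((?u - ?B) * (?t - ?A)) - (?u - ?B) * ((?t - ?A) * (?u - ?B))"
    unfolding S_braid_stage self S ..
  also have "\<dots> = ?t * (?u * ?t) - ?u * (?t * ?u) + (?e * (?A * ?C) - ?C * ?B + ?A * ?B) * (?t - ?A)
      + (?A * ?C - ?e * (?C * ?B) - ?A * ?B) * (?u - ?B)"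
    by (rule braid_identity[OF e ABC tA rest(1,2,3) uB rest(4) sq])
  also have "?e * (?A * ?C) - ?C * ?B + ?A * ?B = (?e * (a * c ^ m) - c ^ m * b + a * b) * E \<ii>"
    using comm by (simp add: prod left_diff_distrib distrib_right) (simp add: mult.assoc)
  also have "?A * ?C - ?e * (?C * ?B) - ?A * ?B = (a * c ^ m - ?e * (c ^ m * b) - a * b) * E \<ii>"
    using comm by (simp add: prod left_diff_distrib distrib_right) (simp add: mult.assoc)
  finally show ?thesis
    unfolding drop T_braid_stage self S by (simp only: a_def b_def)
qed

end

end


section \<open>Relations as equations\<close>

text \<open>The shared relations that the twist preserves outright. \<open>far_eqs\<close> is kept
  apart because its comparison uses the slide relations. The idempotents add up to
  \<open>h 1\<close>, as \<open>h\<close> need not be unital.\<close>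

definition base_eqs ::
    "('i, 'h) pre_digraph \<Rightarrow> ('i \<Rightarrow> nat) \<Rightarrow> ('i klr_gen free \<Rightarrow> 'a::ring_1) \<Rightarrow> bool"
  where "base_eqs Q \<nu> h \<longleftrightarrow>
    (\<forall>\<ii>\<in>Seqs Q \<nu>. \<forall>\<jj>\<in>Seqs Q \<nu>. h (idm \<ii>) * h (idm \<jj>) = (if \<ii> = \<jj> then h (idm \<ii>) else 0)) \<and>
    (\<Sum>\<ii>\<in>Seqs Q \<nu>. h (idm \<ii>)) = h 1 \<and>
    (\<forall>\<ii>\<in>Seqs Q \<nu>. \<forall>k\<in>{1..size_of Q \<nu>}.
      h (gen (Dot k \<ii>)) = h (dot Q \<nu> k) * h (idm \<ii>) \<and>
      h (idm \<ii>) * h (dot Q \<nu> k) = h (dot Q \<nu> k) * h (idm \<ii>)) \<and>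
    (\<forall>\<ii>\<in>Seqs Q \<nu>. \<forall>k\<in>{1..<size_of Q \<nu>}.
      h (gen (Cross k \<ii>)) = h (cross Q \<nu> k) * h (idm \<ii>) \<and>
      h (idm (swap_seq k \<ii>)) * h (cross Q \<nu> k) = h (cross Q \<nu> k) * h (idm \<ii>)) \<and>
    (\<forall>k\<in>{1..size_of Q \<nu>}. \<forall>l\<in>{1..size_of Q \<nu>}.
      h (dot Q \<nu> k) * h (dot Q \<nu> l) = h (dot Q \<nu> l) * h (dot Q \<nu> k))"

definition far_eqs ::
    "('i, 'h) pre_digraph \<Rightarrow> ('i \<Rightarrow> nat) \<Rightarrow> ('i klr_gen free \<Rightarrow> 'a::ring_1) \<Rightarrow> bool"
  where "far_eqs Q \<nu> h \<longleftrightarrow>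
    (\<forall>k\<in>{1..<size_of Q \<nu>}. \<forall>l\<in>{1..<size_of Q \<nu>}. k + 1 < l \<or> l + 1 < k \<longrightarrow>
      h (cross Q \<nu> k) * h (cross Q \<nu> l) = h (cross Q \<nu> l) * h (cross Q \<nu> k))"

lemma common_rels_eqs:
  assumes h: "rng_hom h"
  shows "(\<forall>r\<in>common_rels Q \<nu>. h r = 0) \<longleftrightarrow> base_eqs Q \<nu> h \<and> far_eqs Q \<nu> h"
proof (intro iffI ballI)
  note hom = rng_hom_diff[OF h] rng_hom_mult[OF h] rng_hom_sum[OF h]
  assume "\<forall>r\<in>common_rels Q \<nu>. h r = 0"
  then have rel: "h r = 0" if "r \<in> common_rels Q \<nu>" for r
    using that by blast
  have "h (idm \<ii>) * h (idm \<jj>) = (if \<ii> = \<jj> then h (idm \<ii>) else 0)"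
    if "\<ii> \<in> Seqs Q \<nu>" "\<jj> \<in> Seqs Q \<nu>" for \<ii> \<jj>
    using rel[OF common_rels.idem[OF that]] h by (simp add: hom split: if_splits)
  moreover have "h (gen (Dot k \<ii>)) = h (dot Q \<nu> k) * h (idm \<ii>)"
    "h (idm \<ii>) * h (dot Q \<nu> k) = h (dot Q \<nu> k) * h (idm \<ii>)"
    if "\<ii> \<in> Seqs Q \<nu>" "k \<in> {1..size_of Q \<nu>}" for \<ii> k
    using rel[OF common_rels.dot_right, of \<ii> k] rel[OF common_rels.dot_left, of \<ii> k] that
    by (simp_all add: hom)
  moreover have "h (gen (Cross k \<ii>)) = h (cross Q \<nu> k) * h (idm \<ii>)"
    "h (idm (swap_seq k \<ii>)) * h (cross Q \<nu> k) = h (cross Q \<nu> k) * h (idm \<ii>)"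
    if "\<ii> \<in> Seqs Q \<nu>" "k \<in> {1..<size_of Q \<nu>}" for \<ii> k
    using rel[OF common_rels.cross_right, of \<ii> k] rel[OF common_rels.cross_left, of \<ii> k] that
    by (simp_all add: hom)
  ultimately show "base_eqs Q \<nu> h \<and> far_eqs Q \<nu> h"
    using rel[OF common_rels.unit] rel[OF common_rels.dot_dot] rel[OF common_rels.cross_cross]
    by (simp add: base_eqs_def far_eqs_def hom)
next
  note hom = rng_hom_diff[OF h] rng_hom_mult[OF h] rng_hom_sum[OF h]
  fix r
  assume eqs: "base_eqs Q \<nu> h \<and> far_eqs Q \<nu> h" and "r \<in> common_rels Q \<nu>"
  from this(2) show "h r = 0"
    by cases (use eqs h in \<open>auto simp: base_eqs_def far_eqs_def hom\<close>)
qed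

lemma kkp_rels_eqs:
  assumes h: "rng_hom h"
  shows "(\<forall>r\<in>kkp_rels Q \<nu>. h r = 0) \<longleftrightarrow> base_eqs Q \<nu> h \<and> far_eqs Q \<nu> h \<and>
    (\<forall>\<ii>\<in>Seqs Q \<nu>. \<forall>k\<in>{1..<size_of Q \<nu>}.
      h (cross Q \<nu> k) * h (cross Q \<nu> k) * h (idm \<ii>) = h (kkp_square Q \<nu> k \<ii>)) \<and>
    (\<forall>\<ii>\<in>Seqs Q \<nu>. \<forall>k\<in>{1..<size_of Q \<nu>}. \<forall>l\<in>{1..size_of Q \<nu>}.
      (h (dot Q \<nu> (Transposition.transpose k (k + 1) l)) * h (cross Q \<nu> k)
        - h (cross Q \<nu> k) * h (dot Q \<nu> l)) * h (idm \<ii>) = h (kkp_slide Q \<nu> k l \<ii>)) \<and>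
    (\<forall>\<ii>\<in>Seqs Q \<nu>. \<forall>k\<in>{1..<size_of Q \<nu>}. k + 1 < size_of Q \<nu> \<longrightarrow>
      (h (cross Q \<nu> k) * h (cross Q \<nu> (k + 1)) * h (cross Q \<nu> k)
        - h (cross Q \<nu> (k + 1)) * h (cross Q \<nu> k) * h (cross Q \<nu> (k + 1))) * h (idm \<ii>)
      = h (kkp_braid Q \<nu> k \<ii>))" (is "?L \<longleftrightarrow> ?R")
proof
  note hom = rng_hom_diff[OF h] rng_hom_mult[OF h] power2_eq_square
  assume ?L
  then have rel: "h r = 0" if "r \<in> kkp_rels Q \<nu>" for r
    using that by blast
  have "base_eqs Q \<nu> h \<and> far_eqs Q \<nu> h"
    using rel[OF kkp_rels.common] common_rels_eqs[OF h] by blast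
  then show ?R
    using rel[OF kkp_rels.square] rel[OF kkp_rels.slide] rel[OF kkp_rels.braid]
    by (simp add: hom)
next
  note hom = rng_hom_diff[OF h] rng_hom_mult[OF h] power2_eq_square
  assume R: ?R
  show ?L
  proof
    fix r assume "r \<in> kkp_rels Q \<nu>"
    then show "h r = 0"
    proof cases
      case common
      then show ?thesis using R common_rels_eqs[OF h] by blast
    qed (use R in \<open>simp_all add: hom\<close>)
  qed
qed

lemma klr_rels_eqs:
  assumes h: "rng_hom h"
  shows "(\<forall>r\<in>klr_rels Q \<nu>. h r = 0) \<longleftrightarrow> base_eqs Q \<nu> h \<and> far_eqs Q \<nu> h \<and>
    (\<forall>k\<in>{1..<size_of Q \<nu>}. \<forall>l\<in>{1..size_of Q \<nu>}. l \<noteq> k \<longrightarrow> l \<noteq> k + 1 \<longrightarrow>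
      h (cross Q \<nu> k) * h (dot Q \<nu> l) = h (dot Q \<nu> l) * h (cross Q \<nu> k)) \<and>
    (\<forall>\<ii>\<in>Seqs Q \<nu>. \<forall>k\<in>{1..<size_of Q \<nu>}.
      h (cross Q \<nu> k) * h (cross Q \<nu> k) * h (idm \<ii>) =
        h (eval_at Q \<nu> k (klr_square Q (ent \<ii> k) (ent \<ii> (k + 1)))) * h (idm \<ii>)) \<and>
    (\<forall>\<ii>\<in>Seqs Q \<nu>. \<forall>k\<in>{1..<size_of Q \<nu>}.
      (h (dot Q \<nu> k) * h (cross Q \<nu> k) - h (cross Q \<nu> k) * h (dot Q \<nu> (k + 1))) * h (idm \<ii>) =
        (if ent \<ii> k = ent \<ii> (k + 1) \<and> ent \<ii> k \<in> I_plus Q then h (idm \<ii>) else 0) \<and>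
      (h (cross Q \<nu> k) * h (dot Q \<nu> k) - h (dot Q \<nu> (k + 1)) * h (cross Q \<nu> k)) * h (idm \<ii>) =
        (if ent \<ii> k = ent \<ii> (k + 1) \<and> ent \<ii> k \<in> I_plus Q then h (idm \<ii>) else 0)) \<and>
    (\<forall>\<ii>\<in>Seqs Q \<nu>. \<forall>k\<in>{1..<size_of Q \<nu>}. k + 1 < size_of Q \<nu> \<longrightarrow>
      (h (cross Q \<nu> k) * h (cross Q \<nu> (k + 1)) * h (cross Q \<nu> k)
        - h (cross Q \<nu> (k + 1)) * h (cross Q \<nu> k) * h (cross Q \<nu> (k + 1))) * h (idm \<ii>)
      = h (eval_at Q \<nu> k (klr_braid Q (ent \<ii> k) (ent \<ii> (k + 1)) (ent \<ii> (k + 2)))) * h (idm \<ii>))"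
    (is "?L \<longleftrightarrow> ?R")
proof
  have if_h: "h (if P then x else 0) = (if P then h x else 0)" for P x
    using h by simp
  note hom = rng_hom_diff[OF h] rng_hom_mult[OF h] power2_eq_square if_h
  assume ?L
  then have rel: "h r = 0" if "r \<in> klr_rels Q \<nu>" for r
    using that by blast
  have "base_eqs Q \<nu> h \<and> far_eqs Q \<nu> h"
    using rel[OF klr_rels.common] common_rels_eqs[OF h] by blast
  then show ?R
    using rel[OF klr_rels.square] rel[OF klr_rels.cross_dot_far] rel[OF klr_rels.dot_cross]
      rel[OF klr_rels.cross_dot] rel[OF klr_rels.braid]
    by (simp add: hom)
next
  have if_h: "h (if P then x else 0) = (if P then h x else 0)" for P x
    using h by simp
  note hom = rng_hom_diff[OF h] rng_hom_mult[OF h] power2_eq_square if_h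
  assume R: ?R
  show ?L
  proof
    fix r assume "r \<in> klr_rels Q \<nu>"
    then show "h r = 0"
    proof cases
      case common
      then show ?thesis using R common_rels_eqs[OF h] by blast
    qed (use R in \<open>simp_all add: hom\<close>)
  qed
qed


section \<open>Evaluation of polynomials at the dots\<close>

text \<open>Writes the value as three nested evaluations in one variable, so that multiplicativity
  can be obtained one variable at a time.\<close>

lemma eval_at_hom:
  assumes h: "rng_hom h"
  shows "h (eval_at Q \<nu> k p) =
    eval_pol (eval_pol (eval_pol (\<lambda>c. h (cst c)) (h (dot Q \<nu> k))) (h (dot Q \<nu> (k + 1))))
      (h (dot Q \<nu> (k + 2))) p"
  by (simp add: eval_at_def eval_pol_def rng_hom_sum[OF h] rng_hom_mult_power_right[OF h]
      sum_distrib_right)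

text \<open>\<open>h\<close> will be the reduction modulo one of the two ideals, in one case
  preceded by the inverse twist. Dots out of range go to zero, so that evaluation at
  \<open>X k\<close>, \<open>X (k + 1)\<close>, \<open>X (k + 2)\<close> is a homomorphism for every
  \<open>k\<close>.\<close>

locale dot_eval =
  fixes Q :: "('i, 'h) pre_digraph" and \<nu> :: "'i \<Rightarrow> nat" and h :: "'i klr_gen free \<Rightarrow> 'a::ring_1"
  assumes fin: "fin_digraph Q" and hom: "rng_hom h" and base: "base_eqs Q \<nu> h"
    and dots_vanish: "\<And>k \<ii>. Dot k \<ii> \<notin> gens Q \<nu> \<Longrightarrow> h (gen (Dot k \<ii>)) = 0"
begin

abbreviation n where "n \<equiv> size_of Q \<nu>"
abbreviation E where "E \<ii> \<equiv> h (idm \<ii>)"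
abbreviation X where "X k \<equiv> h (dot Q \<nu> k)"

lemma E_mult: "\<ii> \<in> Seqs Q \<nu> \<Longrightarrow> \<jj> \<in> Seqs Q \<nu> \<Longrightarrow> E \<ii> * E \<jj> = (if \<ii> = \<jj> then E \<ii> else 0)"
  using base by (simp add: base_eqs_def)

lemma E_idem: "\<ii> \<in> Seqs Q \<nu> \<Longrightarrow> E \<ii> * E \<ii> = E \<ii>"
  by (simp add: E_mult)

lemma X_outside: "k \<notin> {1..n} \<Longrightarrow> X k = 0"
  by (simp add: dot_def rng_hom_sum[OF hom]) (rule sum.neutral, auto intro!: dots_vanish simp: gens_def)

lemma X_E: "\<ii> \<in> Seqs Q \<nu> \<Longrightarrow> E \<ii> * X k = X k * E \<ii>"
  using base X_outside[of k] by (cases "k \<in> {1..n}") (auto simp: base_eqs_def)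

lemma X_X: "X k * X l = X l * X k"
  using base X_outside[of k] X_outside[of l]
  by (cases "k \<in> {1..n}"; cases "l \<in> {1..n}") (auto simp: base_eqs_def)

lemma gen_Dot: "\<ii> \<in> Seqs Q \<nu> \<Longrightarrow> k \<in> {1..n} \<Longrightarrow> h (gen (Dot k \<ii>)) = X k * E \<ii>"
  using base by (simp add: base_eqs_def)

lemma cst_hom: "h (cst c) * h p = h p * h (cst c)"
  by (metis cst_commute hom rng_hom_mult)

text \<open>Cutting off by the idempotent sends the polynomial \<open>1\<close> to
  \<open>E \<ii>\<close>, the unit of the corner belonging to \<open>\<ii>\<close>.\<close>

definition ev :: "nat \<Rightarrow> 'i list \<Rightarrow> poly3 \<Rightarrow> 'a"
  where "ev k \<ii> p = h (eval_at Q \<nu> k p) * E \<ii>"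

lemma rng_hom_cst: "rng_hom (\<lambda>c. h (cst c))"
  by (simp add: rng_hom_def cst_simps rng_hom_add[OF hom] rng_hom_mult[OF hom])

lemma rng_hom_eval1: "rng_hom (eval_pol (\<lambda>c. h (cst c)) (X k))"
  by (intro rng_hom_eval_pol rng_hom_cst cst_hom)

lemma rng_hom_eval2: "rng_hom (eval_pol (eval_pol (\<lambda>c. h (cst c)) (X k)) (X l))"
  by (intro rng_hom_eval_pol rng_hom_eval1 eval_pol_commute cst_hom X_X)

lemma rng_hom_eval3: "rng_hom (\<lambda>p. h (eval_at Q \<nu> k p))"
  unfolding eval_at_hom[OF hom]
  by (intro rng_hom_eval_pol rng_hom_eval2 eval_pol_commute cst_hom X_X)

lemma eval_at_E: "\<ii> \<in> Seqs Q \<nu> \<Longrightarrow> h (eval_at Q \<nu> k p) * E \<ii> = E \<ii> * h (eval_at Q \<nu> k p)"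
  unfolding eval_at_hom[OF hom]
  by (intro eval_pol_commute cst_hom X_E[symmetric])

lemma rng_hom_ev:
  assumes i: "\<ii> \<in> Seqs Q \<nu>"
  shows "rng_hom (ev k \<ii>)"
proof (rule rng_homI)
  show "ev k \<ii> (p + q) = ev k \<ii> p + ev k \<ii> q" for p q
    by (simp add: ev_def rng_hom_add[OF rng_hom_eval3] distrib_right)
  fix p q
  have "ev k \<ii> p * ev k \<ii> q = h (eval_at Q \<nu> k p) * (E \<ii> * h (eval_at Q \<nu> k q)) * E \<ii>"
    by (simp only: ev_def mult.assoc)
  also have "\<dots> = h (eval_at Q \<nu> k p) * (h (eval_at Q \<nu> k q) * E \<ii>) * E \<ii>"
    by (simp only: eval_at_E[OF i])
  also have "\<dots> = ev k \<ii> (p * q)"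
    by (simp only: ev_def rng_hom_mult[OF rng_hom_eval3] mult.assoc E_idem[OF i])
  finally show "ev k \<ii> (p * q) = ev k \<ii> p * ev k \<ii> q" ..
qed

lemma one_mult_h: "h 1 * h p = h p"
  by (metis hom mult_1_left rng_hom_mult)

lemma ev_vars:
  assumes i: "\<ii> \<in> Seqs Q \<nu>"
  shows "ev k \<ii> 1 = E \<ii>" "ev k \<ii> var_u = X k * E \<ii>" "ev k \<ii> var_v = X (k + 1) * E \<ii>"
    "ev k \<ii> var_w = X (k + 2) * E \<ii>"
  unfolding ev_def eval_at_hom[OF hom] var_u_def var_v_def var_w_def one_pCons
  by (simp_all add: eval_pol_pCons[OF rng_hom_cst] eval_pol_pCons[OF rng_hom_eval1]
      eval_pol_pCons[OF rng_hom_eval2] eval_pol_const rng_hom_zero[OF rng_hom_cst]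
      rng_hom_zero[OF rng_hom_eval1] rng_hom_zero[OF rng_hom_eval2] one_pCons cst_simps one_mult_h
      rng_hom_zero[OF hom] eval_pol_def[where p = 0] one_mult_h[THEN arg_cong[of _ _ "\<lambda>y. y * _"], unfolded mult.assoc])

lemma ev_power:
  assumes i: "\<ii> \<in> Seqs Q \<nu>" and p: "ev k \<ii> p = z * E \<ii>" and z: "E \<ii> * z = z * E \<ii>"
  shows "ev k \<ii> (p ^ m) = z ^ m * E \<ii>"
proof (induction m)
  case 0
  then show ?case by (simp add: ev_vars[OF i])
next
  case (Suc m)
  have "ev k \<ii> (p ^ Suc m) = z * (E \<ii> * z ^ m) * E \<ii>"
    by (simp add: rng_hom_mult[OF rng_hom_ev[OF i]] p Suc mult.assoc)
  also have "\<dots> = z ^ Suc m * E \<ii>"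
    by (simp only: intertwine_power[OF z] mult.assoc E_idem[OF i] power_Suc)
  finally show ?case .
qed

text \<open>The value of \<open>ev\<close> at \<open>- 1\<close> is \<open>- E \<ii>\<close> and not
  \<open>- 1\<close>; signs are therefore extracted by parity.\<close>

lemma ev_sign:
  assumes "\<ii> \<in> Seqs Q \<nu>"
  shows "ev k \<ii> ((-1) ^ m * p) = (-1) ^ m * ev k \<ii> p"
  by (cases "even m") (simp_all add: rng_hom_uminus[OF rng_hom_ev[OF assms]])

lemma ev_mult:
  assumes i: "\<ii> \<in> Seqs Q \<nu>" and p: "ev k \<ii> p = y * E \<ii>" and q: "ev k \<ii> q = z * E \<ii>"
    and z: "E \<ii> * z = z * E \<ii>"
  shows "ev k \<ii> (p * q) = y * z * E \<ii>"
proof -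
  have "ev k \<ii> (p * q) = y * (E \<ii> * z) * E \<ii>"
    by (simp add: rng_hom_mult[OF rng_hom_ev[OF i]] p q mult.assoc)
  then show ?thesis
    by (simp only: z mult.assoc E_idem[OF i])
qed

lemma X_diff_E: "\<ii> \<in> Seqs Q \<nu> \<Longrightarrow> E \<ii> * (X k - X l) = (X k - X l) * E \<ii>"
  by (simp add: algebra_simps X_E)

lemma ev_var_diffs:
  assumes i: "\<ii> \<in> Seqs Q \<nu>"
  shows "ev k \<ii> ((var_u - var_v) ^ m) = (X k - X (k + 1)) ^ m * E \<ii>"
    "ev k \<ii> ((var_u - var_w) ^ m) = (X k - X (k + 2)) ^ m * E \<ii>"
    "ev k \<ii> ((var_v - var_w) ^ m) = (X (k + 1) - X (k + 2)) ^ m * E \<ii>"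
    "ev k \<ii> ((var_w - var_v) ^ m) = (X (k + 2) - X (k + 1)) ^ m * E \<ii>"
  by (intro ev_power i X_diff_E; simp add: rng_hom_diff[OF rng_hom_ev[OF i]] ev_vars[OF i] left_diff_distrib)+

lemma X_diff_power_E: "\<ii> \<in> Seqs Q \<nu> \<Longrightarrow> E \<ii> * (X k - X l) ^ m = (X k - X l) ^ m * E \<ii>"
  by (intro intertwine_power X_diff_E)

lemma const3_minus_one_power: "const3 ((-1) ^ m) = (-1) ^ m"
proof -
  have "const3 (- 1) = - 1" "const3 1 = 1"
    by (simp_all add: const3_def one_pCons)
  then show ?thesis
    by (cases "even m") simp_all
qed

lemma ev_Q_pol:
  assumes i: "\<ii> \<in> Seqs Q \<nu>"
  shows "ev k \<ii> (Q_pol Q a b var_u var_v) =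
      (-1) ^ num_arrows Q a b * ((X k - X (k + 1)) ^ nat (- cartan Q a b) * E \<ii>)"
    "ev k \<ii> (Q_pol Q a b var_w var_v) =
      (-1) ^ num_arrows Q a b * ((X (k + 2) - X (k + 1)) ^ nat (- cartan Q a b) * E \<ii>)"
  by (simp_all only: Q_pol_def const3_minus_one_power ev_sign[OF i] ev_var_diffs[OF i])

text \<open>Of the \<open>m + 1\<close> factors in P(u,w), one cancels the denominator of
  \<open>Q_quot\<close>; the others give the power of \<open>X k - X (k + 2)\<close> in
  \<open>tw.braid_middle_loops\<close>.\<close>

lemma ev_P_mult_Q_quot:
  assumes i: "\<ii> \<in> Seqs Q \<nu>"
  shows "num_loops Q a = 0 \<Longrightarrow> ev k \<ii> (P_pol Q a var_u var_w * Q_quot Q a b) = ev k \<ii> (Q_quot Q a b)"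
    "num_loops Q a = Suc m \<Longrightarrow> ev k \<ii> (P_pol Q a var_u var_w * Q_quot Q a b) =
      (X k - X (k + 2)) ^ m * (ev k \<ii> (Q_pol Q a b var_u var_v) - ev k \<ii> (Q_pol Q a b var_w var_v))"
proof -
  show "num_loops Q a = 0 \<Longrightarrow> ev k \<ii> (P_pol Q a var_u var_w * Q_quot Q a b) = ev k \<ii> (Q_quot Q a b)"
    by (simp add: P_pol_def)
  assume m: "num_loops Q a = Suc m"
  have "P_pol Q a var_u var_w * Q_quot Q a b = (var_u - var_w) ^ m * (Q_quot Q a b * (var_u - var_w))"
    by (simp add: P_pol_def m mult_ac)
  also have "ev k \<ii> \<dots> = (X k - X (k + 2)) ^ m * (E \<ii> * ev k \<ii> (Q_quot Q a b * (var_u - var_w)))"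
    unfolding rng_hom_mult[OF rng_hom_ev[OF i], of k "(var_u - var_w) ^ m"] ev_var_diffs[OF i]
    by (simp only: mult.assoc)
  also have "E \<ii> * ev k \<ii> p = ev k \<ii> p" for p
    by (metis ev_def eval_at_E[OF i] E_idem[OF i] mult.assoc)
  finally show "ev k \<ii> (P_pol Q a var_u var_w * Q_quot Q a b) =
      (X k - X (k + 2)) ^ m * (ev k \<ii> (Q_pol Q a b var_u var_v) - ev k \<ii> (Q_pol Q a b var_w var_v))"
    by (simp only: Q_quot_mult rng_hom_diff[OF rng_hom_ev[OF i]])
qed

lemma eval_at_mult_ev:
  assumes "\<ii> \<in> Seqs Q \<nu>" "E \<ii> * y = y"
  shows "h (eval_at Q \<nu> k p) * y = ev k \<ii> p * y"
  by (simp add: ev_def assms(2) mult.assoc)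

end


section \<open>The twist of the free algebra\<close>

text \<open>For \<open>e = 1\<close> the images of the \<open>\<tau>\<^sub>k\<^sub>,\<^sub>\<ii>\<close>, and for \<open>e = -1\<close> the inverse substitution.\<close>

primrec twist ::
    "('i, 'h) pre_digraph \<Rightarrow> 'i klr_gen free \<Rightarrow> 'i klr_gen \<Rightarrow> 'i klr_gen free"
  where
    "twist Q e (Idemp \<ii>) = idm \<ii>"
  | "twist Q e (Dot k \<ii>) = gen (Dot k \<ii>)"
  | "twist Q e (Cross k \<ii>) =
      (if ent \<ii> k = ent \<ii> (k + 1)
       then if num_loops Q (ent \<ii> k) = 0 then - gen (Cross k \<ii>)
            else gen (Cross k \<ii>) +
              e * ((gen (Dot k \<ii>) - gen (Dot (k + 1) \<ii>)) ^ (num_loops Q (ent \<ii> k) - 1) * idm \<ii>)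
       else gen (Cross k \<ii>))"

lemma twist_inverse: "subst (twist Q 1) (twist Q (- 1) g) = gen g" "subst (twist Q (- 1)) (twist Q 1 g) = gen g"
  by (cases g; simp add: subst_simps)+

lemma subst_twist_dot: "subst (twist Q e) (dot Q \<nu> k) = dot Q \<nu> k"
  by (simp add: dot_def subst_simps)

lemma subst_twist_eval_at: "subst (twist Q e) (eval_at Q \<nu> k p) = eval_at Q \<nu> k p"
  by (simp add: eval_at_def subst_simps subst_twist_dot)

lemma mem_I_plus_iff: "i \<in> I_plus Q \<longleftrightarrow> i \<in> verts Q \<and> num_loops Q i = 0"
  by (auto simp: I_plus_def cartan_def)

lemma mem_I_le0_iff: "i \<in> I_le0 Q \<longleftrightarrow> i \<in> verts Q \<and> num_loops Q i \<noteq> 0"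
  by (auto simp: I_le0_def cartan_def)

lemma ent_verts:
  assumes "fin_digraph Q" "\<ii> \<in> Seqs Q \<nu>" "1 \<le> k" "k \<le> size_of Q \<nu>"
  shows "ent \<ii> k \<in> verts Q"
proof -
  have "ent \<ii> k \<in> set \<ii>"
    using assms length_Seqs[OF assms(1,2)] by (auto simp: ent_def)
  then show ?thesis
    using assms(2) by (auto simp: Seqs_def)
qed

text \<open>The twist contains powers of the dots of one sequence, the relations contain powers of
  the summed dots. They agree after multiplication by the idempotent, which also covers the zeroth
  power.\<close>

lemma mult_idem_power:
  fixes x e :: "'a::monoid_mult"
  assumes "e * x = x * e" "e * e = e"
  shows "(x * e) ^ m * e = x ^ m * e"
proof (induction m)
  case (Suc m)
  have "(x * e) ^ Suc m * e = x * (e * ((x * e) ^ m * e))"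
    by (simp add: mult.assoc)
  also have "\<dots> = x * (e * x ^ m) * e"
    by (simp add: Suc mult.assoc)
  also have "\<dots> = x ^ Suc m * e"
    by (simp add: intertwine_power[OF assms(1)] mult.assoc assms(2))
  finally show ?case .
qed simp

text \<open>The integer exponent is \<open>- int m\<close>, and opposite powers of
  \<open>- 1\<close> coincide.\<close>

lemma cross_square_sign: "(- 1 :: complex) powi (cartan Q i i div 2) = (- 1) ^ m"
  and cross_square_exponent: "nat (- cartan Q i i) = m + m"
  if "num_loops Q i = Suc m"
proof -
  have "cartan Q i i = 2 * - int m"
    using that by (simp add: cartan_def)
  then have "cartan Q i i div 2 = - int m" by simp
  then show "(- 1 :: complex) powi (cartan Q i i div 2) = (- 1) ^ m"
    by (simp add: power_int_minus power_inverse[symmetric])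
  show "nat (- cartan Q i i) = m + m"
    using that by (simp add: cartan_def)
qed

section \<open>Images of the crossings under the twist\<close>

context dot_eval
begin

lemma h_twist_Cross:
  assumes "\<ii> \<in> Seqs Q \<nu>" "1 \<le> k" "k < n" "e = 1 \<or> e = - 1"
  shows "h (twist Q e (Cross k \<ii>)) =
      (if ent \<ii> k = ent \<ii> (k + 1)
       then if num_loops Q (ent \<ii> k) = 0 then - (h (cross Q \<nu> k) * E \<ii>)
            else h (cross Q \<nu> k) * E \<ii> +
              (if e = 1 then 1 else - 1) * ((X k - X (k + 1)) ^ (num_loops Q (ent \<ii> k) - 1) * E \<ii>)
       else h (cross Q \<nu> k) * E \<ii>)"
proof -
  have cross: "h (gen (Cross k \<ii>)) = h (cross Q \<nu> k) * E \<ii>"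
    using base assms by (simp add: base_eqs_def)
  have "h ((gen (Dot k \<ii>) - gen (Dot (k + 1) \<ii>)) ^ m * idm \<ii>) = (X k - X (k + 1)) ^ m * E \<ii>" for m
    using assms mult_idem_power[OF X_diff_E[OF assms(1)] E_idem[OF assms(1)], of k "k + 1" m]
    by (simp add: rng_hom_mult_power_left[OF hom] rng_hom_diff[OF hom] gen_Dot left_diff_distrib)
  then show ?thesis
    using assms(4) cross
    by (auto simp: rng_hom_add[OF hom] rng_hom_uminus[OF hom] rng_hom_diff[OF hom])
qed

lemma swap_Seqs: "\<ii> \<in> Seqs Q \<nu> \<Longrightarrow> 1 \<le> k \<Longrightarrow> k < n \<Longrightarrow> swap_seq k \<ii> \<in> Seqs Q \<nu>"
  using swap_seq_Seqs[of k \<ii>] length_Seqs[OF fin, of \<ii>] by simp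

lemma h_twist_Cross_E:
  assumes i: "\<ii> \<in> Seqs Q \<nu>" and k: "1 \<le> k" "k < n" and e: "e = 1 \<or> e = - 1"
  shows "h (twist Q e (Cross k \<ii>)) * E \<ii> = h (twist Q e (Cross k \<ii>))"
    "E (swap_seq k \<ii>) * h (twist Q e (Cross k \<ii>)) = h (twist Q e (Cross k \<ii>))"
proof -
  let ?S = "h (cross Q \<nu> k)"
  have S: "E (swap_seq k \<ii>) * (?S * E \<ii>) = ?S * E \<ii>"
    using base i k E_idem[OF i] by (simp add: base_eqs_def flip: mult.assoc) (simp add: mult.assoc)
  show "h (twist Q e (Cross k \<ii>)) * E \<ii> = h (twist Q e (Cross k \<ii>))"
    unfolding h_twist_Cross[OF assms] by (simp add: distrib_right mult.assoc E_idem[OF i])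
  show "E (swap_seq k \<ii>) * h (twist Q e (Cross k \<ii>)) = h (twist Q e (Cross k \<ii>))"
  proof (cases "ent \<ii> k = ent \<ii> (k + 1)")
    case False
    then show ?thesis
      unfolding h_twist_Cross[OF assms] using S by simp
  next
    case True
    have "swap_seq k \<ii> = \<ii>"
      using swap_seq_eq_self[of k \<ii>] length_Seqs[OF fin i] k True by simp
    moreover have "E \<ii> * ((X k - X (k + 1)) ^ m * E \<ii>) = (X k - X (k + 1)) ^ m * E \<ii>" for m
      by (metis X_diff_power_E[OF i] E_idem[OF i] mult.assoc)
    ultimately show ?thesis
      unfolding h_twist_Cross[OF assms] using S by (simp add: distrib_left)
  qed
qed

text \<open>By orthogonality an idempotent on the right picks out one summand. On the left it does
  so because exchanging two entries is injective on sequences.\<close>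

lemma h_twist_cross:
  assumes i: "\<ii> \<in> Seqs Q \<nu>" and k: "1 \<le> k" "k < n" and e: "e = 1 \<or> e = - 1"
  shows "h (subst (twist Q e) (cross Q \<nu> k)) * E \<ii> = h (twist Q e (Cross k \<ii>))"
    "E (swap_seq k \<ii>) * h (subst (twist Q e) (cross Q \<nu> k)) = h (twist Q e (Cross k \<ii>))"
proof -
  let ?t = "\<lambda>\<jj>. h (twist Q e (Cross k \<jj>))"
  have sum: "h (subst (twist Q e) (cross Q \<nu> k)) = (\<Sum>\<jj>\<in>Seqs Q \<nu>. ?t \<jj>)"
    by (simp add: cross_def subst_sum rng_hom_sum[OF hom] del: twist.simps)
  have "?t \<jj> * E \<ii> = (if \<jj> = \<ii> then ?t \<ii> else 0)" if "\<jj> \<in> Seqs Q \<nu>" for \<jj>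
    using h_twist_Cross_E(1)[OF i k e] h_twist_Cross_E(1)[OF that k e] E_mult[OF that i]
    by (metis mult.assoc mult_zero_right)
  then show "h (subst (twist Q e) (cross Q \<nu> k)) * E \<ii> = ?t \<ii>"
    using i finite_Seqs[OF fin] by (simp add: sum sum_distrib_right sum.delta del: twist.simps)
  have inj: "swap_seq k \<ii> = swap_seq k \<jj> \<longleftrightarrow> \<ii> = \<jj>" if "\<jj> \<in> Seqs Q \<nu>" for \<jj>
    using swap_seq_swap_seq[OF k(1)] length_Seqs[OF fin] i k(2) that by metis
  have "E (swap_seq k \<ii>) * ?t \<jj> = (if \<jj> = \<ii> then ?t \<ii> else 0)" if j: "\<jj> \<in> Seqs Q \<nu>" for \<jj>
  proof -
    have "E (swap_seq k \<ii>) * ?t \<jj> = (E (swap_seq k \<ii>) * E (swap_seq k \<jj>)) * ?t \<jj>"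
      by (simp only: mult.assoc h_twist_Cross_E(2)[OF j k e])
    then show ?thesis
      using inj[OF j] h_twist_Cross_E(2)[OF i k e]
      by (simp add: E_mult[OF swap_Seqs[OF i k] swap_Seqs[OF j k]] E_idem[OF swap_Seqs[OF i k]] del: twist.simps split: if_splits)
  qed
  then show "E (swap_seq k \<ii>) * h (subst (twist Q e) (cross Q \<nu> k)) = ?t \<ii>"
    using i finite_Seqs[OF fin] by (simp add: sum sum_distrib_left sum.delta del: twist.simps)
qed

lemma base_eqs_twist:
  assumes e: "e = 1 \<or> e = - 1"
  shows "base_eqs Q \<nu> (\<lambda>p. h (subst (twist Q e) p))"
  using base unfolding base_eqs_def
  by (simp add: subst_twist_dot h_twist_cross[OF _ _ _ e] del: twist.simps(3))

lemma twisted_crossings: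
  "twisted_crossings Q \<nu> E X (\<lambda>k. h (cross Q \<nu> k)) (\<lambda>k. h (subst (twist Q 1) (cross Q \<nu> k)))"
proof -
  interpret D: fin_digraph Q by (rule fin)
  show ?thesis
  proof (rule twisted_crossings.intro)
    fix \<ii> k assume k: "1 \<le> k" "k < n"
    have "h (cross Q \<nu> k) = (\<Sum>\<ii>\<in>Seqs Q \<nu>. h (gen (Cross k \<ii>)))"
      by (simp add: cross_def rng_hom_sum[OF hom])
    then show "h (cross Q \<nu> k) = (\<Sum>\<ii>\<in>Seqs Q \<nu>. h (cross Q \<nu> k) * E \<ii>)"
      using base k by (simp add: base_eqs_def)
    have "h (subst (twist Q 1) (cross Q \<nu> k)) = (\<Sum>\<ii>\<in>Seqs Q \<nu>. h (twist Q 1 (Cross k \<ii>)))"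
      by (simp add: cross_def subst_sum rng_hom_sum[OF hom] del: twist.simps)
    also have "\<dots> = (\<Sum>\<ii>\<in>Seqs Q \<nu>. h (subst (twist Q 1) (cross Q \<nu> k)) * E \<ii>)"
      using k by (intro sum.cong refl h_twist_cross(1)[symmetric]) auto
    finally show "h (subst (twist Q 1) (cross Q \<nu> k)) =
        (\<Sum>\<ii>\<in>Seqs Q \<nu>. h (subst (twist Q 1) (cross Q \<nu> k)) * E \<ii>)" .
    assume i: "\<ii> \<in> Seqs Q \<nu>"
    show "h (cross Q \<nu> k) * E \<ii> = E (swap_seq k \<ii>) * h (cross Q \<nu> k)"
      using base i k by (simp add: base_eqs_def)
    show "h (subst (twist Q 1) (cross Q \<nu> k)) * E \<ii> =
        E (swap_seq k \<ii>) * h (subst (twist Q 1) (cross Q \<nu> k))"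
      using h_twist_cross[OF i k] by metis
    show "h (subst (twist Q 1) (cross Q \<nu> k)) * E \<ii> =
          (if ent \<ii> k = ent \<ii> (k + 1)
           then if num_loops Q (ent \<ii> k) = 0 then - (h (cross Q \<nu> k) * E \<ii>)
                else h (cross Q \<nu> k) * E \<ii> + (X k - X (k + 1)) ^ (num_loops Q (ent \<ii> k) - 1) * E \<ii>
           else h (cross Q \<nu> k) * E \<ii>)"
      unfolding h_twist_cross(1)[OF i k disjI1[OF refl]] h_twist_Cross[OF i k disjI1[OF refl]] by simp
  qed (simp_all add: fin E_mult X_E X_X)
qed

end

sublocale dot_eval \<subseteq> tw: twisted_crossings Q \<nu> "\<lambda>\<ii>. h (idm \<ii>)" "\<lambda>k. h (dot Q \<nu> k)"
  "\<lambda>k. h (cross Q \<nu> k)" "\<lambda>k. h (subst (twist Q 1) (cross Q \<nu> k))"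
  by (rule twisted_crossings)

section \<open>Equivalence of the two sets of relations, one type after the other\<close>

context dot_eval
begin

abbreviation S where "S k \<equiv> h (cross Q \<nu> k)"
abbreviation T where "T k \<equiv> h (subst (twist Q 1) (cross Q \<nu> k))"

lemma h_kkp_slide:
  assumes i: "\<ii> \<in> Seqs Q \<nu>"
  shows "h (kkp_slide Q \<nu> k l \<ii>) = tw.kkp_slide_val k l \<ii>"
proof -
  have "h (eval_at Q \<nu> k (P_pol Q (ent \<ii> k) var_u var_v) * idm \<ii>) =
      tw.d k ^ num_loops Q (ent \<ii> k) * E \<ii>"
    using ev_var_diffs(1)[OF i] by (simp add: rng_hom_mult[OF hom] ev_def P_pol_def tw.d_def)
  then show ?thesis
    by (cases "ent \<ii> k = ent \<ii> (k + 1)")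
      (simp_all add: kkp_slide_def tw.kkp_slide_val_def Let_def rng_hom_uminus[OF hom] rng_hom_zero[OF hom])
qed

lemma kkp_slides_eq:
  "(\<forall>\<ii>\<in>Seqs Q \<nu>. \<forall>k\<in>{1..<n}. \<forall>l\<in>{1..n}.
      (X (Transposition.transpose k (k + 1) l) * S k - S k * X l) * E \<ii> = h (kkp_slide Q \<nu> k l \<ii>)) \<longleftrightarrow>
    (\<forall>\<ii>\<in>Seqs Q \<nu>. \<forall>k\<in>{1..<n}. tw.kkp_slides k \<ii>)"
  by (simp add: tw.kkp_slides_def h_kkp_slide)

text \<open>The slides of distant dots are imposed globally, the others sequence by sequence;
  \<open>tw.T_X_global\<close> bridges the difference.\<close>

lemma klr_slides_eq:
  "(\<forall>k\<in>{1..<n}. \<forall>l\<in>{1..n}. l \<noteq> k \<longrightarrow> l \<noteq> k + 1 \<longrightarrow> T k * X l = X l * T k) \<and>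
    (\<forall>\<ii>\<in>Seqs Q \<nu>. \<forall>k\<in>{1..<n}.
      (X k * T k - T k * X (k + 1)) * E \<ii> =
        (if ent \<ii> k = ent \<ii> (k + 1) \<and> ent \<ii> k \<in> I_plus Q then E \<ii> else 0) \<and>
      (T k * X k - X (k + 1) * T k) * E \<ii> =
        (if ent \<ii> k = ent \<ii> (k + 1) \<and> ent \<ii> k \<in> I_plus Q then E \<ii> else 0)) \<longleftrightarrow>
    (\<forall>\<ii>\<in>Seqs Q \<nu>. \<forall>k\<in>{1..<n}. tw.klr_slides k \<ii>)" (is "?far \<and> ?near \<longleftrightarrow> ?slides")
proof -
  have val: "tw.klr_slide_val k \<ii> =
      (if ent \<ii> k = ent \<ii> (k + 1) \<and> ent \<ii> k \<in> I_plus Q then E \<ii> else 0)"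
    if "\<ii> \<in> Seqs Q \<nu>" "k \<in> {1..<n}" for \<ii> k
    using ent_verts[OF fin that(1), of k] that(2) by (simp add: tw.klr_slide_val_def mem_I_plus_iff)
  show ?thesis
  proof
    assume far_near: "?far \<and> ?near"
    show ?slides
    proof (intro ballI)
      fix \<ii> k assume i: "\<ii> \<in> Seqs Q \<nu>" and k: "k \<in> {1..<n}"
      have "(T k * X l - X l * T k) * E \<ii> = 0" if "l \<in> {1..n}" "l \<noteq> k" "l \<noteq> k + 1" for l
      proof -
        have "T k * X l = X l * T k" using far_near k that by blast
        then show ?thesis by simp
      qed
      then show "tw.klr_slides k \<ii>"
        using far_near i k unfolding tw.klr_slides_def val[OF i k] by blast
    qed
  next
    assume slides: ?slides
    have ?far
    proof (intro ballI impI)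
      fix k l assume k: "k \<in> {1..<n}" and l: "l \<in> {1..n}" "l \<noteq> k" "l \<noteq> k + 1"
      show "T k * X l = X l * T k"
        using slides k l by (intro tw.T_X_global) (auto simp: tw.klr_slides_def)
    qed
    moreover have ?near
      using slides val unfolding tw.klr_slides_def by (metis (no_types, lifting))
    ultimately show "?far \<and> ?near" ..
  qed
qed

lemma slides_iff:
  "(\<forall>\<ii>\<in>Seqs Q \<nu>. \<forall>k\<in>{1..<n}. tw.kkp_slides k \<ii>) \<longleftrightarrow> (\<forall>\<ii>\<in>Seqs Q \<nu>. \<forall>k\<in>{1..<n}. tw.klr_slides k \<ii>)"
  using tw.kkp_slides_iff by simp

lemma far_iff:
  assumes "\<forall>\<ii>\<in>Seqs Q \<nu>. \<forall>k\<in>{1..<n}. tw.kkp_slides k \<ii>"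
  shows "far_eqs Q \<nu> h \<longleftrightarrow> far_eqs Q \<nu> (\<lambda>p. h (subst (twist Q 1) p))"
proof -
  have "S k * S l = S l * S k \<longleftrightarrow> T k * T l = T l * T k"
    if kl: "1 \<le> k" "k < n" "1 \<le> l" "l < n" "k + 1 < l \<or> l + 1 < k" for k l
  proof -
    have "(T k * T l - T l * T k) * E \<ii> = 0 \<longleftrightarrow> (S k * S l - S l * S k) * E \<ii> = 0"
      if "\<ii> \<in> Seqs Q \<nu>" for \<ii>
      using tw.far_crossings[OF that kl] assms by (auto simp: tw.sgn_tw_def)
    then show ?thesis
      using tw.S_S_global[OF kl(1-4)] tw.T_T_global[OF kl(1-4)] by (metis diff_self mult_zero_left)
  qed
  then show ?thesis
    unfolding far_eqs_def by simp
qed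

lemma E_S: "\<ii> \<in> Seqs Q \<nu> \<Longrightarrow> 1 \<le> k \<Longrightarrow> k < n \<Longrightarrow> ent \<ii> k = ent \<ii> (k + 1) \<Longrightarrow> E \<ii> * (S k * E \<ii>) = S k * E \<ii>"
  using tw.S_stage[of \<ii> k 1] tw.swap_self[of \<ii> k] by simp

lemma gen_Cross: "\<ii> \<in> Seqs Q \<nu> \<Longrightarrow> 1 \<le> k \<Longrightarrow> k < n \<Longrightarrow> h (gen (Cross k \<ii>)) = S k * E \<ii>"
  using base by (simp add: base_eqs_def)

lemma ev_klr_square_loops:
  assumes i: "\<ii> \<in> Seqs Q \<nu>" and "ent \<ii> k = ent \<ii> (k + 1)" and Suc: "num_loops Q (ent \<ii> k) = Suc m"
  shows "h (eval_at Q \<nu> k (klr_square Q (ent \<ii> k) (ent \<ii> (k + 1)))) * E \<ii> =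
    (-1) ^ m * (tw.d k ^ m * tw.d k ^ m) * E \<ii>"
proof -
  have "klr_square Q (ent \<ii> k) (ent \<ii> (k + 1)) = (-1) ^ m * (var_u - var_v) ^ (m + m)"
    using assms(2,3) cross_square_sign[OF Suc] cross_square_exponent[OF Suc]
    by (simp add: klr_square_def mem_I_plus_iff const3_minus_one_power)
  then show ?thesis
    using ev_sign[OF i, of k m "(var_u - var_v) ^ (m + m)"] ev_var_diffs(1)[OF i, of k "m + m"]
    by (simp add: tw.d_def power_add mult.assoc flip: ev_def)
qed

text \<open>With \<open>m + 1\<close> loops the right-hand side for \<open>S\<close> is minus
  \<open>(1 + (-1) ^ m)\<close> times the \<open>m\<close>-th power of \<open>tw.d k\<close> times
  the crossing. Moved to the left, it completes the left-hand side of
  \<open>tw.square_loops\<close>.\<close>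

lemma square_iff:
  assumes i: "\<ii> \<in> Seqs Q \<nu>" and k: "1 \<le> k" "k < n" and slides: "tw.klr_slides k \<ii>"
  shows "S k * S k * E \<ii> = h (kkp_square Q \<nu> k \<ii>) \<longleftrightarrow>
    T k * T k * E \<ii> = h (eval_at Q \<nu> k (klr_square Q (ent \<ii> k) (ent \<ii> (k + 1)))) * E \<ii>"
proof (cases "ent \<ii> k = ent \<ii> (k + 1)")
  case False
  then show ?thesis
    using tw.square_unequal[OF i k False]
    by (simp add: kkp_square_def klr_square_def rng_hom_mult[OF hom])
next
  case True
  have verts: "ent \<ii> k \<in> verts Q"
    using ent_verts[OF fin i, of k] k by simp
  have kkp: "h (kkp_square Q \<nu> k \<ii>) = - (ev k \<ii> (dP_pol Q (ent \<ii> k)) * (S k * E \<ii>))"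
    using True by (simp add: kkp_square_def Let_def rng_hom_uminus[OF hom] rng_hom_mult[OF hom]
        gen_Cross[OF i k] eval_at_mult_ev[OF i E_S[OF i k True]])
  show ?thesis
  proof (cases "num_loops Q (ent \<ii> k)")
    case 0
    have "klr_square Q (ent \<ii> k) (ent \<ii> (k + 1)) = 0"
      using True 0 verts by (simp add: klr_square_def mem_I_plus_iff)
    then show ?thesis
      unfolding kkp using tw.square_no_loops[OF i k True 0]
      by (simp add: dP_pol_0[OF 0] rng_hom_zero[OF rng_hom_ev[OF i]] rng_hom_zero[OF rng_hom_eval3])
  next
    case (Suc m)
    have dP: "ev k \<ii> (dP_pol Q (ent \<ii> k)) = (1 + (-1) ^ m) * (tw.d k ^ m * E \<ii>)"
      using ev_sign[OF i, of k m "(var_u - var_v) ^ m"] ev_var_diffs(1)[OF i, of k m]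
      by (simp add: dP_pol_Suc[OF Suc] distrib_right rng_hom_add[OF rng_hom_ev[OF i]] tw.d_def)
    note ev_klr_square_loops[OF i True Suc]
    moreover have "ev k \<ii> (dP_pol Q (ent \<ii> k)) * (S k * E \<ii>) = (1 + (-1) ^ m) * (tw.d k ^ m * (S k * E \<ii>))"
      unfolding dP by (simp only: mult.assoc E_S[OF i k True])
    ultimately show ?thesis
      using tw.square_loops[OF i k True Suc slides] unfolding kkp
      by (metis (no_types, lifting) add.commute add_cancel_right_left diff_0 diff_add_cancel
          eq_neg_iff_add_eq_0 right_minus_eq)
  qed
qed

lemma ev_P3:
  fixes k :: nat
  assumes i: "\<ii> \<in> Seqs Q \<nu>" and m: "num_loops Q j = Suc m"
  defines "c \<equiv> X k - X (k + 2)"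
  shows "ev k \<ii> (P3_pol Q j) =
      ((-1) ^ m * (tw.d k ^ m * c ^ m) - c ^ m * tw.d (k + 1) ^ m + tw.d k ^ m * tw.d (k + 1) ^ m) * E \<ii>"
    and "ev k \<ii> (P3'_pol Q j) =
      (tw.d k ^ m * c ^ m - (-1) ^ m * (c ^ m * tw.d (k + 1) ^ m) - tw.d k ^ m * tw.d (k + 1) ^ m) * E \<ii>"
proof -
  note diffs = ev_var_diffs[OF i, where k = k and m = m]
  have "ev k \<ii> ((var_u - var_v) ^ m * (var_u - var_w) ^ m) = tw.d k ^ m * c ^ m * E \<ii>"
    "ev k \<ii> ((var_u - var_w) ^ m * (var_v - var_w) ^ m) = c ^ m * tw.d (k + 1) ^ m * E \<ii>"
    "ev k \<ii> ((var_u - var_v) ^ m * (var_v - var_w) ^ m) = tw.d k ^ m * tw.d (k + 1) ^ m * E \<ii>"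
    using ev_mult[OF i diffs(1) diffs(2) X_diff_power_E[OF i]]
      ev_mult[OF i diffs(2) diffs(3) X_diff_power_E[OF i]]
      ev_mult[OF i diffs(1) diffs(3) X_diff_power_E[OF i]]
    by (simp_all add: c_def tw.d_def)
  then show "ev k \<ii> (P3_pol Q j) =
      ((-1) ^ m * (tw.d k ^ m * c ^ m) - c ^ m * tw.d (k + 1) ^ m + tw.d k ^ m * tw.d (k + 1) ^ m) * E \<ii>"
    "ev k \<ii> (P3'_pol Q j) =
      (tw.d k ^ m * c ^ m - (-1) ^ m * (c ^ m * tw.d (k + 1) ^ m) - tw.d k ^ m * tw.d (k + 1) ^ m) * E \<ii>"
    unfolding P3_pol_Suc[OF m]
    by (simp_all only: rng_hom_add[OF rng_hom_ev[OF i]] rng_hom_diff[OF rng_hom_ev[OF i]]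
        ev_sign[OF i] left_diff_distrib distrib_right mult.assoc)
qed

text \<open>The symmetry of Q under exchanging both indices and arguments. Reversing the difference
  costs the sign of all arrows between \<open>a\<close> and \<open>b\<close>, which converts the
  sign of the arrows in one direction into that of the other.\<close>

lemma ev_Q_pol_swap:
  assumes i: "\<ii> \<in> Seqs Q \<nu>" and "a \<noteq> b"
  shows "ev (k + 1) \<ii> (Q_pol Q b a var_u var_v) = ev k \<ii> (Q_pol Q a b var_w var_v)"
proof -
  let ?N = "num_arrows Q a b + num_arrows Q b a"
  have "nat (- cartan Q b a) = ?N" "nat (- cartan Q a b) = ?N"
    using assms(2) by (auto simp: cartan_def nat_add_distrib)
  moreover have "(X (k + 2) - X (k + 1)) ^ ?N = (-1) ^ ?N * (X (k + 1) - X (k + 2)) ^ ?N"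
    by (metis minus_diff_eq power_minus)
  moreover have "(-1) ^ num_arrows Q a b * ((-1) ^ ?N * y) = (-1) ^ num_arrows Q b a * y" for y :: 'a
    by (simp add: power_add minus_one_power_iff)
  ultimately show ?thesis
    by (simp add: ev_Q_pol[OF i] mult.assoc)
qed

lemma braid_iff:
  assumes i: "\<ii> \<in> Seqs Q \<nu>" and k: "1 \<le> k" "k + 1 < n"
    and slides: "\<forall>\<ii>\<in>Seqs Q \<nu>. \<forall>k\<in>{1..<n}. tw.klr_slides k \<ii>"
    and squares: "\<forall>\<ii>\<in>Seqs Q \<nu>. \<forall>k\<in>{1..<n}.
      T k * T k * E \<ii> = h (eval_at Q \<nu> k (klr_square Q (ent \<ii> k) (ent \<ii> (k + 1)))) * E \<ii>"
  shows "tw.S_braid k \<ii> = h (kkp_braid Q \<nu> k \<ii>) \<longleftrightarrow>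
    tw.T_braid k \<ii> =
      h (eval_at Q \<nu> k (klr_braid Q (ent \<ii> k) (ent \<ii> (k + 1)) (ent \<ii> (k + 2)))) * E \<ii>"
proof (cases "ent \<ii> k = ent \<ii> (k + 2)")
  case False
  then have "h (kkp_braid Q \<nu> k \<ii>) = 0"
    by (auto simp: kkp_braid_def Let_def rng_hom_zero[OF hom])
  moreover have "klr_braid Q (ent \<ii> k) (ent \<ii> (k + 1)) (ent \<ii> (k + 2)) = 0"
    using False by (simp add: klr_braid_def)
  ultimately show ?thesis
    using tw.braid_distinct_ends[OF i k False] slides by (simp add: rng_hom_zero[OF rng_hom_eval3])
next
  case ends: True
  let ?a = "ent \<ii> k" and ?b = "ent \<ii> (k + 1)"
  have verts: "?a \<in> verts Q"
    using ent_verts[OF fin i, of k] k by simp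
  have k': "k < n" "1 \<le> k + 1" using k by simp_all
  have slides': "tw.klr_slides k \<jj>" if "\<jj> \<in> Seqs Q \<nu>" "1 \<le> k" "k < n" for \<jj> k
    using slides that by simp
  have kkp_middle: "h (kkp_braid Q \<nu> k \<ii>) = - ev k \<ii> (P_pol Q ?a var_u var_w * Q_quot Q ?a ?b)"
    if "?a \<noteq> ?b"
    using that ends by (simp add: kkp_braid_def Let_def rng_hom_uminus[OF hom] rng_hom_mult[OF hom] ev_def)
  have kkp_equal: "h (kkp_braid Q \<nu> k \<ii>) =
      ev k \<ii> (P3_pol Q ?a) * (S k * E \<ii>) + ev k \<ii> (P3'_pol Q ?a) * (S (k + 1) * E \<ii>)"
    if ab: "?a = ?b"
  proof -
    have bc: "?b = ent \<ii> (k + 1 + 1)" using ab ends by simp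
    have "h (kkp_braid Q \<nu> k \<ii>) =
        h (eval_at Q \<nu> k (P3_pol Q ?a)) * (S k * E \<ii>) + h (eval_at Q \<nu> k (P3'_pol Q ?a)) * (S (k + 1) * E \<ii>)"
      using ends ab k gen_Cross[OF i k(1) k'(1)] gen_Cross[OF i k'(2) k(2)]
      by (simp add: kkp_braid_def Let_def rng_hom_add[OF hom] rng_hom_mult[OF hom])
    then show ?thesis
      unfolding eval_at_mult_ev[OF i E_S[OF i k(1) k'(1) ab]] eval_at_mult_ev[OF i E_S[OF i k'(2) k(2) bc]] .
  qed
  show ?thesis
  proof (cases "num_loops Q ?a")
    case 0
    have kkp: "h (kkp_braid Q \<nu> k \<ii>) = - (if ?a = ?b then 0 else ev k \<ii> (Q_quot Q ?a ?b))"
      using kkp_equal kkp_middle ev_P_mult_Q_quot(1)[OF i 0] P3_pol_0[OF 0]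
      by (auto simp: rng_hom_zero[OF rng_hom_ev[OF i]])
    have "Q_quot Q ?a ?b = 0" if "?a \<noteq> ?b" "\<not> cartan Q ?a ?b < 0"
      using that by (intro Q_quot_eq_0) (simp add: cartan_def split: if_splits)
    then have "h (eval_at Q \<nu> k (klr_braid Q ?a ?b (ent \<ii> (k + 2)))) * E \<ii> =
        (if ?a = ?b then 0 else ev k \<ii> (Q_quot Q ?a ?b))"
      using ends 0 verts rng_hom_zero[OF rng_hom_ev[OF i], of k]
      by (auto simp: klr_braid_def mem_I_plus_iff ev_def rng_hom_zero[OF rng_hom_eval3])
    moreover have "x = - y \<longleftrightarrow> - x = y" for x y :: 'a
      by (metis minus_minus)
    ultimately show ?thesis
      unfolding kkp tw.braid_no_loops[OF i k ends 0] by (simp only:)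
  next
    case (Suc m)
    have klr: "h (eval_at Q \<nu> k (klr_braid Q ?a ?b (ent \<ii> (k + 2)))) * E \<ii> = 0"
      using Suc by (simp add: klr_braid_def mem_I_plus_iff rng_hom_zero[OF rng_hom_eval3])
    show ?thesis
    proof (cases "?a = ?b")
      case True
      have bc: "?b = ent \<ii> (k + 1 + 1)" and b: "num_loops Q ?b = Suc m"
        using True ends Suc by simp_all
      have "T k * T k * E \<ii> = (-1) ^ m * (tw.d k ^ m * tw.d k ^ m) * E \<ii>"
        unfolding ev_klr_square_loops[OF i True Suc, symmetric] using squares i k(1) k'(1) by auto
      moreover have "T (k + 1) * T (k + 1) * E \<ii> = (-1) ^ m * (tw.d (k + 1) ^ m * tw.d (k + 1) ^ m) * E \<ii>"
        unfolding ev_klr_square_loops[OF i bc b, symmetric] using squares i k(2) k'(2) by auto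
      ultimately have "tw.S_braid k \<ii> = tw.T_braid k \<ii> + h (kkp_braid Q \<nu> k \<ii>)"
        unfolding kkp_equal[OF True] ev_P3[OF i Suc] mult.assoc[of _ "E \<ii>"]
          E_S[OF i k(1) k'(1) True] E_S[OF i k'(2) k(2) bc]
        using tw.braid_equal_loops[OF i k True ends Suc slides'] by (simp add: add.assoc)
      then show ?thesis
        unfolding klr by auto
    next
      case False
      \<comment> \<open>The two squares in \<open>tw.braid_middle_loops\<close> are the values of Q
        at (x_k, x_{k+1}) and, by symmetry, at (x_{k+2}, x_{k+1}), so their difference is the
        numerator of \<open>Q_quot\<close>.\<close>
      have sq1: "S k * S k * E \<ii> = ev k \<ii> (Q_pol Q ?a ?b var_u var_v)"
        using squares i k k' False tw.square_unequal[OF i k(1) k'(1) False]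
        by (simp add: klr_square_def ev_def)
      have ne: "?b \<noteq> ent \<ii> (k + 1 + 1)"
        using False ends by simp
      have "S (k + 1) * S (k + 1) * E \<ii> = ev (k + 1) \<ii> (Q_pol Q ?b ?a var_u var_v)"
        using squares i k k' False ends tw.square_unequal[OF i k'(2) k(2) ne]
        by (simp add: klr_square_def ev_def)
      also have "\<dots> = ev k \<ii> (Q_pol Q ?a ?b var_w var_v)"
        by (rule ev_Q_pol_swap[OF i False])
      finally have sq2: "S (k + 1) * S (k + 1) * E \<ii> = ev k \<ii> (Q_pol Q ?a ?b var_w var_v)" .
      have "tw.T_braid k \<ii> = tw.S_braid k \<ii> +
          (X k - X (k + 2)) ^ m * (S k * S k * E \<ii> - S (k + 1) * S (k + 1) * E \<ii>)"
        using slides' by (intro tw.braid_middle_loops[OF i k ends False Suc])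
      then have "tw.T_braid k \<ii> = tw.S_braid k \<ii> - h (kkp_braid Q \<nu> k \<ii>)"
        unfolding kkp_middle[OF False] ev_P_mult_Q_quot(2)[OF i Suc] sq1 sq2 by simp
      then show ?thesis
        unfolding klr by auto
    qed
  qed
qed

text \<open>The slides are equivalent outright. Given them, so are the distant and the quadratic
  relations, and given slides and squares also the braids; hence the conjunctions agree.\<close>

lemma kkp_iff_klr:
  "(\<forall>r\<in>kkp_rels Q \<nu>. h r = 0) \<longleftrightarrow> (\<forall>r\<in>klr_rels Q \<nu>. h (subst (twist Q 1) r) = 0)"
proof -
  have hom': "rng_hom (\<lambda>p. h (subst (twist Q 1) p))"
    by (rule rng_hom_comp[OF hom rng_hom_subst])
  define slides where "slides \<longleftrightarrow> (\<forall>\<ii>\<in>Seqs Q \<nu>. \<forall>k\<in>{1..<n}. tw.klr_slides k \<ii>)"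
  define squares where "squares \<longleftrightarrow> (\<forall>\<ii>\<in>Seqs Q \<nu>. \<forall>k\<in>{1..<n}.
      T k * T k * E \<ii> = h (eval_at Q \<nu> k (klr_square Q (ent \<ii> k) (ent \<ii> (k + 1)))) * E \<ii>)"
  have sq: "(\<forall>\<ii>\<in>Seqs Q \<nu>. \<forall>k\<in>{1..<n}. S k * S k * E \<ii> = h (kkp_square Q \<nu> k \<ii>)) \<longleftrightarrow> squares"
    if slides
    unfolding squares_def using square_iff that by (simp add: slides_def)
  have br: "(\<forall>\<ii>\<in>Seqs Q \<nu>. \<forall>k\<in>{1..<n}. k + 1 < n \<longrightarrow> tw.S_braid k \<ii> = h (kkp_braid Q \<nu> k \<ii>)) \<longleftrightarrow>
    (\<forall>\<ii>\<in>Seqs Q \<nu>. \<forall>k\<in>{1..<n}. k + 1 < n \<longrightarrow> tw.T_braid k \<ii> =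
      h (eval_at Q \<nu> k (klr_braid Q (ent \<ii> k) (ent \<ii> (k + 1)) (ent \<ii> (k + 2)))) * E \<ii>)"
    if slides squares
    using braid_iff that unfolding slides_def squares_def by (metis atLeastLessThan_iff)
  have far: "far_eqs Q \<nu> h \<longleftrightarrow> far_eqs Q \<nu> (\<lambda>p. h (subst (twist Q 1) p))" if slides
    using far_iff slides_iff that by (simp add: slides_def)
  have "(\<forall>r\<in>kkp_rels Q \<nu>. h r = 0) \<longleftrightarrow> far_eqs Q \<nu> h \<and>
      (\<forall>\<ii>\<in>Seqs Q \<nu>. \<forall>k\<in>{1..<n}. S k * S k * E \<ii> = h (kkp_square Q \<nu> k \<ii>)) \<and> slides \<and>
      (\<forall>\<ii>\<in>Seqs Q \<nu>. \<forall>k\<in>{1..<n}. k + 1 < n \<longrightarrow> tw.S_braid k \<ii> = h (kkp_braid Q \<nu> k \<ii>))"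
    unfolding kkp_rels_eqs[OF hom] slides_def slides_iff[symmetric] kkp_slides_eq[symmetric] tw.S_braid_def
    using base by blast
  moreover have "(\<forall>r\<in>klr_rels Q \<nu>. h (subst (twist Q 1) r) = 0) \<longleftrightarrow>
      far_eqs Q \<nu> (\<lambda>p. h (subst (twist Q 1) p)) \<and> squares \<and> slides \<and>
      (\<forall>\<ii>\<in>Seqs Q \<nu>. \<forall>k\<in>{1..<n}. k + 1 < n \<longrightarrow> tw.T_braid k \<ii> =
        h (eval_at Q \<nu> k (klr_braid Q (ent \<ii> k) (ent \<ii> (k + 1)) (ent \<ii> (k + 2)))) * E \<ii>)"
    unfolding klr_rels_eqs[OF hom'] slides_def klr_slides_eq[symmetric] squares_def tw.T_braid_def
      subst_twist_dot subst_twist_eval_at subst_gen twist.simps(1)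
    using base_eqs_twist[of 1] by blast
  ultimately show ?thesis
    using sq br far by blast
qed

end


section \<open>The isomorphism of presentations\<close>

lemma twist_grade:
  assumes e: "e = 1 \<or> e = - 1" and g: "g \<in> gens Q \<nu>"
  shows "twist Q e g \<in> grade (free_alg (gens Q \<nu>) (gen_deg Q)) (gen_deg Q g)"
proof (cases g)
  case (Cross k \<ii>)
  let ?G = "grade (free_alg (gens Q \<nu>) (gen_deg Q))"
  have i: "\<ii> \<in> Seqs Q \<nu>" and k: "1 \<le> k" "k < size_of Q \<nu>"
    using g Cross by (auto simp: gens_def)
  have cross: "gen (Cross k \<ii>) \<in> ?G (gen_deg Q (Cross k \<ii>))"
    using grade_gen[OF g, of "gen_deg Q"] Cross by (simp del: gen_deg.simps)
  have "gen (Dot l \<ii>) \<in> ?G 2" if "l = k \<or> l = k + 1" for l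
    using grade_gen[of "Dot l \<ii>" "gens Q \<nu>" "gen_deg Q"] i k that by (auto simp: gens_def)
  then have "gen (Dot k \<ii>) - gen (Dot (k + 1) \<ii>) \<in> ?G 2"
    by (intro grade_diff) auto
  moreover have "idm \<ii> \<in> ?G 0"
    using grade_gen[of "Idemp \<ii>" "gens Q \<nu>" "gen_deg Q"] i by (auto simp: gens_def)
  ultimately have "(gen (Dot k \<ii>) - gen (Dot (k + 1) \<ii>)) ^ m * idm \<ii> \<in> ?G (int m * 2 + 0)" for m
    by (intro grade_mult grade_power)
  then have shift: "e * ((gen (Dot k \<ii>) - gen (Dot (k + 1) \<ii>)) ^ m * idm \<ii>) \<in> ?G (int m * 2)" for m
    using e by (auto intro!: grade_uminus)
  have twisted: "e * ((gen (Dot k \<ii>) - gen (Dot (k + 1) \<ii>)) ^ (num_loops Q (ent \<ii> k) - 1) * idm \<ii>)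
      \<in> ?G (gen_deg Q (Cross k \<ii>))"
    if "ent \<ii> k = ent \<ii> (k + 1)" "num_loops Q (ent \<ii> k) \<noteq> 0"
  proof -
    \<comment> \<open>Dots have degree 2, and twice the number of loops minus 2 is the degree of a
      crossing of two equal vertices.\<close>
    have "int (num_loops Q (ent \<ii> k) - 1) * 2 = gen_deg Q (Cross k \<ii>)"
      using that by (simp add: cartan_def of_nat_diff)
    then show ?thesis
      using shift[of "num_loops Q (ent \<ii> k) - 1"] by (simp only:)
  qed
  show ?thesis
  proof (cases "ent \<ii> k = ent \<ii> (k + 1) \<and> num_loops Q (ent \<ii> k) \<noteq> 0")
    case True
    then have tw: "twist Q e g = gen (Cross k \<ii>) +
        e * ((gen (Dot k \<ii>) - gen (Dot (k + 1) \<ii>)) ^ (num_loops Q (ent \<ii> k) - 1) * idm \<ii>)"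
      by (auto simp: Cross)
    show ?thesis
      unfolding tw using grade_add[OF cross twisted[OF conjunct1[OF True] conjunct2[OF True]]]
      by (simp only: Cross)
  next
    case False
    then have "twist Q e g = gen (Cross k \<ii>) \<or> twist Q e g = - gen (Cross k \<ii>)"
      by (auto simp: Cross)
    then show ?thesis
      using cross grade_uminus[OF cross] by (auto simp only: Cross)
  qed
qed (use grade_gen[OF g, of "gen_deg Q"] in simp_all)

lemma twist_iso:
  "subst (twist Q 1) \<in> gr_alg_iso (free_alg (gens Q \<nu>) (gen_deg Q)) (free_alg (gens Q \<nu>) (gen_deg Q))"
  by (rule subst_gr_alg_iso[where f' = "twist Q (- 1)"]) (simp_all only: twist_grade twist_inverse simp_thms)

section \<open>Identification of the two ideals\<close>

context
  fixes Q :: "('i, 'h) pre_digraph" and \<nu> :: "'i \<Rightarrow> nat"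
  assumes fin: "fin_digraph Q"
begin

abbreviation (input) A where "A \<equiv> free_alg (gens Q \<nu>) (gen_deg Q)"

lemma idm_closed: "\<ii> \<in> Seqs Q \<nu> \<Longrightarrow> idm \<ii> \<in> carrier A"
  and gen_Cross_closed: "\<ii> \<in> Seqs Q \<nu> \<Longrightarrow> 1 \<le> k \<Longrightarrow> k < size_of Q \<nu> \<Longrightarrow> gen (Cross k \<ii>) \<in> carrier A"
  and gen_Dot_closed: "\<ii> \<in> Seqs Q \<nu> \<Longrightarrow> 1 \<le> k \<Longrightarrow> k \<le> size_of Q \<nu> \<Longrightarrow> gen (Dot k \<ii>) \<in> carrier A"
  by (auto intro!: free_alg_carrierI simp: gens_def)

lemma dot_closed: "1 \<le> k \<Longrightarrow> k \<le> size_of Q \<nu> \<Longrightarrow> dot Q \<nu> k \<in> carrier A"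
  unfolding dot_def by (intro free_alg_carrier_sum gen_Dot_closed)

lemma cross_closed: "1 \<le> k \<Longrightarrow> k < size_of Q \<nu> \<Longrightarrow> cross Q \<nu> k \<in> carrier A"
  unfolding cross_def by (intro free_alg_carrier_sum gen_Cross_closed)

text \<open>Only \<open>dot Q \<nu> (k + 2)\<close> at the last crossing can be out of range; there
  \<open>degree p = 0\<close> leaves just its zeroth power.\<close>

lemma eval_at_closed:
  assumes "1 \<le> k" "k < size_of Q \<nu>" "k + 1 < size_of Q \<nu> \<or> degree p = 0"
  shows "eval_at Q \<nu> k p \<in> carrier A"
proof -
  have "dot Q \<nu> (k + 2) ^ c \<in> carrier A" if "c \<le> degree p" for c
  proof (cases "degree p = 0")
    case True
    then show ?thesis using that by (simp add: free_alg_closed)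
  next
    case False
    then show ?thesis using assms by (intro free_alg_carrier_power dot_closed) auto
  qed
  moreover have "dot Q \<nu> k ^ a \<in> carrier A" "dot Q \<nu> (k + 1) ^ a \<in> carrier A" for a
    using assms by (auto intro!: free_alg_carrier_power dot_closed)
  ultimately show ?thesis
    unfolding eval_at_def
    by (intro free_alg_carrier_sum free_alg_carrier_mult free_alg_carrierI) auto
qed

lemma swap_closed:
  "\<ii> \<in> Seqs Q \<nu> \<Longrightarrow> 1 \<le> k \<Longrightarrow> k < size_of Q \<nu> \<Longrightarrow> swap_seq k \<ii> \<in> Seqs Q \<nu>"
  using swap_seq_Seqs[of k \<ii> Q \<nu>] length_Seqs[OF fin, of \<ii> \<nu>] by auto

lemmas algebra_closed = free_alg_carrier_add free_alg_carrier_mult free_alg_carrier_uminus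
  free_alg_carrier_diff free_alg_carrier_power free_alg_carrierI(1,2) idm_closed gen_Cross_closed gen_Dot_closed
  dot_closed cross_closed swap_closed eval_at_closed

lemma common_rels_closed: "common_rels Q \<nu> \<subseteq> carrier A"
proof
  fix r assume "r \<in> common_rels Q \<nu>"
  then show "r \<in> carrier A"
    by cases (auto intro!: algebra_closed free_alg_carrier_sum)
qed

lemma klr_rels_closed: "klr_rels Q \<nu> \<subseteq> carrier A"
proof
  fix r assume "r \<in> klr_rels Q \<nu>"
  then show "r \<in> carrier A"
  proof cases
    case common
    then show ?thesis using common_rels_closed by blast
  next
    case (square \<ii> k)
    then show ?thesis
      by (auto simp: degree_klr_square intro!: algebra_closed)
  next
    case (braid \<ii> k)
    then show ?thesis
      by (auto intro!: algebra_closed)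
  qed (auto intro!: algebra_closed)
qed

lemma kkp_rels_closed: "kkp_rels Q \<nu> \<subseteq> carrier A"
proof
  fix r assume "r \<in> kkp_rels Q \<nu>"
  then show "r \<in> carrier A"
  proof cases
    case common
    then show ?thesis using common_rels_closed by blast
  next
    case (square \<ii> k)
    then show ?thesis
      by (auto simp: kkp_square_def Let_def degree_dP_pol degree_Q_pol intro!: algebra_closed)
  next
    case (slide \<ii> k l)
    have "1 \<le> Transposition.transpose k (k + 1) l" "Transposition.transpose k (k + 1) l \<le> size_of Q \<nu>"
      using slide by (auto simp: Transposition.transpose_def)
    then show ?thesis
      using slide by (auto simp: kkp_slide_def Let_def degree_P_pol intro!: algebra_closed)
  next
    case (braid \<ii> k)
    have "eval_at Q \<nu> k p \<in> carrier A" for p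
      using braid by (intro eval_at_closed) auto
    then show ?thesis
      using braid by (simp add: kkp_braid_def Let_def algebra_closed)
  qed
qed

lemma twist_Idl: "subst (twist Q 1) ` (Idl\<^bsub>A\<^esub> (klr_rels Q \<nu>)) = Idl\<^bsub>A\<^esub> (kkp_rels Q \<nu>)"
proof -
  interpret A: ring A by (rule ring_free_alg)
  have closed: "subst (twist Q e) p \<in> carrier A" if "p \<in> carrier A" "e = 1 \<or> e = - 1" for p e
    using that twist_grade grade_carrier by (intro subst_closed[OF _ that(1)]) blast
  \<comment> \<open>On the free algebra on the generators, reduction modulo the extended ideal
    detects exactly membership in the ideal, so relations become equations in a ring and
    conversely.\<close>
  have kills: "\<forall>r\<in>R. at_ideal (extended_ideal (gens Q \<nu>) (Idl\<^bsub>A\<^esub> R)) r = 0"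
    and vanish: "Dot k \<ii> \<notin> gens Q \<nu> \<Longrightarrow>
      at_ideal (extended_ideal (gens Q \<nu>) (Idl\<^bsub>A\<^esub> R)) (gen (Dot k \<ii>)) = 0"
    and mem: "\<And>p. p \<in> carrier A \<Longrightarrow>
      at_ideal (extended_ideal (gens Q \<nu>) (Idl\<^bsub>A\<^esub> R)) p = 0 \<Longrightarrow> p \<in> Idl\<^bsub>A\<^esub> R"
    if "R \<subseteq> carrier A" for R and k :: nat and \<ii> :: "'i list"
  proof -
    have J: "ideal (Idl\<^bsub>A\<^esub> R) A"
      using that by (rule A.genideal_ideal)
    note iff = at_ideal_eq_0_iff[OF two_sided_ideal_extended[OF J]]
    show "\<forall>r\<in>R. at_ideal (extended_ideal (gens Q \<nu>) (Idl\<^bsub>A\<^esub> R)) r = 0"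
      using A.genideal_self[OF that] that by (auto simp: iff mem_extended_ideal_iff subset_iff)
    show "at_ideal (extended_ideal (gens Q \<nu>) (Idl\<^bsub>A\<^esub> R)) (gen (Dot k \<ii>)) = 0"
      if "Dot k \<ii> \<notin> gens Q \<nu>"
      using gen_mem_extended_ideal[OF J that] by (simp add: iff)
    show "p \<in> Idl\<^bsub>A\<^esub> R" if "p \<in> carrier A"
      "at_ideal (extended_ideal (gens Q \<nu>) (Idl\<^bsub>A\<^esub> R)) p = 0" for p
      using that by (simp add: iff mem_extended_ideal_iff)
  qed
  show ?thesis
  proof (rule Idl_image_eq[OF ring_free_alg ring_free_alg _ klr_rels_closed kkp_rels_closed])
    show "subst (twist Q 1) \<in> ring_iso A A"
      using twist_iso by (auto simp: gr_alg_iso_def)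
    define h where "h = at_ideal (extended_ideal (gens Q \<nu>) (Idl\<^bsub>A\<^esub> (kkp_rels Q \<nu>)))"
    have h: "rng_hom h" "\<forall>r\<in>kkp_rels Q \<nu>. h r = 0"
      using kills[OF kkp_rels_closed] rng_hom_at_ideal by (simp_all add: h_def)
    have base: "base_eqs Q \<nu> h"
      using kkp_rels_eqs[OF h(1)] h(2) by blast
    interpret h: dot_eval Q \<nu> h
      by (rule dot_eval.intro[OF fin h(1) base]) (simp add: h_def vanish[OF kkp_rels_closed])
    show "subst (twist Q 1) ` klr_rels Q \<nu> \<subseteq> Idl\<^bsub>A\<^esub> (kkp_rels Q \<nu>)"
    proof (rule image_subsetI)
      fix r assume r: "r \<in> klr_rels Q \<nu>"
      then have "h (subst (twist Q 1) r) = 0"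
        using h.kkp_iff_klr h(2) by simp
      moreover have "subst (twist Q 1) r \<in> carrier A"
        using closed r klr_rels_closed by blast
      ultimately show "subst (twist Q 1) r \<in> Idl\<^bsub>A\<^esub> (kkp_rels Q \<nu>)"
        using mem[OF kkp_rels_closed] by (simp add: h_def)
    qed
  next
    define h where "h = at_ideal (extended_ideal (gens Q \<nu>) (Idl\<^bsub>A\<^esub> (klr_rels Q \<nu>)))"
    have h: "rng_hom h" "\<forall>r\<in>klr_rels Q \<nu>. h r = 0"
      using kills[OF klr_rels_closed] rng_hom_at_ideal by (simp_all add: h_def)
    have base: "base_eqs Q \<nu> h"
      using klr_rels_eqs[OF h(1)] h(2) by blast
    interpret h: dot_eval Q \<nu> h
      by (rule dot_eval.intro[OF fin h(1) base]) (simp add: h_def vanish[OF klr_rels_closed])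
    \<comment> \<open>\<open>kkp_iff_klr\<close> puts the twist on the side of \<tau>. Starting with
      the inverse twist makes the map on that side the plain reduction \<open>h\<close>, which kills
      the KLR relations.\<close>
    define g where "g = (\<lambda>p. h (subst (twist Q (- 1)) p))"
    interpret g: dot_eval Q \<nu> g
      unfolding g_def
      by (rule dot_eval.intro[OF fin rng_hom_comp[OF h(1) rng_hom_subst] h.base_eqs_twist])
        (simp_all add: h.dots_vanish)
    have inverse: "subst (twist Q (- 1)) (subst (twist Q 1) p) = p"
      "subst (twist Q 1) (subst (twist Q (- 1)) p) = p" for p
      by (simp_all only: subst_subst twist_inverse) (simp_all add: subst_gen_id)
    have "\<forall>r\<in>kkp_rels Q \<nu>. g r = 0"
      unfolding g.kkp_iff_klr using h(2) by (simp add: g_def inverse)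
    moreover have "subst (twist Q (- 1)) r \<in> carrier A" if "r \<in> kkp_rels Q \<nu>" for r
      using closed kkp_rels_closed that by blast
    ultimately have "subst (twist Q (- 1)) r \<in> Idl\<^bsub>A\<^esub> (klr_rels Q \<nu>)" if "r \<in> kkp_rels Q \<nu>" for r
      using mem[OF klr_rels_closed] that by (simp add: g_def h_def)
    then show "kkp_rels Q \<nu> \<subseteq> subst (twist Q 1) ` (Idl\<^bsub>A\<^esub> (klr_rels Q \<nu>))"
      using inverse(2) by (metis image_eqI subsetI)
  qed
qed

lemma KLR_iso:
  "(`) (subst (twist Q 1)) \<in> gr_alg_iso (KLR Q \<nu>) (presented_alg (gens Q \<nu>) (gen_deg Q) (kkp_rels Q \<nu>))"
proof -
  interpret A: ring A by (rule ring_free_alg)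
  show ?thesis
    unfolding KLR_def presented_alg_def twist_Idl[symmetric]
    by (rule gr_alg_iso_quot[OF ring_free_alg ring_free_alg twist_iso A.genideal_ideal[OF klr_rels_closed]])
      (simp_all add: free_alg_closed grade_carrier)
qed

lemma KLR_iso_class:
  assumes "g \<in> gens Q \<nu>"
  shows "subst (twist Q 1) ` klr_class Q \<nu> g = Idl\<^bsub>A\<^esub> (kkp_rels Q \<nu>) +>\<^bsub>A\<^esub> twist Q 1 g"
proof -
  interpret A: ring A by (rule ring_free_alg)
  have "ring_hom_ring A A (subst (twist Q 1))"
    using twist_iso by (auto simp: gr_alg_iso_def ring_iso_def intro!: ring_hom_ringI2 ring_free_alg)
  moreover have "Idl\<^bsub>A\<^esub> (klr_rels Q \<nu>) \<subseteq> carrier A"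
    using ideal.Icarr[OF A.genideal_ideal[OF klr_rels_closed]] by blast
  ultimately show ?thesis
    unfolding klr_class_def gen_class_def using assms
    by (subst a_r_coset_image) (simp_all add: free_alg_closed twist_Idl)
qed

end

theorem proposition3p4:
  fixes Q :: "('i, 'h) pre_digraph" and \<nu> :: "'i \<Rightarrow> nat"
    and x \<sigma> :: "nat \<Rightarrow> 'i list \<Rightarrow> ('i, 'h) conv"
  assumes "fin_digraph Q"
    and "\<And>i. i \<notin> verts Q \<Longrightarrow> \<nu> i = 0"
    and "kkp_generators Q \<nu> x \<sigma>"
  shows "\<exists>\<Phi> \<in> gr_alg_iso (KLR Q \<nu>) (conv_alg Q \<nu>).
    (\<forall>\<ii>\<in>Seqs Q \<nu>. \<Phi> (klr_class Q \<nu> (Idemp \<ii>)) = conv_idem Q \<nu> \<ii>) \<and>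
    (\<forall>\<ii>\<in>Seqs Q \<nu>. \<forall>k\<in>{1..size_of Q \<nu>}. \<Phi> (klr_class Q \<nu> (Dot k \<ii>)) = x k \<ii>) \<and>
    (\<forall>\<ii>\<in>Seqs Q \<nu>. \<forall>k\<in>{1..<size_of Q \<nu>}.
       \<Phi> (klr_class Q \<nu> (Cross k \<ii>)) = tau_image Q \<nu> x \<sigma> k \<ii>)"
proof -
  let ?S = "gens Q \<nu>" and ?n = "size_of Q \<nu>"
  let ?A = "free_alg ?S (gen_deg Q)" and ?C = "conv_alg Q \<nu>"
  let ?J = "Idl\<^bsub>?A\<^esub> (kkp_rels Q \<nu>)"
  note fin = assms(1)
  interpret A: ring ?A by (rule ring_free_alg)
  have J: "ideal ?J ?A"
    by (rule A.genideal_ideal[OF kkp_rels_closed[OF fin]])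
  obtain \<Psi> where \<Psi>: "\<Psi> \<in> gr_alg_iso (quot_alg ?A ?J) ?C"
    and idem: "\<And>\<ii>. \<ii> \<in> Seqs Q \<nu> \<Longrightarrow> \<Psi> (?J +>\<^bsub>?A\<^esub> idm \<ii>) = conv_idem Q \<nu> \<ii>"
    and dots: "\<And>\<ii> k. \<ii> \<in> Seqs Q \<nu> \<Longrightarrow> k \<in> {1..?n} \<Longrightarrow> \<Psi> (?J +>\<^bsub>?A\<^esub> gen (Dot k \<ii>)) = x k \<ii>"
    and crosses: "\<And>\<ii> k. \<ii> \<in> Seqs Q \<nu> \<Longrightarrow> k \<in> {1..<?n} \<Longrightarrow> \<Psi> (?J +>\<^bsub>?A\<^esub> gen (Cross k \<ii>)) = \<sigma> k \<ii>"
    using assms(3) unfolding kkp_generators_def Let_def presented_alg_def gen_class_def by blast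
  define \<Phi> where "\<Phi> = \<Psi> \<circ> (`) (subst (twist Q 1))"
  \<comment> \<open>\<Phi> takes the class of a generator to \<pi> of its twist, and \<pi> is a ring
    homomorphism from the free algebra, so sums, signs and powers can be computed term by
    term.\<close>
  define \<pi> where "\<pi> = (\<lambda>p. \<Psi> (?J +>\<^bsub>?A\<^esub> p))"
  have iso: "\<Phi> \<in> gr_alg_iso (KLR Q \<nu>) ?C"
    unfolding \<Phi>_def using KLR_iso[OF fin] \<Psi> by (intro gr_alg_iso_comp) (simp_all add: presented_alg_def)
  have \<Phi>: "\<Phi> (klr_class Q \<nu> g) = \<pi> (twist Q 1 g)" if "g \<in> ?S" for g
    using KLR_iso_class[OF fin that] by (simp add: \<Phi>_def \<pi>_def)
  have quot: "(+>\<^bsub>?A\<^esub>) ?J \<in> ring_hom ?A (quot_alg ?A ?J)"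
    using ideal.rcos_ring_hom[OF J] by (simp add: ring_hom_def quot_alg_def)
  have "ring ?C"
    using gr_alg_iso_ring[OF ring_quot_alg[OF J] \<Psi>] .
  moreover have "\<pi> \<in> ring_hom ?A ?C"
    using ring_hom_trans[OF quot, of \<Psi> ?C] \<Psi> by (simp add: \<pi>_def comp_def gr_alg_iso_def ring_iso_def)
  ultimately interpret \<pi>: ring_hom_ring ?A ?C \<pi>
    by (intro ring_hom_ringI2 ring_free_alg)
  have "\<Phi> (klr_class Q \<nu> (Cross k \<ii>)) = tau_image Q \<nu> x \<sigma> k \<ii>"
    if i: "\<ii> \<in> Seqs Q \<nu>" and k: "k \<in> {1..<?n}" for \<ii> k
  proof -
    have verts: "ent \<ii> k \<in> verts Q"
      using ent_verts[OF fin i, of k] k by simp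
    have closed: "gen (Cross k \<ii>) \<in> carrier ?A" "gen (Dot k \<ii>) \<in> carrier ?A"
      "gen (Dot (k + 1) \<ii>) \<in> carrier ?A" "idm \<ii> \<in> carrier ?A"
      using i k by (auto intro!: idm_closed gen_Cross_closed gen_Dot_closed fin)
    have vals: "\<pi> (gen (Cross k \<ii>)) = \<sigma> k \<ii>" "\<pi> (gen (Dot k \<ii>)) = x k \<ii>"
      "\<pi> (gen (Dot (k + 1) \<ii>)) = x (k + 1) \<ii>" "\<pi> (idm \<ii>) = conv_idem Q \<nu> \<ii>"
      using i k crosses dots idem by (simp_all add: \<pi>_def)
    have uminus: "\<pi> (- gen (Cross k \<ii>)) = \<ominus>\<^bsub>?C\<^esub> \<sigma> k \<ii>"
      using \<pi>.hom_a_inv[OF closed(1)] by (simp add: free_alg_a_inv[OF closed(1)] vals)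
    have "\<pi> (- gen (Dot (k + 1) \<ii>)) = \<ominus>\<^bsub>?C\<^esub> x (k + 1) \<ii>"
      using \<pi>.hom_a_inv[OF closed(3)] unfolding free_alg_a_inv[OF closed(3)] vals .
    then have diff: "\<pi> (gen (Dot k \<ii>) - gen (Dot (k + 1) \<ii>)) = x k \<ii> \<ominus>\<^bsub>?C\<^esub> x (k + 1) \<ii>"
      using \<pi>.hom_add[OF closed(2) free_alg_carrier_uminus[OF closed(3)]]
      by (simp add: vals a_minus_def)
    have power: "\<pi> ((gen (Dot k \<ii>) - gen (Dot (k + 1) \<ii>)) ^ m) =
        (x k \<ii> \<ominus>\<^bsub>?C\<^esub> x (k + 1) \<ii>) [^]\<^bsub>?C\<^esub> m" for m
      using \<pi>.hom_nat_pow[OF free_alg_carrier_diff[OF closed(2,3)], of m]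
      by (simp only: free_alg_nat_pow diff)
    have "\<pi> (gen (Cross k \<ii>) + 1 * ((gen (Dot k \<ii>) - gen (Dot (k + 1) \<ii>)) ^ m * idm \<ii>)) =
        \<sigma> k \<ii> \<oplus>\<^bsub>?C\<^esub> ((x k \<ii> \<ominus>\<^bsub>?C\<^esub> x (k + 1) \<ii>) [^]\<^bsub>?C\<^esub> m) \<otimes>\<^bsub>?C\<^esub> conv_idem Q \<nu> \<ii>" for m
      using \<pi>.hom_add[OF closed(1) free_alg_carrier_mult[OF free_alg_carrier_power[OF
            free_alg_carrier_diff[OF closed(2,3)]] closed(4)]]
        \<pi>.hom_mult[OF free_alg_carrier_power[OF free_alg_carrier_diff[OF closed(2,3)]] closed(4)]
      by (simp add: vals power[simplified])
    \<comment> \<open>The exponent in the prescribed image, expressed by the number of loops as in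
      \<open>twist\<close>.\<close>
    moreover have "nat (- cartan Q i i div 2) = num_loops Q i - 1" if "num_loops Q i \<noteq> 0" for i
      using that by (simp add: cartan_def)
    moreover have "Cross k \<ii> \<in> ?S"
      using i k by (auto simp: gens_def)
    ultimately show ?thesis
      using verts uminus vals(1)
      by (simp add: \<Phi> tau_image_def Let_def mem_I_plus_iff mem_I_le0_iff)
  qed
  moreover have "\<Phi> (klr_class Q \<nu> (Idemp \<ii>)) = conv_idem Q \<nu> \<ii>" if "\<ii> \<in> Seqs Q \<nu>" for \<ii>
    using that \<Phi>[of "Idemp \<ii>"] idem by (simp add: gens_def \<pi>_def)
  moreover have "\<Phi> (klr_class Q \<nu> (Dot k \<ii>)) = x k \<ii>" if "\<ii> \<in> Seqs Q \<nu>" "k \<in> {1..?n}" for \<ii> k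
    using that \<Phi>[of "Dot k \<ii>"] dots by (simp add: gens_def \<pi>_def)
  ultimately show ?thesis
    using iso by (intro bexI[of _ \<Phi>] conjI ballI)
qed

end
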